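(* For every $\delta\in(0,1/2)$ there exists $e_0=e_0(\delta)>0$ with the following property: for every integer $e\geqslant e_0$ and every constant $c>0$, there are only finitely many tight relative $2e$-designs $(Y,\omega)$ (counted up to positive scalar multiples of $\omega$, with $n$, $\ell$, $m$ allowed to vary) in $\mathcal{Q}_n$ supported on two shells $X_\ell\sqcup X_m$ with $e\leqslant\ell<m\leqslant n-\ell$ and $\ell<c\cdot n^{\delta}$.
   Context: The $n$-cube $\mathcal{Q}_n$: vertex set $X=\{0,1\}^n$ with Hamming distance $\partial$. For each $n$ a base vertex $x\in X$ is fixed; $\hat x$ is its characteristic vector and $X_i=\{y:\partial(x,y)=i\}$ are the shells. Let $V=\mathbb{C}^X$, $A_1$ the adjacency matrix of $\mathcal{Q}_n$, and $E_i$ ($0\le i\le n$) the orthogonal projection onto the eigenspace of $A_1$ with eigenvalue $n-2i$; $E_i^*$ is the diagonal 0/1 matrix with $(E_i^* )_{y,y}=1$ iff $y\in X_i$. A weighted subset is a pair $(Y,\omega)$ with $\omega:X\to[0,\infty)$ and $Y=\{y:\omega(y)>0\}$; it is a relative $t$-design if $E_i\omega\in\operatorname{span}\{E_i\hat x\}$ for $1\le i\le t$. It is supported on two shells $X_\ell\sqcup X_m$ if $Y\subseteq X_\ell\cup X_m$ and $Y$ meets both. A relative $2e$-design supported on $X_\ell\sqcup X_m$ satisfies $|Y|\ge\dim(E_\ell^*+E_m^* )(\sum_{i=0}^eE_iV)$ and is tight if equality holds; when $e\le\ell<m\le n-\ell$ this bound equals $\binom{n}{e}+\binom{n}{e-1}$.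 *)

theory Defs
  imports Complex_Main "HOL-Library.Function_Algebras" "HOL-Library.Set_Algebras"
begin

type_synonym vertex = "bool list"
type_synonym cvec = "vertex \<Rightarrow> complex"
type_synonym cmat = "vertex \<Rightarrow> vertex \<Rightarrow> complex"

definition cube :: "nat \<Rightarrow> vertex set" where
  "cube n = {y. length y = n}"

definition hdist :: "vertex \<Rightarrow> vertex \<Rightarrow> nat" where
  "hdist y z = card {i. i < length y \<and> y ! i \<noteq> z ! i}"

definition shell :: "nat \<Rightarrow> vertex \<Rightarrow> nat \<Rightarrow> vertex set" where
  "shell n x i = {y \<in> cube n. hdist x y = i}"

text \<open>
  The dimension \<open>n\<close> varies inside the statement, so vectors indexed by the vertices of the
  \<open>n\<close>-cube are functions on all bit strings that vanish off \<open>cube n\<close>.  Addition of vectors is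
  pointwise (\<open>Function_Algebras\<close>), and \<open>+\<close>, \<open>\<Sum>\<close> on sets of vectors are Minkowski sums
  (\<open>Set_Algebras\<close>).
\<close>

definition cscale :: "complex \<Rightarrow> cvec \<Rightarrow> cvec" where
  "cscale a v = (\<lambda>y. a * v y)"

interpretation cvec: vector_space cscale
  by unfold_locales (auto simp: cscale_def fun_eq_iff algebra_simps)

definition vecs :: "nat \<Rightarrow> cvec set" where
  "vecs n = {v. \<forall>y. y \<notin> cube n \<longrightarrow> v y = 0}"

definition herm :: "nat \<Rightarrow> cvec \<Rightarrow> cvec \<Rightarrow> complex" where
  "herm n u v = (\<Sum>y\<in>cube n. u y * cnj (v y))"

definition mat_app :: "nat \<Rightarrow> cmat \<Rightarrow> cvec \<Rightarrow> cvec" where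
  "mat_app n M v = (\<lambda>y. if y \<in> cube n then \<Sum>z\<in>cube n. M y z * v z else 0)"

definition char_vec :: "vertex \<Rightarrow> cvec" where
  "char_vec x = (\<lambda>y. of_bool (y = x))"

definition A1 :: cmat where
  "A1 = (\<lambda>y z. of_bool (hdist y z = 1))"

definition eigsp :: "nat \<Rightarrow> nat \<Rightarrow> cvec set" where
  "eigsp n i = {v \<in> vecs n. mat_app n A1 v = cscale (of_nat n - 2 * of_nat i) v}"

definition orth_proj :: "nat \<Rightarrow> cvec set \<Rightarrow> cvec \<Rightarrow> cvec" where
  "orth_proj n W v = (THE u. u \<in> W \<and> (\<forall>w\<in>W. herm n (v - u) w = 0))"

definition E :: "nat \<Rightarrow> nat \<Rightarrow> cvec \<Rightarrow> cvec" where
  "E n i = orth_proj n (eigsp n i)"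

definition Estar :: "vertex \<Rightarrow> nat \<Rightarrow> cmat" where
  "Estar x i = (\<lambda>y z. of_bool (y = z \<and> hdist x y = i))"

definition weighted_subset :: "nat \<Rightarrow> vertex set \<Rightarrow> (vertex \<Rightarrow> real) \<Rightarrow> bool" where
  "weighted_subset n Y \<omega> \<longleftrightarrow>
     (\<forall>y\<in>cube n. \<omega> y \<ge> 0) \<and> (\<forall>y. y \<notin> cube n \<longrightarrow> \<omega> y = 0) \<and> Y = {y \<in> cube n. \<omega> y > 0}"

definition relative_design ::
    "nat \<Rightarrow> vertex \<Rightarrow> nat \<Rightarrow> vertex set \<Rightarrow> (vertex \<Rightarrow> real) \<Rightarrow> bool" where
  "relative_design n x t Y \<omega> \<longleftrightarrow>
     weighted_subset n Y \<omega> \<and>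
     (\<forall>i\<in>{1..t}. E n i (\<lambda>y. complex_of_real (\<omega> y)) \<in> cvec.span {E n i (char_vec x)})"

definition supported_on_shells :: "nat \<Rightarrow> vertex \<Rightarrow> nat \<Rightarrow> nat \<Rightarrow> vertex set \<Rightarrow> bool" where
  "supported_on_shells n x l m Y \<longleftrightarrow>
     Y \<subseteq> shell n x l \<union> shell n x m \<and> Y \<inter> shell n x l \<noteq> {} \<and> Y \<inter> shell n x m \<noteq> {}"

definition tight_relative_design ::
    "nat \<Rightarrow> vertex \<Rightarrow> nat \<Rightarrow> nat \<Rightarrow> nat \<Rightarrow> vertex set \<Rightarrow> (vertex \<Rightarrow> real) \<Rightarrow> bool" where
  "tight_relative_design n x e l m Y \<omega> \<longleftrightarrow>
     relative_design n x (2 * e) Y \<omega> \<and> supported_on_shells n x l m Y \<and>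
     card Y = cvec.dim (mat_app n (Estar x l + Estar x m) ` (\<Sum>i\<le>e. E n i ` vecs n))"

definition scaling_rel ::
    "((nat \<times> vertex set \<times> (vertex \<Rightarrow> real)) \<times> (nat \<times> vertex set \<times> (vertex \<Rightarrow> real))) set" where
  "scaling_rel = {((n, Y, \<omega>), (n', Y', \<omega>')).
     n' = n \<and> Y' = Y \<and> (\<exists>a>0. \<omega>' = (\<lambda>y. a * \<omega> y))}"

lemma equiv_scaling_rel: "equiv UNIV scaling_rel"
proof (rule equivI)
  show "refl scaling_rel"
    by (auto simp: refl_on_def scaling_rel_def intro!: exI[of _ 1])
  show "sym scaling_rel"
  proof (rule symI)
    fix p q assume "(p, q) \<in> scaling_rel"
    then obtain n Y \<omega> a where "p = (n, Y, \<omega>)" "q = (n, Y, \<lambda>y. a * \<omega> y)" "a > 0"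
      by (auto simp: scaling_rel_def)
    then show "(q, p) \<in> scaling_rel"
      by (auto simp: scaling_rel_def fun_eq_iff intro!: exI[of _ "1 / a"])
  qed
  show "trans scaling_rel"
  proof (rule transI)
    fix p q r assume "(p, q) \<in> scaling_rel" "(q, r) \<in> scaling_rel"
    then obtain n Y \<omega> a b where "p = (n, Y, \<omega>)" "r = (n, Y, \<lambda>y. b * (a * \<omega> y))" "a > 0" "b > 0"
      by (auto simp: scaling_rel_def)
    then show "(p, r) \<in> scaling_rel"
      by (auto simp: scaling_rel_def fun_eq_iff intro!: exI[of _ "b * a"])
  qed
qed auto

end

theory Submission
  imports Defs "HOL-Computational_Algebra.Polynomial" "HOL-Library.FuncSet"
begin

text \<open>
  Identify vertices with subsets of \<open>{..<n}\<close> through the coordinates in which they differ from the base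
  vertex. A relative \<open>2e\<close>-design is then a weight whose Fourier coefficients of order at most \<open>2e\<close>
  depend only on the order, so it integrates polynomials of degree at most \<open>2e\<close> like the
  shell-uniform weight with the same masses on the two shells. Tightness makes every function on \<open>Y\<close> the
  restriction of a polynomial of degree at most \<open>e\<close>. The polynomial that is the indicator of \<open>y\<close> on
  \<open>Y\<close> is a reproducing kernel, hence invariant under the stabilizer of \<open>y\<close>. This shows that there
  are exactly \<open>e\<close> values \<open>card (y - z)\<close> with \<open>z\<close> in the other shell, and that these integers are the
  zeros of a Hahn polynomial. It also shows that \<open>Y\<close> determines the weight up to a scalar, so it remains
  to bound \<open>n\<close>.

  The coefficients of the Hahn polynomial in the basis of falling factorials are integers. The two
  coefficients after the leading one force the variance of the Hahn weight to be of order at least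
  \<open>n / l\<^sup>2\<close>, hence unbounded, and the constant coefficient excludes \<open>n = 2 * m\<close> for large \<open>n\<close>, since
  half of the factors of its denominator are almost coprime to those of the numerator. For \<open>n \<noteq> 2 * m\<close>
  the Hahn polynomial is asymptotically a Hermite polynomial, and to second order the sum of a
  symmetric pair of zeros near \<open>\<plusminus> \<sigma> \<eta>\<close> depends on \<open>\<eta>\<close> through \<open>\<rho> * \<eta>\<^sup>2 / 3\<close> with
  \<open>0 < \<bar>\<rho>\<bar> \<le> 1\<close>. For large \<open>e\<close> there are Hermite zeros whose squares differ by less than \<open>3\<close>, which
  contradicts integrality.
\<close>

section \<open>The Hahn difference operator\<close>

text \<open>The bound \<delta> < 1/2 acts twice: with l = O(n^\<delta>) it makes n / l^2 grow at
  least like a positive power of n, and for n = 2 * m it decides the comparison of n^(e div 2) with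
  l^e. Only the second makes the threshold on e depend on \<delta>, because of the rounding in e div
  2.

  The obstacle is that \<rho> = (2 * m - n) * (n - 2 * l) / n^2 may be arbitrarily small, so the
  asymmetry of the zeros can lie far below their spacing. It is therefore divided by \<rho> before
  passing to the limit; the limit lies strictly between 0 and 1 in absolute value, and the resulting
  integer is nonzero but smaller than \<bar>\<rho>\<bar>. For n = 2 * m the Hahn weight is symmetric
  under t -> l - t and sums of pairs say nothing, hence the separate arithmetic argument.

  Falling factorials suit both sides: a monic polynomial with integer zeros has integer coefficients
  in them, and the Hahn operator is bidiagonal in them, so that a two-term recurrence makes each
  coefficient an explicit product.\<close>

definition falling :: "nat \<Rightarrow> real \<Rightarrow> real" where
  "falling k t = (\<Prod>i<k. t - real i)"

lemma falling_0 [simp]: "falling 0 t = 1"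
  by (simp add: falling_def)

lemma falling_Suc: "falling (Suc k) t = (t - real k) * falling k t"
  by (simp add: falling_def mult.commute)

lemma falling_Suc_shift: "falling (Suc k) t = t * falling k (t - 1)"
  unfolding falling_def by (subst prod.lessThan_Suc_shift) (simp add: algebra_simps)

lemma falling_eq_0: "j < k \<Longrightarrow> falling k (real j) = 0"
  by (auto simp: falling_def)

lemma falling_self: "falling k (real k) \<noteq> 0"
  by (auto simp: falling_def)

text \<open>Evaluation at 0, 1, 2, ... is triangular on falling factorials: at \<open>k\<close> all
  those of index above \<open>k\<close> vanish. So the coefficients can be killed one after
  another.\<close>

lemma falling_combination_eq_0:
  assumes "\<And>t. t \<le> d \<Longrightarrow> (\<Sum>k<e. b k * falling k (real t)) = 0" and "e \<le> Suc d" and "k < e"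
  shows "b k = 0"
  using assms(3)
proof (induction k rule: less_induct)
  case (less k)
  have "(\<Sum>i<e. b i * falling i (real k)) = b k * falling k (real k)"
  proof (subst sum.remove[of _ k])
    have "(\<Sum>i\<in>{..<e} - {k}. b i * falling i (real k)) = 0"
    proof (rule sum.neutral, rule ballI)
      fix i assume i: "i \<in> {..<e} - {k}"
      show "b i * falling i (real k) = 0"
      proof (cases "i < k")
        case True then show ?thesis using less.IH i by simp
      next
        case False then show ?thesis using i by (simp add: falling_eq_0)
      qed
    qed
    then show "b k * falling k (real k) + (\<Sum>i\<in>{..<e} - {k}. b i * falling i (real k)) = b k * falling k (real k)"
      by simp
  qed (use less.prems in auto)
  moreover have "k \<le> d" using less.prems assms(2) by linarith
  ultimately have "b k * falling k (real k) = 0" using assms(1) by metis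
  then show ?case using falling_self by simp
qed

text \<open>On \<open>falling k\<close> the factor t - \<xi> splits as (t - k) + (k - \<xi>): the
  first part raises the index by one, the second is an integer multiple. Integrality of the zeros
  thus passes to all coefficients.\<close>

lemma falling_expansion:
  fixes D :: "nat set"
  assumes "finite D"
  shows "\<exists>a :: nat \<Rightarrow> int. a (card D) = 1 \<and>
    (\<forall>t. (\<Prod>\<xi>\<in>D. t - real \<xi>) = (\<Sum>k\<le>card D. of_int (a k) * falling k t))"
  using assms
proof (induction D)
  case empty
  then show ?case by (intro exI[of _ "\<lambda>_. 1"]) simp
next
  case (insert \<xi> D)
  obtain a :: "nat \<Rightarrow> int" where a: "a (card D) = 1"
    "\<And>t. (\<Prod>\<xi>\<in>D. t - real \<xi>) = (\<Sum>k\<le>card D. of_int (a k) * falling k t)"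
    using insert.IH by blast
  let ?d = "card D"
  define a' where "a' k = (if k = 0 then 0 else a (k - 1)) + (if k \<le> ?d then a k * (int k - int \<xi>) else 0)" for k
  have "(\<Prod>\<zeta>\<in>insert \<xi> D. t - real \<zeta>) = (\<Sum>k\<le>Suc ?d. of_int (a' k) * falling k t)" for t
  proof -
    have "(\<Sum>k\<le>Suc ?d. of_int (a' k) * falling k t) =
        (\<Sum>k\<le>Suc ?d. (if k = 0 then 0 else of_int (a (k - 1)) * falling k t)) +
        (\<Sum>k\<le>Suc ?d. (if k \<le> ?d then of_int (a k) * (real k - real \<xi>) * falling k t else 0))"
      unfolding sum.distrib[symmetric] a'_def by (intro sum.cong) (auto simp: algebra_simps)
    also have "(\<Sum>k\<le>Suc ?d. (if k = 0 then 0 else of_int (a (k - 1)) * falling k t)) =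
        (\<Sum>k\<le>?d. of_int (a k) * falling (Suc k) t)"
      by (subst sum.atMost_Suc_shift) simp
    also have "(\<Sum>k\<le>Suc ?d. (if k \<le> ?d then of_int (a k) * (real k - real \<xi>) * falling k t else 0)) =
        (\<Sum>k\<le>?d. of_int (a k) * (real k - real \<xi>) * falling k t)"
      by simp
    also have "(\<Sum>k\<le>?d. of_int (a k) * falling (Suc k) t) + \<dots> =
        (\<Sum>k\<le>?d. (t - real \<xi>) * (of_int (a k) * falling k t))"
      unfolding sum.distrib[symmetric] by (intro sum.cong) (auto simp: falling_Suc algebra_simps)
    also have "\<dots> = (t - real \<xi>) * (\<Prod>\<zeta>\<in>D. t - real \<zeta>)"
      by (simp add: a(2) sum_distrib_left)
    finally show ?thesis using insert.hyps by simp
  qed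
  moreover have "a' (Suc ?d) = 1" by (simp add: a'_def a)
  ultimately show ?case using insert.hyps by (intro exI[of _ a']) simp
qed

text \<open>Generator of the walk on m-sets z that exchanges one element, observed through t = card
  (y - z) for a fixed l-set y. An increase removes one of the l - t common elements and inserts one
  of the n - m - t elements outside both sets; a decrease inserts one of the t missing elements in
  place of one of the m - l + t elements of z outside y.\<close>

definition hahn_op :: "nat \<Rightarrow> nat \<Rightarrow> nat \<Rightarrow> (real \<Rightarrow> real) \<Rightarrow> real \<Rightarrow> real" where
  "hahn_op n l m f t =
     (real l - t) * (real n - real m - t) * (f (t + 1) - f t) +
     t * (real m - real l + t) * (f (t - 1) - f t)"

text \<open>Both shifted values are multiples of \<open>falling (k - 1) t\<close>: the upward shift
  splits off the factor t + 1, and in the downward one the rate t completes the product. Hence the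
  operator is bidiagonal in this basis.\<close>

lemma hahn_op_falling:
  "hahn_op n l m (falling k) t =
     - real k * (real n + 1 - real k) * falling k t
     + real k * (real l - real k + 1) * (real n - real m - real k + 1) * falling (k - 1) t"
proof (cases k)
  case 0
  then show ?thesis by (simp add: hahn_op_def)
next
  case (Suc j)
  have up: "falling (Suc j) (t + 1) = (t + 1) * falling j t"
    using falling_Suc_shift[of j "t + 1"] by simp
  have "t * falling (Suc j) (t - 1) = (t - 1 - real j) * (t * falling j (t - 1))"
    by (simp add: falling_Suc)
  also have "t * falling j (t - 1) = (t - real j) * falling j t"
    using falling_Suc_shift[of j t] falling_Suc[of j t] by simp
  finally have down: "t * falling (Suc j) (t - 1) = (t - 1 - real j) * ((t - real j) * falling j t)" .
  have "hahn_op n l m (falling (Suc j)) t =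
     (real l - t) * (real n - real m - t) * (falling (Suc j) (t + 1) - falling (Suc j) t) +
     (real m - real l + t) * (t * falling (Suc j) (t - 1) - t * falling (Suc j) t)"
    by (simp add: hahn_op_def algebra_simps)
  also have "\<dots> = - real (Suc j) * (real n + 1 - real (Suc j)) * falling (Suc j) t
     + real (Suc j) * (real l - real (Suc j) + 1) * (real n - real m - real (Suc j) + 1) * falling j t"
    unfolding up down falling_Suc[of j t] by (simp add: algebra_simps)
  finally show ?thesis using Suc by simp
qed

lemma hahn_op_sum:
  "hahn_op n l m (\<lambda>t. \<Sum>k\<in>K. b k * f k t) t = (\<Sum>k\<in>K. b k * hahn_op n l m (f k) t)"
  by (simp add: hahn_op_def sum_distrib_left sum_subtractf[symmetric] sum.distrib[symmetric] algebra_simps)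

text \<open>Number of m-sets z with card (y - z) = t, for an l-set y inside an n-set; up to
  normalization a hypergeometric law.\<close>

definition hahn_weight :: "nat \<Rightarrow> nat \<Rightarrow> nat \<Rightarrow> nat \<Rightarrow> real" where
  "hahn_weight n l m t = real (l choose t) * real ((n - l) choose (m - l + t))"

lemma real_choose_Suc: "k \<le> n \<Longrightarrow> real (n choose k) * (real n - real k) = real (n choose Suc k) * real (Suc k)"
proof -
  assume "k \<le> n"
  have "(n choose k) * (n - k) = (n choose Suc k) * Suc k"
    using binomial_absorb_comp[of n k] binomial_absorption[of k n]
    by (simp add: mult.commute)
  then have "real ((n choose k) * (n - k)) = real ((n choose Suc k) * Suc k)" by simp
  then show ?thesis using \<open>k \<le> n\<close> by (simp add: of_nat_diff algebra_simps)
qed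

lemma hahn_weight_pos:
  assumes "l \<le> m" "m \<le> n - l" "t \<le> l"
  shows "hahn_weight n l m t > 0"
  using assms by (auto simp: hahn_weight_def)

text \<open>Detailed balance: the walk generated by \<open>hahn_op\<close> is reversible for this
  weight.\<close>

lemma hahn_weight_Suc:
  assumes "l \<le> m" "m \<le> n - l" "l \<le> n" "t < l"
  shows "hahn_weight n l m t * ((real l - real t) * (real n - real m - real t)) =
         hahn_weight n l m (Suc t) * ((real t + 1) * (real m - real l + real t + 1))"
proof -
  have 1: "real (l choose t) * (real l - real t) = real (l choose Suc t) * (real t + 1)"
    using real_choose_Suc[of t l] assms by (simp add: algebra_simps)
  have "real ((n - l) choose (m - l + t)) * (real (n - l) - real (m - l + t)) =
        real ((n - l) choose Suc (m - l + t)) * real (Suc (m - l + t))"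
    by (rule real_choose_Suc) (use assms in linarith)
  then have 2: "real ((n - l) choose (m - l + t)) * (real n - real m - real t) =
        real ((n - l) choose Suc (m - l + t)) * (real m - real l + real t + 1)"
    using assms by (simp add: of_nat_diff algebra_simps)
  have "hahn_weight n l m t * ((real l - real t) * (real n - real m - real t)) =
    (real (l choose t) * (real l - real t)) * (real ((n - l) choose (m - l + t)) * (real n - real m - real t))"
    by (simp add: hahn_weight_def)
  also have "\<dots> = hahn_weight n l m (Suc t) * ((real t + 1) * (real m - real l + real t + 1))"
    unfolding 1 2 by (simp add: hahn_weight_def)
  finally show ?thesis .
qed

text \<open>Summation by parts. Boundary terms are absent because the upward rate vanishes at t = l
  and the downward rate at t = 0; detailed balance then merges the two sums into a form symmetric in
  f and g.\<close>

lemma hahn_op_dirichlet: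
  assumes "l \<le> m" "m \<le> n - l" "l \<le> n"
  shows "(\<Sum>t\<le>l. hahn_weight n l m t * hahn_op n l m f (real t) * g (real t)) =
    - (\<Sum>t<l. hahn_weight n l m t * ((real l - real t) * (real n - real m - real t)) *
         ((f (real t + 1) - f (real t)) * (g (real t + 1) - g (real t))))"
proof -
  let ?W = "hahn_weight n l m"
  let ?B = "\<lambda>t. (real l - real t) * (real n - real m - real t)"
  have "(\<Sum>t\<le>l. ?W t * hahn_op n l m f (real t) * g (real t)) =
     (\<Sum>t\<le>l. ?W t * ?B t * (f (real t + 1) - f (real t)) * g (real t)) +
     (\<Sum>t\<le>l. ?W t * (real t * (real m - real l + real t)) * (f (real t - 1) - f (real t)) * g (real t))"
    unfolding sum.distrib[symmetric] by (intro sum.cong) (auto simp: hahn_op_def algebra_simps)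
  also have "(\<Sum>t\<le>l. ?W t * ?B t * (f (real t + 1) - f (real t)) * g (real t)) =
     (\<Sum>t<l. ?W t * ?B t * (f (real t + 1) - f (real t)) * g (real t))"
    unfolding lessThan_Suc_atMost[symmetric] by simp
  also have "(\<Sum>t\<le>l. ?W t * (real t * (real m - real l + real t)) * (f (real t - 1) - f (real t)) * g (real t)) =
     (\<Sum>t<l. ?W (Suc t) * ((real t + 1) * (real m - real l + real t + 1)) * (f (real t) - f (real t + 1)) * g (real t + 1))"
    unfolding lessThan_Suc_atMost[symmetric]
    by (subst sum.lessThan_Suc_shift) (simp, intro sum.cong refl, simp add: ac_simps)
  also have "\<dots> = (\<Sum>t<l. ?W t * ?B t * (f (real t) - f (real t + 1)) * g (real t + 1))"
    by (intro sum.cong refl) (use hahn_weight_Suc[OF assms] in auto)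
  also have "(\<Sum>t<l. ?W t * ?B t * (f (real t + 1) - f (real t)) * g (real t)) + \<dots> =
     - (\<Sum>t<l. ?W t * ?B t * ((f (real t + 1) - f (real t)) * (g (real t + 1) - g (real t))))"
    unfolding sum.distrib[symmetric] sum_negf[symmetric] by (intro sum.cong) (auto simp: algebra_simps)
  finally show ?thesis .
qed

lemma hahn_op_self_adjoint:
  assumes "l \<le> m" "m \<le> n - l" "l \<le> n"
  shows "(\<Sum>t\<le>l. hahn_weight n l m t * hahn_op n l m f (real t) * g (real t)) =
         (\<Sum>t\<le>l. hahn_weight n l m t * f (real t) * hahn_op n l m g (real t))"
proof -
  have "(\<Sum>t\<le>l. hahn_weight n l m t * f (real t) * hahn_op n l m g (real t)) =
     (\<Sum>t\<le>l. hahn_weight n l m t * hahn_op n l m g (real t) * f (real t))"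
    by (intro sum.cong) auto
  then show ?thesis
    unfolding hahn_op_dirichlet[OF assms] by (simp add: mult.commute)
qed

text \<open>The condition \<open>b e = 0\<close> is the value reached by the shifted index
  \<open>Suc k\<close> at k = e - 1, so that one formula also covers the top coefficient.\<close>

lemma hahn_op_combination:
  fixes b :: "nat \<Rightarrow> real" and n l m e :: nat
  defines "lam \<equiv> \<lambda>k. - real k * (real n + 1 - real k)"
    and "gam \<equiv> \<lambda>k. (real k + 1) * (real l - real k) * (real n - real m - real k)"
  assumes "b e = 0"
  shows "hahn_op n l m (\<lambda>t. \<Sum>k<e. b k * falling k t) t =
    (\<Sum>k<e. (b k * lam k + gam k * b (Suc k)) * falling k t)"
proof (cases e)
  case (Suc d)
  have op: "hahn_op n l m (falling k) t = lam k * falling k t + (if k = 0 then 0 else gam (k - 1) * falling (k - 1) t)" for k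
    unfolding hahn_op_falling lam_def gam_def by (cases k) (auto simp: algebra_simps)
  have "hahn_op n l m (\<lambda>t. \<Sum>k<e. b k * falling k t) t = 
    (\<Sum>k<e. b k * lam k * falling k t) + (\<Sum>k<e. if k = 0 then 0 else b k * (gam (k - 1) * falling (k - 1) t))"
    unfolding hahn_op_sum op sum.distrib[symmetric] by (intro sum.cong refl) (simp add: distrib_left)
  also have "(\<Sum>k<e. if k = 0 then 0 else b k * (gam (k - 1) * falling (k - 1) t)) =
    (\<Sum>k<d. gam k * b (Suc k) * falling k t)"
    unfolding Suc by (subst sum.lessThan_Suc_shift) (simp add: mult.assoc mult.left_commute)
  also have "\<dots> = (\<Sum>k<e. gam k * b (Suc k) * falling k t)"
    unfolding Suc using assms(3) Suc by simp
  finally show ?thesis by (simp only: distrib_right sum.distrib)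
qed (simp add: hahn_op_def)

text \<open>What is left of \<open>hahn_op n l m p\<close> after subtracting the eigenvalue multiple
  of p is some R of degree below e. Self-adjointness moves the operator onto R, where it keeps the
  degree below e, so orthogonality makes the weighted square sum of R vanish. As R is zero on 0,
  ..., l and e \<le> l, all its coefficients are zero, which gives the recurrence and the eigenvalue
  equation at every real t.\<close>

lemma hahn_recurrence:
  fixes a :: "nat \<Rightarrow> real"
  assumes "e \<le> l" "l \<le> m" "m \<le> n - l" "l \<le> n"
    and p: "\<And>t. p t = (\<Sum>k\<le>e. a k * falling k t)"
    and orth: "\<And>j. j < e \<Longrightarrow> (\<Sum>t\<le>l. hahn_weight n l m t * p (real t) * falling j (real t)) = 0"
    and "k < e"
  shows "a k * ((real e - real k) * (real n + 1 - real e - real k)) +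
         (real k + 1) * (real l - real k) * (real n - real m - real k) * a (Suc k) = 0"
    and "hahn_op n l m p t = - real e * (real n + 1 - real e) * p t"
proof -
  define lam where "lam k = - real k * (real n + 1 - real k)" for k
  define gam where "gam k = (real k + 1) * (real l - real k) * (real n - real m - real k)" for k
  define a' where "a' k = (if k \<le> e then a k else 0)" for k
  define b where "b k = a' k * (lam k - lam e) + gam k * a' (Suc k)" for k
  define R where "R t = (\<Sum>k<e. b k * falling k t)" for t
  let ?W = "hahn_weight n l m"
  have p': "p t = (\<Sum>k<Suc e. a' k * falling k t)" for t
    unfolding p lessThan_Suc_atMost a'_def by (intro sum.cong) auto
  have op: "hahn_op n l m (\<lambda>t. \<Sum>k<d. c k * falling k t) t =
    (\<Sum>k<d. (c k * lam k + gam k * c (Suc k)) * falling k t)" if "c d = 0" for c d t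
    unfolding lam_def gam_def by (rule hahn_op_combination) fact
  have op_p: "hahn_op n l m p t = lam e * p t + R t" for t
  proof -
    have "hahn_op n l m p t = (\<Sum>k<Suc e. (a' k * lam k + gam k * a' (Suc k)) * falling k t)"
      unfolding p' by (rule op) (simp add: a'_def)
    also have "\<dots> = (\<Sum>k<Suc e. lam e * (a' k * falling k t) + b k * falling k t)"
      unfolding b_def by (intro sum.cong refl) (simp add: algebra_simps)
    also have "\<dots> = lam e * p t + (\<Sum>k<Suc e. b k * falling k t)"
      unfolding p' sum.distrib sum_distrib_left ..
    also have "b e = 0" by (simp add: b_def a'_def)
    then have "(\<Sum>k<Suc e. b k * falling k t) = R t" by (simp add: R_def)
    finally show ?thesis .
  qed
  have orth_sum: "(\<Sum>t\<le>l. ?W t * p (real t) * (\<Sum>j<e. c j * falling j (real t))) = 0" for c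
  proof -
    have "(\<Sum>t\<le>l. ?W t * p (real t) * (\<Sum>j<e. c j * falling j (real t))) =
      (\<Sum>j<e. c j * (\<Sum>t\<le>l. ?W t * p (real t) * falling j (real t)))"
      unfolding sum_distrib_left by (subst sum.swap) (simp only: ac_simps)
    then show ?thesis using orth by simp
  qed
  have op_R: "\<exists>c. \<forall>t. hahn_op n l m R t = (\<Sum>j<e. c j * falling j t)"
  proof -
    define b' where "b' k = (if k < e then b k else 0)" for k
    have R': "R = (\<lambda>t. \<Sum>k<e. b' k * falling k t)"
      unfolding R_def b'_def by (intro ext sum.cong) auto
    show ?thesis
      unfolding R' by (intro exI allI, rule op) (simp add: b'_def)
  qed
  have "(\<Sum>t\<le>l. ?W t * (R (real t))\<^sup>2) =
    (\<Sum>t\<le>l. ?W t * hahn_op n l m p (real t) * R (real t)) -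
    lam e * (\<Sum>t\<le>l. ?W t * p (real t) * R (real t))"
    unfolding op_p sum_distrib_left sum_subtractf[symmetric]
    by (intro sum.cong refl) (simp add: distrib_left distrib_right power2_eq_square)
  also have "(\<Sum>t\<le>l. ?W t * hahn_op n l m p (real t) * R (real t)) = (\<Sum>t\<le>l. ?W t * p (real t) * hahn_op n l m R (real t))"
    by (rule hahn_op_self_adjoint) fact+
  also have "\<dots> = 0"
  proof -
    obtain c where "\<And>t. hahn_op n l m R t = (\<Sum>j<e. c j * falling j t)" using op_R by blast
    then show ?thesis by (simp only: orth_sum)
  qed
  also have "(\<Sum>t\<le>l. ?W t * p (real t) * R (real t)) = 0"
    unfolding R_def by (rule orth_sum)
  finally have "(\<Sum>t\<le>l. ?W t * (R (real t))\<^sup>2) = 0" by simp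
  then have "\<forall>t\<in>{..l}. ?W t * (R (real t))\<^sup>2 = 0"
    by (subst (asm) sum_nonneg_eq_0_iff) (auto simp: hahn_weight_def)
  then have R0: "R (real t) = 0" if "t \<le> l" for t
    using bspec[OF \<open>\<forall>t\<in>{..l}. _\<close>, of t] hahn_weight_pos[OF assms(2,3) that] that by simp
  have b0: "b k = 0" if "k < e" for k
    by (rule falling_combination_eq_0[where d = l and e = e]) (use assms(1) that R0 in \<open>auto simp: R_def\<close>)
  have "lam k - lam e = (real e - real k) * (real n + 1 - real e - real k)"
    by (simp add: lam_def algebra_simps)
  then show "a k * ((real e - real k) * (real n + 1 - real e - real k)) +
         (real k + 1) * (real l - real k) * (real n - real m - real k) * a (Suc k) = 0"
    using b0[OF \<open>k < e\<close>] \<open>k < e\<close> by (simp add: b_def a'_def gam_def)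
  have "R t = 0" unfolding R_def using b0 by simp
  then show "hahn_op n l m p t = - real e * (real n + 1 - real e) * p t"
    using op_p[of t] by (simp add: lam_def)
qed

section \<open>Arithmetic of the integral coefficients\<close>

text \<open>The recurrence for \<open>a (e - 2)\<close>, read modulo N + 1, says that N + 1 divides
  (e - 1) * (L + 1) * w * (e * L - w). This number is positive, hence at least N + 1; after
  multiplication by N^2 both w * N and (e * L - w) * N have closed forms.\<close>

lemma hahn_integrality_bound:
  fixes a :: "nat \<Rightarrow> int" and n l m e :: nat
  defines "N \<equiv> int n - 2 * int e + 2" and "L \<equiv> int l - int e + 1"
    and "M \<equiv> int m - int e + 1" and "M' \<equiv> int n - int m - int e + 1"
  assumes "2 \<le> e" "e \<le> l" "l < m" "m \<le> n - l" "l \<le> n"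
    and rec: "\<And>k. k < e \<Longrightarrow> a k * ((int e - int k) * (int n + 1 - int e - int k)) +
         (int k + 1) * (int l - int k) * (int n - int m - int k) * a (Suc k) = 0"
    and "a e = 1"
  shows "N\<^sup>2 * (N + 1) \<le> int e ^ 3 * (L + 1) * L\<^sup>2 * (M * M')"
proof -
  define w where "w = - a (e - 1)"
  have pos: "N \<ge> 1" "L \<ge> 1" "M \<ge> 1" "M' \<ge> 1" "N = M + M'"
    using assms(5-9) unfolding N_def L_def M_def M'_def by linarith+
  have w: "w * N = int e * L * M'"
    using rec[of "e - 1"] assms(5-9) \<open>a e = 1\<close> unfolding w_def N_def L_def M'_def
    by (simp add: of_nat_diff algebra_simps)
  have a2: "a (e - 2) * (2 * (N + 1)) = (int e - 1) * (L + 1) * (M' + 1) * w"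
    using rec[of "e - 2"] assms(5-9) unfolding w_def N_def L_def M'_def
    by (simp add: of_nat_diff numeral_2_eq_2 Suc_diff_Suc algebra_simps)
  have elw: "(int e * L - w) * N = int e * L * M"
    using w pos(5) by (simp add: algebra_simps)
  have w_pos: "w > 0"
  proof -
    have "0 < w * N" unfolding w using pos assms(5) by (intro mult_pos_pos) auto
    then show ?thesis using pos by (simp add: zero_less_mult_iff)
  qed
  have elw_pos: "int e * L - w > 0"
  proof -
    have "0 < (int e * L - w) * N" unfolding elw using pos assms(5) by (intro mult_pos_pos) auto
    then show ?thesis using pos by (simp add: zero_less_mult_iff)
  qed
  have "(N + 1) dvd (int e - 1) * (L + 1) * (M' + 1) * w"
    unfolding a2[symmetric] by (intro dvd_mult) simp
  \<comment> \<open>The factor e * L is inserted to eliminate M': e * L * (M' + 1) = w * (N + 1) +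
    (e * L - w).\<close>
  then have "(N + 1) dvd int e * L * ((int e - 1) * (L + 1) * (M' + 1) * w)"
    by (rule dvd_mult)
  also have "int e * L * ((int e - 1) * (L + 1) * (M' + 1) * w) =
      (int e - 1) * (L + 1) * w * (int e * L * M' + int e * L)"
    by (simp add: algebra_simps)
  also have "\<dots> = (int e - 1) * (L + 1) * w * w * (N + 1) + (int e - 1) * (L + 1) * w * (int e * L - w)"
    unfolding w[symmetric] by (simp add: algebra_simps)
  finally have "(N + 1) dvd (int e - 1) * (L + 1) * w * (int e * L - w)"
    by (metis dvd_add_right_iff dvd_triv_right)
  moreover have "(int e - 1) * (L + 1) * w * (int e * L - w) > 0"
    using pos w_pos elw_pos assms(5) by (intro mult_pos_pos) auto
  ultimately have "N + 1 \<le> (int e - 1) * (L + 1) * w * (int e * L - w)"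
    by (rule zdvd_imp_le)
  also have "\<dots> \<le> int e * (L + 1) * w * (int e * L - w)"
    using pos w_pos elw_pos by (intro mult_right_mono) auto
  finally have "N\<^sup>2 * (N + 1) \<le> N\<^sup>2 * (int e * (L + 1) * w * (int e * L - w))"
    by (intro mult_left_mono) auto
  also have "\<dots> = int e * (L + 1) * (w * N) * ((int e * L - w) * N)"
    by (simp add: power2_eq_square algebra_simps)
  also have "\<dots> = int e ^ 3 * (L + 1) * L\<^sup>2 * (M * M')"
    unfolding w elw by (simp add: power2_eq_square power3_eq_cube algebra_simps)
  finally show ?thesis .
qed

text \<open>The recurrence telescopes from 0 to e; the factors e - k and k + 1 both multiply to e!
  and cancel. Absolute values absorb the sign (-1)^e.\<close>

lemma hahn_constant_coefficient:
  fixes a :: "nat \<Rightarrow> int" and n l m e :: nat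
  assumes rec: "\<And>k. k < e \<Longrightarrow> a k * ((int e - int k) * (int n + 1 - int e - int k)) +
         (int k + 1) * (int l - int k) * (int n - int m - int k) * a (Suc k) = 0"
    and "a e = 1"
  shows "\<bar>a 0 * (\<Prod>k<e. int n + 1 - int e - int k)\<bar> = \<bar>(\<Prod>k<e. (int l - int k) * (int n - int m - int k))\<bar>"
proof -
  have "\<bar>a 0\<bar> * (\<Prod>k<r. \<bar>(int e - int k) * (int n + 1 - int e - int k)\<bar>) =
     (\<Prod>k<r. (int k + 1) * \<bar>(int l - int k) * (int n - int m - int k)\<bar>) * \<bar>a r\<bar>" if "r \<le> e" for r
    using that
  proof (induction r)
    case (Suc r)
    have "\<bar>a r * ((int e - int r) * (int n + 1 - int e - int r))\<bar> =
       \<bar>(int r + 1) * (int l - int r) * (int n - int m - int r) * a (Suc r)\<bar>"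
      using rec[of r] Suc.prems by linarith
    then have *: "\<bar>a r\<bar> * \<bar>(int e - int r) * (int n + 1 - int e - int r)\<bar> =
       (int r + 1) * \<bar>(int l - int r) * (int n - int m - int r)\<bar> * \<bar>a (Suc r)\<bar>"
      by (simp add: abs_mult mult.assoc)
    have "\<bar>a 0\<bar> * (\<Prod>k<Suc r. \<bar>(int e - int k) * (int n + 1 - int e - int k)\<bar>) =
      (\<bar>a 0\<bar> * (\<Prod>k<r. \<bar>(int e - int k) * (int n + 1 - int e - int k)\<bar>)) * \<bar>(int e - int r) * (int n + 1 - int e - int r)\<bar>"
      by simp
    also have "\<dots> = (\<Prod>k<r. (int k + 1) * \<bar>(int l - int k) * (int n - int m - int k)\<bar>) *
       (\<bar>a r\<bar> * \<bar>(int e - int r) * (int n + 1 - int e - int r)\<bar>)"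
      using Suc by simp
    finally show ?case unfolding * by simp
  qed simp
  from this[of e] have "\<bar>a 0\<bar> * (\<Prod>k<e. \<bar>(int e - int k) * (int n + 1 - int e - int k)\<bar>) =
     (\<Prod>k<e. (int k + 1) * \<bar>(int l - int k) * (int n - int m - int k)\<bar>)"
    using \<open>a e = 1\<close> by simp
  then have "(\<Prod>k<e. \<bar>int e - int k\<bar>) * (\<bar>a 0\<bar> * (\<Prod>k<e. \<bar>int n + 1 - int e - int k\<bar>)) =
     (\<Prod>k<e. int k + 1) * (\<Prod>k<e. \<bar>(int l - int k) * (int n - int m - int k)\<bar>)"
    by (simp add: abs_mult prod.distrib ac_simps)
  moreover have "(\<Prod>k<e. \<bar>int e - int k\<bar>) = (\<Prod>k<e. int k + 1)"
    by (rule prod.reindex_bij_witness[of _ "\<lambda>k. e - Suc k" "\<lambda>k. e - Suc k"]) (auto simp: of_nat_diff)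
  moreover have "(\<Prod>k<e. int k + 1) \<noteq> 0" by simp
  ultimately have "\<bar>a 0\<bar> * (\<Prod>k<e. \<bar>int n + 1 - int e - int k\<bar>) = (\<Prod>k<e. \<bar>(int l - int k) * (int n - int m - int k)\<bar>)"
    by simp
  then show ?thesis by (simp add: abs_mult abs_prod)
qed

lemma gcd_mult_dvd_nat: "gcd (a * b) c dvd gcd a c * gcd b (c :: nat)"
proof -
  let ?d = "gcd (a * b) c"
  have "?d dvd gcd (b * a) (b * c)" by (simp only: mult.commute[of b a] gcd_greatest_iff) simp
  then have "?d dvd b * gcd a c" unfolding gcd_mult_distrib_nat .
  then have "?d dvd gcd a c * b" by (simp only: mult.commute)
  moreover have "?d dvd gcd a c * c" by simp
  ultimately have "?d dvd gcd (gcd a c * b) (gcd a c * c)" by (rule gcd_greatest)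
  then show ?thesis by (simp add: gcd_mult_distrib_nat[symmetric])
qed

lemma gcd_prod_dvd_nat:
  assumes "finite K"
  shows "gcd (\<Prod>k\<in>K. f k) c dvd (\<Prod>k\<in>K. gcd (f k) (c :: nat))"
  using assms
proof (induction K)
  case (insert k K)
  then show ?case
    using dvd_trans[OF gcd_mult_dvd_nat mult_dvd_mono[OF dvd_refl]] by simp
qed simp

text \<open>Every factor \<open>2 * m + 1 - e - k\<close> with \<open>k\<close> and \<open>e\<close> of equal parity has only a small common
  divisor with each \<open>m - i\<close>, since \<open>2 * (m - i)\<close> differs from it by a nonzero number below \<open>2 * e\<close>.\<close>

lemma middle_dvd_bound:
  fixes m l e :: nat
  assumes "1 \<le> e" "e \<le> l" "l < m"
    and dvd: "(\<Prod>k<e. 2 * m + 1 - e - k) dvd (\<Prod>k<e. l - k) * (\<Prod>k<e. m - k)"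
  shows "(2 * m - 2 * e) ^ (e div 2) \<le> l ^ e * (2 * e) ^ (e * e)"
proof -
  \<comment> \<open>One parity class keeps only half of the factors, which is where the exponent e
    div 2 comes from.\<close>
  define K where "K = {k. k < e \<and> even (k + e)}"
  have fin: "finite K" and sub: "K \<subseteq> {..<e}" by (auto simp: K_def)
  have "K = (\<lambda>j. 2 * j + e mod 2) ` {..<e div 2}"
  proof (intro equalityI subsetI)
    fix k assume "k \<in> K"
    then have "k < e \<and> even (k + e)" by (simp add: K_def)
    then have "k = 2 * (k div 2) + e mod 2" "k div 2 < e div 2"
      by presburger+
    then show "k \<in> (\<lambda>j. 2 * j + e mod 2) ` {..<e div 2}" by blast
  next
    fix k assume "k \<in> (\<lambda>j. 2 * j + e mod 2) ` {..<e div 2}"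
    then show "k \<in> K" unfolding K_def by auto
  qed
  then have card_K: "card K = e div 2"
    by (simp add: card_image inj_on_def)
  let ?A = "\<Prod>k\<in>K. 2 * m + 1 - e - k" and ?B = "\<Prod>k<e. m - k" and ?C = "\<Prod>k<e. l - k"
  have "?A dvd (\<Prod>k<e. 2 * m + 1 - e - k)"
    by (rule prod_dvd_prod_subset) (use sub in auto)
  with dvd have dvd': "?A dvd ?C * ?B" by (rule dvd_trans[rotated])
  \<comment> \<open>Because \<open>?A\<close> divides \<open>?C * ?B\<close>, it divides
    \<open>?C * gcd ?A ?B\<close>. The gcd will be bounded in terms of e alone, so that
    \<open>?C\<close>, at most l^e, is the only factor left that can grow.\<close>
  have "?A dvd gcd (?C * ?A) (?C * ?B)" using dvd' by simp
  then have "?A dvd ?C * gcd ?A ?B" by (simp add: gcd_mult_distrib_nat)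
  also have "?C * gcd ?A ?B dvd ?C * (\<Prod>k\<in>K. \<Prod>i<e. gcd (m - i) (2 * m + 1 - e - k))"
  proof (intro mult_dvd_mono dvd_refl)
    have "gcd ?A ?B dvd (\<Prod>k\<in>K. gcd (2 * m + 1 - e - k) ?B)" by (rule gcd_prod_dvd_nat[OF fin])
    also have "\<dots> dvd (\<Prod>k\<in>K. \<Prod>i<e. gcd (m - i) (2 * m + 1 - e - k))"
      by (intro prod_dvd_prod) (metis gcd_prod_dvd_nat finite_lessThan gcd.commute)
    finally show "gcd ?A ?B dvd (\<Prod>k\<in>K. \<Prod>i<e. gcd (m - i) (2 * m + 1 - e - k))" .
  qed
  finally have "?A dvd ?C * (\<Prod>k\<in>K. \<Prod>i<e. gcd (m - i) (2 * m + 1 - e - k))" .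
  moreover have "?C * (\<Prod>k\<in>K. \<Prod>i<e. gcd (m - i) (2 * m + 1 - e - k)) > 0"
    using assms sub by (auto intro!: prod_pos)
  ultimately have "?A \<le> ?C * (\<Prod>k\<in>K. \<Prod>i<e. gcd (m - i) (2 * m + 1 - e - k))"
    by (rule dvd_imp_le)
  also have "\<dots> \<le> l ^ e * (2 * e) ^ (e * e)"
  proof (rule mult_mono)
    have "?C \<le> (\<Prod>k<e. l)" by (rule prod_mono) auto
    then show "?C \<le> l ^ e" by simp
    have "gcd (m - i) (2 * m + 1 - e - k) \<le> 2 * e" if "k \<in> K" "i < e" for k i
    proof -
      have ke: "k < e" "even (k + e)" using that by (auto simp: K_def)
      let ?g = "int (gcd (m - i) (2 * m + 1 - e - k))"
      have "?g dvd int (m - i)" "?g dvd int (2 * m + 1 - e - k)"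
        by (simp_all only: of_nat_dvd_iff gcd_dvd1 gcd_dvd2)
      then have "?g dvd int (m - i) * 2 - int (2 * m + 1 - e - k)"
        by (meson dvd_diff dvd_mult2)
      also have "int (m - i) * 2 - int (2 * m + 1 - e - k) = int e - 1 - 2 * int i + int k"
        using that ke assms by (simp add: of_nat_diff)
      finally have d: "?g dvd int e - 1 - 2 * int i + int k" .
      \<comment> \<open>The number is odd since k and e have equal parity; hence it is nonzero and
        bounds its divisors.\<close>
      have "int e - 1 - 2 * int i + int k \<noteq> 0" using ke by presburger
      with d have "?g \<le> \<bar>int e - 1 - 2 * int i + int k\<bar>"
        by (metis dvd_imp_le_int abs_of_nat)
      also have "\<dots> \<le> int (2 * e)" using ke that by simp
      finally show ?thesis by linarith
    qed
    then have "(\<Prod>k\<in>K. \<Prod>i<e. gcd (m - i) (2 * m + 1 - e - k)) \<le> (\<Prod>k\<in>K. \<Prod>i<e. 2 * e)"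
      by (intro prod_mono conjI le0) auto
    also have "\<dots> = (2 * e) ^ (e * card K)" by (simp add: power_mult)
    also have "\<dots> \<le> (2 * e) ^ (e * e)"
      using assms card_K by (intro power_increasing) auto
    finally show "(\<Prod>k\<in>K. \<Prod>i<e. gcd (m - i) (2 * m + 1 - e - k)) \<le> (2 * e) ^ (e * e)" .
  qed auto
  finally have "?A \<le> l ^ e * (2 * e) ^ (e * e)" .
  moreover have "(\<Prod>k\<in>K. 2 * m - 2 * e) \<le> ?A"
    by (intro prod_mono) (auto simp: K_def)
  ultimately show ?thesis using card_K by simp
qed

section \<open>The Hermite limit\<close>

lemma power_shift_expansion:
  fixes x h :: real
  shows "(x + h) ^ i = (\<Sum>j\<le>i. real (i choose j) * h ^ (i - j) * x ^ j)"
  by (subst binomial_ring) (simp add: ac_simps)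

text \<open>Coefficient of x^j in ((x + h)^i - (x - h)^i) / (2 * h). The division by h is carried
  out in the exponent, so that the entry is a polynomial in h and can be followed to h = 0;
  \<open>diff2_coeff\<close> does the same for the second central difference.\<close>

definition diff1_coeff :: "real \<Rightarrow> nat \<Rightarrow> nat \<Rightarrow> real" where
  "diff1_coeff h i j = (if j < i \<and> odd (i - j) then real (i choose j) * h ^ (i - j - 1) else 0)"

definition diff2_coeff :: "real \<Rightarrow> nat \<Rightarrow> nat \<Rightarrow> real" where
  "diff2_coeff h i j = (if j < i \<and> even (i - j) then 2 * real (i choose j) * h ^ (i - j - 2) else 0)"

lemma diff1_power:
  assumes "h \<noteq> 0" "i \<le> e"
  shows "((x + h) ^ i - (x - h) ^ i) / (2 * h) = (\<Sum>j\<le>e. diff1_coeff h i j * x ^ j)"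
proof -
  have "(x + h) ^ i - (x - h) ^ i = (\<Sum>j\<le>i. real (i choose j) * (h ^ (i - j) - (- h) ^ (i - j)) * x ^ j)"
    using power_shift_expansion[of x h i] power_shift_expansion[of x "- h" i]
    by (simp add: sum_subtractf[symmetric] left_diff_distrib right_diff_distrib)
  also have "\<dots> = (\<Sum>j\<le>i. 2 * h * (diff1_coeff h i j * x ^ j))"
  proof (intro sum.cong refl)
    fix j assume "j \<in> {..i}"
    then have *: "odd (i - j) \<Longrightarrow> h ^ (i - j) = h * h ^ (i - j - 1)" "odd (i - j) \<Longrightarrow> j < i"
      by (metis odd_pos power_eq_if less_not_refl2) (use odd_pos in fastforce)
    then show "real (i choose j) * (h ^ (i - j) - (- h) ^ (i - j)) * x ^ j = 2 * h * (diff1_coeff h i j * x ^ j)"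
      by (cases "even (i - j)") (simp_all add: diff1_coeff_def)
  qed
  also have "\<dots> = 2 * h * (\<Sum>j\<le>e. diff1_coeff h i j * x ^ j)"
    unfolding sum_distrib_left
    by (rule sum.mono_neutral_left) (use assms in \<open>auto simp: diff1_coeff_def\<close>)
  finally show ?thesis using assms by simp
qed

lemma diff2_power:
  assumes "h \<noteq> 0" "i \<le> e"
  shows "((x + h) ^ i - 2 * x ^ i + (x - h) ^ i) / h\<^sup>2 = (\<Sum>j\<le>e. diff2_coeff h i j * x ^ j)"
proof -
  have "(x + h) ^ i + (x - h) ^ i = (\<Sum>j\<le>i. real (i choose j) * (h ^ (i - j) + (- h) ^ (i - j)) * x ^ j)"
    using power_shift_expansion[of x h i] power_shift_expansion[of x "- h" i]
    by (simp add: sum.distrib[symmetric] distrib_left distrib_right)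
  also have "\<dots> = (\<Sum>j\<le>i. (if j = i then 2 * x ^ i else 0) + h\<^sup>2 * (diff2_coeff h i j * x ^ j))"
  proof (intro sum.cong refl)
    fix j assume j: "j \<in> {..i}"
    have *: "h ^ (i - j) = h\<^sup>2 * h ^ (i - j - 2)" if "even (i - j)" "j < i"
    proof -
      have "i - j = 2 + (i - j - 2)" using that by presburger
      then show ?thesis by (metis power_add)
    qed
    show "real (i choose j) * (h ^ (i - j) + (- h) ^ (i - j)) * x ^ j =
        (if j = i then 2 * x ^ i else 0) + h\<^sup>2 * (diff2_coeff h i j * x ^ j)"
      using j * by (cases "even (i - j)"; cases "j = i") (auto simp: diff2_coeff_def)
  qed
  also have "\<dots> = 2 * x ^ i + h\<^sup>2 * (\<Sum>j\<le>i. diff2_coeff h i j * x ^ j)"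
    by (simp add: sum.distrib sum_distrib_left)
  also have "(\<Sum>j\<le>i. diff2_coeff h i j * x ^ j) = (\<Sum>j\<le>e. diff2_coeff h i j * x ^ j)"
    by (rule sum.mono_neutral_left) (use assms in \<open>auto simp: diff2_coeff_def\<close>)
  finally show ?thesis using assms by (simp add: algebra_simps)
qed

text \<open>Eigenvalue equation of \<open>hahn_op\<close> in the variable x with t = c + \<sigma> *
  x and h = 1 / \<sigma>, written with central differences. For h and \<nu> tending to 0 and bounded
  \<rho> it becomes the Hermite equation F'' - x * F' + e * F = 0; the term with \<rho> is the one
  that breaks the symmetry x -> - x.\<close>

definition scaled_hahn_eq :: "nat \<Rightarrow> real \<Rightarrow> real \<Rightarrow> real \<Rightarrow> (real \<Rightarrow> real) \<Rightarrow> bool" where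
  "scaled_hahn_eq e h \<nu> \<rho> F \<longleftrightarrow> (\<forall>x.
     - x * ((F (x + h) - F (x - h)) / (2 * h)) +
     (1 + \<rho> * h / 2 * x + \<nu> * x\<^sup>2) * ((F (x + h) - 2 * F x + F (x - h)) / h\<^sup>2) +
     real e * (1 - (real e - 1) * \<nu>) * F x = 0)"

text \<open>Contribution of x^i to the coefficient of x^k in the operator of
  \<open>scaled_hahn_eq\<close>. The guards on k express the multiplications by x and x^2, which
  yield no lower powers.\<close>

definition scaled_hahn_mat :: "nat \<Rightarrow> real \<Rightarrow> real \<Rightarrow> real \<Rightarrow> nat \<Rightarrow> nat \<Rightarrow> real" where
  "scaled_hahn_mat e h \<nu> \<rho> k i =
     - (if k = 0 then 0 else diff1_coeff h i (k - 1)) + diff2_coeff h i k +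
     \<rho> * h / 2 * (if k = 0 then 0 else diff2_coeff h i (k - 1)) +
     \<nu> * (if k < 2 then 0 else diff2_coeff h i (k - 2)) +
     (if i = k then real e * (1 - (real e - 1) * \<nu>) else 0)"

lemma scaled_hahn_coeff_eq:
  assumes "h \<noteq> 0" and eq: "scaled_hahn_eq e h \<nu> \<rho> (\<lambda>x. \<Sum>i\<le>e. c i * x ^ i)" and "k \<le> e"
  shows "(\<Sum>i\<le>e. c i * scaled_hahn_mat e h \<nu> \<rho> k i) = 0"
proof -
  define F where "F x = (\<Sum>i\<le>e. c i * x ^ i)" for x
  define u where "u j = (\<Sum>i\<le>e. c i * diff1_coeff h i j)" for j
  define w where "w j = (\<Sum>i\<le>e. c i * diff2_coeff h i j)" for j
  have U: "(F (x + h) - F (x - h)) / (2 * h) = (\<Sum>j\<le>e. u j * x ^ j)" for x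
  proof -
    have "(F (x + h) - F (x - h)) / (2 * h) = (\<Sum>i\<le>e. c i * (((x + h) ^ i - (x - h) ^ i) / (2 * h)))"
      by (simp add: F_def sum_subtractf[symmetric] sum_divide_distrib right_diff_distrib)
    also have "\<dots> = (\<Sum>i\<le>e. c i * (\<Sum>j\<le>e. diff1_coeff h i j * x ^ j))"
      using diff1_power[OF assms(1)] by simp
    also have "\<dots> = (\<Sum>j\<le>e. u j * x ^ j)"
      unfolding u_def sum_distrib_left sum_distrib_right by (subst sum.swap) (simp add: mult.assoc)
    finally show ?thesis .
  qed
  have W: "(F (x + h) - 2 * F x + F (x - h)) / h\<^sup>2 = (\<Sum>j\<le>e. w j * x ^ j)" for x
  proof -
    have "F (x + h) - 2 * F x + F (x - h) = (\<Sum>i\<le>e. c i * ((x + h) ^ i - 2 * x ^ i + (x - h) ^ i))"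
      unfolding F_def sum_distrib_left sum_subtractf[symmetric] sum.distrib[symmetric]
      by (intro sum.cong refl) (simp add: algebra_simps)
    then have "(F (x + h) - 2 * F x + F (x - h)) / h\<^sup>2 = (\<Sum>i\<le>e. c i * (((x + h) ^ i - 2 * x ^ i + (x - h) ^ i) / h\<^sup>2))"
      by (simp add: sum_divide_distrib)
    also have "\<dots> = (\<Sum>i\<le>e. c i * (\<Sum>j\<le>e. diff2_coeff h i j * x ^ j))"
      using diff2_power[OF assms(1)] by simp
    also have "\<dots> = (\<Sum>j\<le>e. w j * x ^ j)"
      unfolding w_def sum_distrib_left sum_distrib_right by (subst sum.swap) (simp add: mult.assoc)
    finally show ?thesis .
  qed
  define Up where "Up = (\<Sum>j\<le>e. monom (u j) j)"
  define Wp where "Wp = (\<Sum>j\<le>e. monom (w j) j)"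
  define Fp where "Fp = (\<Sum>j\<le>e. monom (c j) j)"
  define lam where "lam = real e * (1 - (real e - 1) * \<nu>)"
  define p where "p = - pCons 0 Up + Wp + smult (\<rho> * h / 2) (pCons 0 Wp) + smult \<nu> (pCons 0 (pCons 0 Wp)) + smult lam Fp"
  have "poly p x = 0" for x
  proof -
    have "poly p x = - x * (\<Sum>j\<le>e. u j * x ^ j) + (1 + \<rho> * h / 2 * x + \<nu> * x\<^sup>2) * (\<Sum>j\<le>e. w j * x ^ j) + lam * F x"
      by (simp add: p_def Up_def Wp_def Fp_def poly_sum poly_monom F_def algebra_simps power2_eq_square)
    also have "\<dots> = 0"
      using eq unfolding scaled_hahn_eq_def F_def[symmetric] U W lam_def by simp
    finally show ?thesis .
  qed
  then have "p = 0" using poly_all_0_iff_0 by blast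
  then have "coeff p k = 0" by simp
  have cU: "coeff Up j = u j" if "j \<le> e" for j using that by (simp add: Up_def coeff_sum)
  have cW: "coeff Wp j = w j" if "j \<le> e" for j using that by (simp add: Wp_def coeff_sum)
  have cF: "coeff Fp j = c j" if "j \<le> e" for j using that by (simp add: Fp_def coeff_sum)
  have "coeff p k = - (if k = 0 then 0 else u (k - 1)) + w k + \<rho> * h / 2 * (if k = 0 then 0 else w (k - 1)) +
      \<nu> * (if k < 2 then 0 else w (k - 2)) + lam * c k"
    using \<open>k \<le> e\<close> cU cW cF
    by (cases k; cases "k - 1") (auto simp: p_def coeff_pCons)
  also have "\<dots> = (\<Sum>i\<le>e. c i * scaled_hahn_mat e h \<nu> \<rho> k i)"
  proof -
    have "(\<Sum>i\<le>e. c i * scaled_hahn_mat e h \<nu> \<rho> k i) =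
      (\<Sum>i\<le>e. - (if k = 0 then 0 else c i * diff1_coeff h i (k - 1))) + w k +
      \<rho> * h / 2 * (\<Sum>i\<le>e. (if k = 0 then 0 else c i * diff2_coeff h i (k - 1))) +
      \<nu> * (\<Sum>i\<le>e. (if k < 2 then 0 else c i * diff2_coeff h i (k - 2))) +
      (\<Sum>i\<le>e. if i = k then lam * c i else 0)"
      unfolding w_def sum_distrib_left sum.distrib[symmetric] scaled_hahn_mat_def lam_def
      by (intro sum.cong refl) (simp add: algebra_simps)
    also have "(\<Sum>i\<le>e. if i = k then lam * c i else 0) = lam * c k" using \<open>k \<le> e\<close> by simp
    finally show ?thesis by (simp add: u_def w_def sum_negf)
  qed
  finally show ?thesis using \<open>coeff p k = 0\<close> by simp
qed

text \<open>A first difference lowers the degree by at least one and a second difference by at least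
  two, while the factors in front raise it by at most that much: the matrix is upper
  triangular.\<close>

lemma scaled_hahn_mat_below: "i < k \<Longrightarrow> scaled_hahn_mat e h \<nu> \<rho> k i = 0"
proof -
  assume "i < k"
  then have "\<not> (k - 2 < i \<and> even (i - (k - 2)))" if "\<not> k < 2" using that by presburger
  then show ?thesis using \<open>i < k\<close> by (auto simp: scaled_hahn_mat_def diff1_coeff_def diff2_coeff_def)
qed

lemma tendsto_diff1_coeff:
  assumes "h \<longlonglongrightarrow> 0"
  shows "(\<lambda>n. diff1_coeff (h n) i j) \<longlonglongrightarrow> (if i = Suc j then real i else 0)"
proof (cases "j < i \<and> odd (i - j)")
  case True
  have "(\<lambda>n. real (i choose j) * h n ^ (i - j - 1)) \<longlonglongrightarrow> real (i choose j) * 0 ^ (i - j - 1)"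
    by (intro tendsto_intros assms)
  also have "real (i choose j) * 0 ^ (i - j - 1) = (if i = Suc j then real i else 0)"
    using True by (auto simp: power_0_left)
  finally show ?thesis using True by (simp add: diff1_coeff_def)
next
  case False
  then show ?thesis by (auto simp: diff1_coeff_def)
qed

lemma tendsto_diff2_coeff:
  assumes "h \<longlonglongrightarrow> 0"
  shows "(\<lambda>n. diff2_coeff (h n) i j) \<longlonglongrightarrow> (if i = j + 2 then real ((j + 2) * (j + 1)) else 0)"
proof (cases "j < i \<and> even (i - j)")
  case True
  have "(\<lambda>n. 2 * real (i choose j) * h n ^ (i - j - 2)) \<longlonglongrightarrow> 2 * real (i choose j) * 0 ^ (i - j - 2)"
    by (intro tendsto_intros assms)
  also have "2 * real (i choose j) * 0 ^ (i - j - 2) = (if i = j + 2 then real ((j + 2) * (j + 1)) else 0)"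
  proof (cases "i = j + 2")
    case i: True
    have "2 * (i choose j) = 2 * ((j + 2) choose 2)"
      using i binomial_symmetric[of j i] by simp
    also have "\<dots> = (j + 2) * (j + 1)" by (simp add: choose_two)
    finally have "2 * real (i choose j) = real ((j + 2) * (j + 1))" by (metis of_nat_mult of_nat_numeral)
    then show ?thesis using i by simp
  next
    case False
    then have "i - j - 2 \<noteq> 0" using True by presburger
    then show ?thesis using False by (simp add: power_0_left)
  qed
  finally show ?thesis using True by (simp only: diff2_coeff_def if_True simp_thms)
next
  case False
  then have "i \<noteq> j + 2" by auto
  moreover have "diff2_coeff (h n) i j = 0" for n using False by (simp only: diff2_coeff_def if_False)
  ultimately show ?thesis by simp
qed

lemma tendsto_mult_le_1_zero:
  fixes h \<rho> :: "nat \<Rightarrow> real"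
  assumes h: "h \<longlonglongrightarrow> 0" and rho: "\<And>j. \<bar>\<rho> j\<bar> \<le> 1"
  shows "(\<lambda>j. \<rho> j * h j) \<longlonglongrightarrow> 0"
proof (rule tendsto_rabs_zero_cancel, rule tendsto_sandwich)
  show "\<forall>\<^sub>F j in sequentially. 0 \<le> \<bar>\<rho> j * h j\<bar>" by simp
  show "\<forall>\<^sub>F j in sequentially. \<bar>\<rho> j * h j\<bar> \<le> \<bar>h j\<bar>"
    using rho by (intro always_eventually allI) (auto simp: abs_mult intro: mult_left_le_one_le)
  show "(\<lambda>j. \<bar>h j\<bar>) \<longlonglongrightarrow> 0" using h by (rule tendsto_rabs_zero)
qed simp

text \<open>In the limit the coefficients of the parity opposite to \<open>e\<close> vanish; divided by \<open>\<rho> * h\<close> they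
  still converge, to the first order correction.\<close>

lemma scaled_hahn_coeff_limit:
  fixes c :: "nat \<Rightarrow> nat \<Rightarrow> real" and h \<nu> \<rho> :: "nat \<Rightarrow> real" and e :: nat
  defines "t \<equiv> \<lambda>j k. if even (e - k) then 1 else \<rho> j * h j"
  assumes h: "h \<longlonglongrightarrow> 0" "\<And>j. h j \<noteq> 0" and nu: "\<nu> \<longlonglongrightarrow> 0"
    and rho: "\<And>j. \<rho> j \<noteq> 0" "\<And>j. \<bar>\<rho> j\<bar> \<le> 1"
    and monic: "\<And>j. c j e = 1"
    and eq: "\<And>j. scaled_hahn_eq e (h j) (\<nu> j) (\<rho> j) (\<lambda>x. \<Sum>i\<le>e. c j i * x ^ i)"
  shows "\<exists>g. g e = 1 \<and> (\<forall>k>e. g k = 0) \<and> (\<forall>k\<le>e. (\<lambda>j. c j k / t j k) \<longlonglongrightarrow> g k) \<and>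
    (\<forall>k<e. real (e - k) * g k + real ((k + 2) * (k + 1)) * g (k + 2) +
       (if odd (e - k) then real ((k + 1) * k) / 2 * g (k + 1) else 0) = 0)"
proof -
  let ?M = "\<lambda>j. scaled_hahn_mat e (h j) (\<nu> j) (\<rho> j)"
  have t_nz: "t j k \<noteq> 0" for j k using rho h by (simp add: t_def)
  \<comment> \<open>Limit of the matrix after rescaling by \<open>t\<close>. The entry i = k + 2 is
    the second derivative; i = k + 1 stems from the term (\<rho> * h / 2) * x * F'' and survives
    only in the rows where the rescaling divides by \<rho> * h.\<close>
  define Elim where "Elim k i = (if i = k + 2 then real ((k + 2) * (k + 1)) else
      if i = k + 1 \<and> odd (e - k) then real ((k + 1) * k) / 2 else 0)" for k i
  have rho_h: "(\<lambda>j. \<rho> j * h j) \<longlonglongrightarrow> 0"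
    using h(1) rho(2) by (rule tendsto_mult_le_1_zero)
  have d1: "(\<lambda>j. if k = 0 then 0 else diff1_coeff (h j) i (k - 1)) \<longlonglongrightarrow> (if i = k then real i else 0)" for i k
    using tendsto_diff1_coeff[OF h(1), of i "k - 1"] by (cases k) (auto simp: diff1_coeff_def)
  have d2: "(\<lambda>j. if k = 0 then 0 else diff2_coeff (h j) i (k - 1)) \<longlonglongrightarrow> (if i = k + 1 then real ((k + 1) * k) else 0)" for i k
    using tendsto_diff2_coeff[OF h(1), of i "k - 1"] by (cases k) (auto simp: diff2_coeff_def)
  have d3: "(\<lambda>j. \<nu> j * (if k < 2 then 0 else diff2_coeff (h j) i (k - 2))) \<longlonglongrightarrow> 0" for i k
  proof (cases "k < 2")
    case False
    have "(\<lambda>j. \<nu> j * diff2_coeff (h j) i (k - 2)) \<longlonglongrightarrow> 0 * (if i = k - 2 + 2 then real ((k - 2 + 2) * (k - 2 + 1)) else 0)"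
      by (intro tendsto_mult nu tendsto_diff2_coeff h)
    then show ?thesis using False by simp
  qed simp
  have d4: "(\<lambda>j. \<rho> j * h j / 2 * (if k = 0 then 0 else diff2_coeff (h j) i (k - 1))) \<longlonglongrightarrow> 0" for i k
    using tendsto_mult[OF tendsto_divide[OF rho_h tendsto_const[of 2]] d2[of k i]] by simp
  have d5: "(\<lambda>j. if i = k then real e * (1 - (real e - 1) * \<nu> j) else 0) \<longlonglongrightarrow> (if i = k then real e else 0)" for i k
  proof (cases "i = k")
    case True
    have "(\<lambda>j. real e * (1 - (real e - 1) * \<nu> j)) \<longlonglongrightarrow> real e * (1 - (real e - 1) * 0)"
      by (intro tendsto_intros nu)
    then show ?thesis using True by simp
  qed simp
  have M_lim: "(\<lambda>j. ?M j k i) \<longlonglongrightarrow> - (if i = k then real i else 0) +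
      (if i = k + 2 then real ((k + 2) * (k + 1)) else 0) + 0 + 0 + (if i = k then real e else 0)" for k i
    unfolding scaled_hahn_mat_def
    by (intro tendsto_add tendsto_minus d1 d3 d4 d5 tendsto_diff2_coeff h)
  have diag: "(\<lambda>j. ?M j k k) \<longlonglongrightarrow> real e - real k" for k
    using M_lim[of k k] by simp
  have off: "(\<lambda>j. t j i / t j k * ?M j k i) \<longlonglongrightarrow> Elim k i" if "k < i" "i \<le> e" for k i
  proof (cases "even (i - k)")
    case True
    then have "even (e - i) \<longleftrightarrow> even (e - k)" using that by presburger
    then have "t j i / t j k * ?M j k i = ?M j k i" for j using t_nz[of j k] by (auto simp: t_def)
    moreover have "Elim k i = (if i = k + 2 then real ((k + 2) * (k + 1)) else 0)"
      using True by (auto simp: Elim_def)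
    ultimately show ?thesis using M_lim[of k i] \<open>k < i\<close> by (simp only:) simp
  next
    case False
    have M_eq: "?M j k i = \<rho> j * h j / 2 * (if k = 0 then 0 else diff2_coeff (h j) i (k - 1))" for j
    proof -
      have "even (i - (k - 1))" if "k \<noteq> 0" using that False \<open>k < i\<close> by presburger
      moreover have "odd (i - (k - 2))" if "\<not> k < 2" using that False \<open>k < i\<close> by presburger
      ultimately show ?thesis using that False by (auto simp: scaled_hahn_mat_def diff1_coeff_def diff2_coeff_def)
    qed
    show ?thesis
    proof (cases "even (e - k)")
      case even: True
      then have "odd (e - i)" using that False by presburger
      then have "(\<lambda>j. t j i / t j k * ?M j k i) = (\<lambda>j. \<rho> j * h j * (\<rho> j * h j / 2 * (if k = 0 then 0 else diff2_coeff (h j) i (k - 1))))"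
        using even by (simp add: t_def M_eq)
      moreover have "(\<lambda>j. \<rho> j * h j * (\<rho> j * h j / 2 * (if k = 0 then 0 else diff2_coeff (h j) i (k - 1)))) \<longlonglongrightarrow> 0 * 0"
        by (intro tendsto_mult rho_h d4)
      moreover have "Elim k i = 0" using even False by (auto simp: Elim_def)
      ultimately show ?thesis by simp
    next
      case odd: False
      then have "even (e - i)" using that False by presburger
      then have "(\<lambda>j. t j i / t j k * ?M j k i) = (\<lambda>j. (if k = 0 then 0 else diff2_coeff (h j) i (k - 1)) / 2)"
        using odd rho h by (auto simp: t_def M_eq fun_eq_iff)
      moreover have "(\<lambda>j. (if k = 0 then 0 else diff2_coeff (h j) i (k - 1)) / 2) \<longlonglongrightarrow> (if i = k + 1 then real ((k + 1) * k) else 0) / 2"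
        by (intro tendsto_divide d2 tendsto_const) simp
      moreover have "Elim k i = (if i = k + 1 then real ((k + 1) * k) else 0) / 2" using odd False by (auto simp: Elim_def)
      ultimately show ?thesis by (simp only:)
    qed
  qed
  have step: "c j k / t j k * ?M j k k = - (\<Sum>i\<in>{k<..e}. c j i / t j i * (t j i / t j k * ?M j k i))" if "k < e" for j k
  proof -
    have "0 = (\<Sum>i\<le>e. c j i * ?M j k i)"
      using scaled_hahn_coeff_eq[OF h(2) eq] that by simp
    also have "\<dots> = (\<Sum>i\<in>{k..e}. c j i * ?M j k i)"
      by (rule sum.mono_neutral_right) (auto simp: scaled_hahn_mat_below)
    also have "{k..e} = insert k {k<..e}" using that by auto
    finally have "c j k * ?M j k k = - (\<Sum>i\<in>{k<..e}. c j i * ?M j k i)" by simp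
    then have "c j k / t j k * ?M j k k = - (\<Sum>i\<in>{k<..e}. c j i * ?M j k i) / t j k"
      by (simp add: field_simps)
    also have "\<dots> = - (\<Sum>i\<in>{k<..e}. c j i / t j i * (t j i / t j k * ?M j k i))"
      using t_nz by (simp add: sum_divide_distrib)
    finally show ?thesis .
  qed
  \<comment> \<open>Back substitution in the triangular system: convergence descends from the monic
    coefficient k = e, and division is possible because the diagonal tends to e - k > 0.\<close>
  have conv: "\<exists>g. (\<lambda>j. c j k / t j k) \<longlonglongrightarrow> g" if "k \<le> e" for k
    using that
  proof (induction "e - k" arbitrary: k rule: less_induct)
    case less
    show ?case
    proof (cases "k = e")
      case True
      then show ?thesis using monic by (auto simp: t_def)
    next
      case False
      then have "k < e" using less.prems by simp
      have "\<exists>g. (\<lambda>j. c j i / t j i) \<longlonglongrightarrow> g" if "i \<in> {k<..e}" for i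
        using less.hyps[of i] that by auto
      then obtain g where g: "\<And>i. i \<in> {k<..e} \<Longrightarrow> (\<lambda>j. c j i / t j i) \<longlonglongrightarrow> g i" by metis
      have "(\<lambda>j. - (\<Sum>i\<in>{k<..e}. c j i / t j i * (t j i / t j k * ?M j k i)) / ?M j k k) \<longlonglongrightarrow>
         - (\<Sum>i\<in>{k<..e}. g i * Elim k i) / (real e - real k)"
        by (intro tendsto_divide tendsto_minus tendsto_sum tendsto_mult g off diag) (use \<open>k < e\<close> in auto)
      moreover have "\<forall>\<^sub>F j in sequentially. ?M j k k \<noteq> 0"
        using diag[of k] \<open>k < e\<close> by (intro tendsto_imp_eventually_ne[of _ "real e - real k"]) auto
      then have "\<forall>\<^sub>F j in sequentially. - (\<Sum>i\<in>{k<..e}. c j i / t j i * (t j i / t j k * ?M j k i)) / ?M j k k = c j k / t j k"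
        by eventually_elim (simp only: step[OF \<open>k < e\<close>, symmetric] nonzero_mult_div_cancel_right not_False_eq_True)
      ultimately show ?thesis using tendsto_cong by fastforce
    qed
  qed
  then obtain g0 where g0: "\<And>k. k \<le> e \<Longrightarrow> (\<lambda>j. c j k / t j k) \<longlonglongrightarrow> g0 k" by metis
  define g where "g k = (if k \<le> e then g0 k else 0)" for k
  have g: "(\<lambda>j. c j k / t j k) \<longlonglongrightarrow> g k" if "k \<le> e" for k using g0 that by (simp add: g_def)
  have "g e = 1"
    using LIMSEQ_unique[OF g[of e]] monic by (simp add: t_def)
  moreover have "real (e - k) * g k + real ((k + 2) * (k + 1)) * g (k + 2) +
       (if odd (e - k) then real ((k + 1) * k) / 2 * g (k + 1) else 0) = 0" if "k < e" for k
  proof -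
    have "(\<lambda>j. c j k / t j k * ?M j k k) \<longlonglongrightarrow> g k * (real e - real k)"
      using that by (intro tendsto_mult g diag) auto
    moreover have "(\<lambda>j. c j k / t j k * ?M j k k) \<longlonglongrightarrow> - (\<Sum>i\<in>{k<..e}. g i * Elim k i)"
      unfolding step[OF that] by (intro tendsto_minus tendsto_sum tendsto_mult g off) auto
    ultimately have *: "g k * (real e - real k) = - (\<Sum>i\<in>{k<..e}. g i * Elim k i)" by (rule LIMSEQ_unique)
    have "(\<Sum>i\<in>{k<..e}. g i * Elim k i) = (\<Sum>i\<in>{k + 1, k + 2}. g i * Elim k i)"
      by (rule sum.mono_neutral_cong) (auto simp: Elim_def g_def)
    also have "\<dots> = g (k + 1) * Elim k (k + 1) + g (k + 2) * Elim k (k + 2)" by simp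
    finally have "g k * (real e - real k) = - (g (k + 1) * Elim k (k + 1) + g (k + 2) * Elim k (k + 2))"
      using * by (simp only:)
    moreover have "Elim k (k + 1) = (if odd (e - k) then real ((k + 1) * k) / 2 else 0)"
      "Elim k (k + 2) = real ((k + 2) * (k + 1))" "real (e - k) = real e - real k"
      using that by (simp_all add: Elim_def of_nat_diff)
    ultimately show ?thesis by (cases "odd (e - k)") (simp_all only: if_True if_False, simp_all add: algebra_simps)
  qed
  ultimately show ?thesis using g by (intro exI[of _ g]) (auto simp: g_def)
qed

section \<open>The Hermite equation and its first order perturbation\<close>

definition hermite_eq :: "nat \<Rightarrow> real poly \<Rightarrow> bool" where
  "hermite_eq e H \<longleftrightarrow> pderiv (pderiv H) = pCons 0 (pderiv H) - smult (real e) H"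

lemma hermite_eq_coeff:
  assumes "hermite_eq e H"
  shows "real ((k + 2) * (k + 1)) * coeff H (k + 2) = (real k - real e) * coeff H k"
proof -
  have "coeff (pderiv (pderiv H)) k = coeff (pCons 0 (pderiv H) - smult (real e) H) k"
    using assms by (simp add: hermite_eq_def)
  then show ?thesis by (cases k) (simp_all add: coeff_pderiv coeff_pCons algebra_simps)
qed

text \<open>The leading coefficient of a nonzero solution forces its degree to be exactly e, so no
  solution but 0 can miss the power x^e.\<close>

lemma hermite_eq_unique_0:
  assumes "hermite_eq e K" "coeff K e = 0"
  shows "K = 0"
proof (rule ccontr)
  assume "K \<noteq> 0"
  have "coeff K (degree K + 2) = 0" by (rule coeff_eq_0) simp
  then have "(real (degree K) - real e) * lead_coeff K = 0"
    using hermite_eq_coeff[OF assms(1), of "degree K"] by simp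
  then have "degree K = e" using \<open>K \<noteq> 0\<close> by simp
  then show False using assms(2) \<open>K \<noteq> 0\<close> by (metis leading_coeff_0_iff)
qed

text \<open>The right hand side of the conclusion is the value at a zero of \<open>H\<close> of the unique solution of
  degree below \<open>e\<close> of the inhomogeneous equation.\<close>

lemma hermite_perturbation_at_root:
  assumes H: "hermite_eq e H" and odd0: "\<And>k. odd (e - k) \<Longrightarrow> k \<le> e \<Longrightarrow> coeff H k = 0" and deg: "degree H \<le> e"
    and G: "pderiv (pderiv G) - pCons 0 (pderiv G) + smult (real e) G + smult (1 / 2) (pCons 0 (pderiv (pderiv H))) = 0"
    and "coeff G e = 0" and root: "poly H x = 0"
  shows "poly G x = - ((real e - 1) / 3 + x\<^sup>2 / 6) * poly (pderiv H) x"
proof -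
  \<comment> \<open>Difference of G and an explicit particular solution. By parity and degree that
    solution has no x^e term, so \<open>K\<close> falls under uniqueness for the homogeneous
    equation; its part x * H disappears at a zero of H.\<close>
  define K where "K = G + smult ((real e - 1) / 3) (pderiv H) + smult (1 / 6) (pCons 0 (pCons 0 (pderiv H))) - smult (real e / 6) (pCons 0 H)"
  have H2: "pderiv (pderiv H) = pCons 0 (pderiv H) - smult (real e) H" using H by (simp add: hermite_eq_def)
  have H3: "pderiv (pderiv (pderiv H)) = pderiv H + pCons 0 (pderiv (pderiv H)) - smult (real e) (pderiv H)"
    by (subst H2) (simp add: pderiv_diff pderiv_smult pderiv_pCons)
  have "poly (pderiv (pderiv K)) y = poly (pCons 0 (pderiv K) - smult (real e) K) y" for y
  proof -
    have h2: "poly (pderiv (pderiv H)) y = y * poly (pderiv H) y - real e * poly H y"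
      by (subst H2) simp
    have h3: "poly (pderiv (pderiv (pderiv H))) y = poly (pderiv H) y + y * poly (pderiv (pderiv H)) y - real e * poly (pderiv H) y"
      by (subst H3) simp
    have "poly (pderiv (pderiv G) - pCons 0 (pderiv G) + smult (real e) G + smult (1 / 2) (pCons 0 (pderiv (pderiv H)))) y = 0"
      unfolding G by simp
    then have g2: "poly (pderiv (pderiv G)) y = y * poly (pderiv G) y - real e * poly G y - y / 2 * poly (pderiv (pderiv H)) y"
      by simp
    have "poly (pderiv (pderiv K)) y = poly (pderiv (pderiv G)) y + (real e - 1) / 3 * poly (pderiv (pderiv (pderiv H))) y +
       1 / 6 * (2 * poly (pderiv H) y + 4 * y * poly (pderiv (pderiv H)) y + y\<^sup>2 * poly (pderiv (pderiv (pderiv H))) y) -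
       real e / 6 * (2 * poly (pderiv H) y + y * poly (pderiv (pderiv H)) y)"
      unfolding K_def
      by (simp only: pderiv_add pderiv_diff pderiv_smult pderiv_pCons poly_add poly_diff poly_smult poly_pCons)
        (simp add: algebra_simps power2_eq_square)
    moreover have "poly (pCons 0 (pderiv K) - smult (real e) K) y = y * (poly (pderiv G) y + (real e - 1) / 3 * poly (pderiv (pderiv H)) y +
       1 / 6 * (2 * y * poly (pderiv H) y + y\<^sup>2 * poly (pderiv (pderiv H)) y) - real e / 6 * (poly H y + y * poly (pderiv H) y)) -
       real e * (poly G y + (real e - 1) / 3 * poly (pderiv H) y + 1 / 6 * y\<^sup>2 * poly (pderiv H) y - real e / 6 * y * poly H y)"
      unfolding K_def by (simp add: pderiv_add pderiv_diff pderiv_smult pderiv_pCons algebra_simps power2_eq_square)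
    ultimately show ?thesis
      unfolding g2 h3 h2 by (simp add: field_simps power2_eq_square)
  qed
  then have "hermite_eq e K" unfolding hermite_eq_def by (metis poly_eq_poly_eq_iff ext)
  moreover have "coeff K e = 0"
  proof -
    have "coeff H (Suc e) = 0" using deg by (intro coeff_eq_0) simp
    moreover have "coeff H (e - 1) = 0" if "e > 0" using odd0[of "e - 1"] that by simp
    ultimately show ?thesis
      using \<open>coeff G e = 0\<close> unfolding K_def
      by (cases e; cases "e - 1") (auto simp: coeff_pderiv coeff_pCons)
  qed
  ultimately have "K = 0" by (rule hermite_eq_unique_0)
  then have "poly K x = 0" by simp
  then show ?thesis
    using root unfolding K_def by (simp add: algebra_simps power2_eq_square)
qed

text \<open>At a multiple zero the equation, which expresses H'' through H' and H, would make H''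
  vanish at least to the order of H', whereas differentiation lowers that order by one.\<close>

lemma hermite_eq_simple_roots:
  assumes "hermite_eq e H" "H \<noteq> 0" "poly H x = 0"
  shows "poly (pderiv H) x \<noteq> 0"
proof
  assume d: "poly (pderiv H) x = 0"
  let ?r = "order x H"
  have nz: "pderiv H \<noteq> 0"
  proof
    assume "pderiv H = 0"
    then have "degree H = 0" by (simp add: pderiv_eq_0_iff)
    then obtain c where "H = [:c:]" by (meson degree_eq_zeroE)
    then show False using assms by simp
  qed
  have r: "?r = Suc (order x (pderiv H))"
    using assms by (intro order_pderiv)
  have nz2: "pderiv (pderiv H) \<noteq> 0"
    using d nz by (metis degree_eq_zeroE pderiv_eq_0_iff poly_pCons poly_0 add.right_neutral mult_zero_right pCons_0_0)
  have r2: "order x (pderiv H) = Suc (order x (pderiv (pderiv H)))"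
    using nz d by (rule order_pderiv)
  let ?X = "[:- x, 1:] ^ order x (pderiv H)"
  have "?X dvd pderiv H" "?X dvd H"
    using r by (simp_all add: order_divides)
  then have "?X dvd [:0, 1:] * pderiv H - [:real e:] * H" by (intro dvd_diff dvd_mult)
  then have "?X dvd pderiv (pderiv H)" using assms(1) by (simp add: hermite_eq_def)
  then have "order x (pderiv H) \<le> order x (pderiv (pderiv H))" using nz2 by (simp add: order_divides)
  then show False using r2 by simp
qed

section \<open>Inverse power sums and gaps of the Hermite zeros\<close>

lemma poly_pderiv_root_prod:
  fixes R :: "real set"
  assumes "finite R" "a \<in> R"
  shows "poly (pderiv (\<Prod>b\<in>R. [:- b, 1:])) a = (\<Prod>b\<in>R - {a}. a - b)"
proof -
  have X: "pderiv [:- a, 1:] = 1" by (simp add: pderiv_pCons)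
  have "(\<Prod>b\<in>R. [:- b, 1:]) = [:- a, 1:] * (\<Prod>b\<in>R - {a}. [:- b, 1:])"
    using assms by (rule prod.remove)
  then show ?thesis by (simp add: pderiv_mult X poly_prod del: mult_pCons_left)
qed

text \<open>With H = (x - a) * A the equation at the zero a reads 2 * A'(a) = a * A(a), and A' / A
  at a is the sum of 1 / (a - b) over the other zeros.\<close>

lemma hermite_stieltjes:
  fixes R :: "real set"
  assumes H: "hermite_eq e H" and "finite R" and prod: "H = (\<Prod>a\<in>R. [:- a, 1:])" and "a \<in> R"
  shows "(\<Sum>b\<in>R - {a}. 2 / (a - b)) = a"
proof -
  define A where "A = (\<Prod>b\<in>R - {a}. [:- b, 1:])"
  have HA: "H = [:- a, 1:] * A" unfolding prod A_def using assms by (simp add: prod.remove)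
  have X: "pderiv [:- a, 1:] = 1" by (simp add: pderiv_pCons)
  have d1: "pderiv H = A + [:- a, 1:] * pderiv A" unfolding HA pderiv_mult X by (simp only: mult_1_right add.commute)
  have d2: "pderiv (pderiv H) = 2 * pderiv A + [:- a, 1:] * pderiv (pderiv A)"
    unfolding d1 pderiv_add pderiv_mult X by (simp only: mult_1_right mult_2 ac_simps)
  have "poly (pderiv (pderiv H)) a = a * poly (pderiv H) a - real e * poly H a"
    using H by (simp add: hermite_eq_def)
  then have 1: "2 * poly (pderiv A) a = a * poly A a"
    unfolding d2 unfolding d1 unfolding HA by simp
  have A0: "poly A a \<noteq> 0" unfolding A_def using assms by (simp add: poly_prod)
  have "poly (pderiv A) a = (\<Sum>b\<in>R - {a}. \<Prod>c\<in>R - {a} - {b}. a - c)"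
    unfolding A_def by (simp add: pderiv_prod poly_sum poly_prod pderiv_pCons)
  also have "\<dots> = (\<Sum>b\<in>R - {a}. poly A a / (a - b))"
  proof (intro sum.cong refl)
    fix b assume b: "b \<in> R - {a}"
    have "poly A a = (a - b) * (\<Prod>c\<in>R - {a} - {b}. a - c)"
      unfolding A_def using b \<open>finite R\<close> by (simp add: poly_prod prod.remove left_diff_distrib)
    then show "(\<Prod>c\<in>R - {a} - {b}. a - c) = poly A a / (a - b)" using b by auto
  qed
  also have "\<dots> = poly A a * (\<Sum>b\<in>R - {a}. 1 / (a - b))" by (simp add: sum_distrib_left)
  finally have "a * poly A a = poly A a * (2 * (\<Sum>b\<in>R - {a}. 1 / (a - b)))" using 1 by (metis mult.left_commute)
  then have "a = 2 * (\<Sum>b\<in>R - {a}. 1 / (a - b))" using A0 by (metis mult.commute mult_cancel_left)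
  then show ?thesis by (simp add: sum_distrib_left)
qed

text \<open>Stieltjes' relations, divided by \<open>a\<close> and by \<open>a ^ 3\<close> and summed over the zeros, become
  symmetric in pairs of zeros.\<close>

lemma hermite_inverse_power_sums:
  fixes R :: "real set"
  assumes fin: "finite R" and st: "\<And>a. a \<in> R \<Longrightarrow> (\<Sum>b\<in>R - {a}. 2 / (a - b)) = a - u / a"
    and sym: "uminus ` R = R" and "0 \<notin> R"
  shows "(1 + u) * (\<Sum>a\<in>R. 1 / a\<^sup>2) = real (card R)"
    and "(3 + u) * (\<Sum>a\<in>R. 1 / a ^ 4) = (\<Sum>a\<in>R. 1 / a\<^sup>2) + (\<Sum>a\<in>R. 1 / a\<^sup>2)\<^sup>2"
proof -
  have odd0: "(\<Sum>a\<in>R. f a) = 0" if "\<And>a. f (- a) = - f a" for f :: "real \<Rightarrow> real"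
  proof -
    have "(\<Sum>a\<in>R. f a) = (\<Sum>a\<in>uminus ` R. f a)" using sym by simp
    also have "\<dots> = (\<Sum>a\<in>R. f (- a))" by (subst sum.reindex) auto
    also have "\<dots> = - (\<Sum>a\<in>R. f a)" using that by (simp add: sum_negf)
    finally show ?thesis by simp
  qed
  have off: "(\<Sum>a\<in>R. \<Sum>b\<in>R - {a}. f a * g b) = (\<Sum>a\<in>R. f a) * (\<Sum>b\<in>R. g b) - (\<Sum>a\<in>R. f a * g a)" for f g :: "real \<Rightarrow> real"
    using fin by (simp add: sum_product sum_subtractf[symmetric] sum_diff1)
  have del: "(\<Sum>b\<in>R - {a}. g b) = (\<Sum>b\<in>R. if a = b then 0 else g b)" for g :: "real \<Rightarrow> real" and a
    by (rule sum.mono_neutral_cong_left) (use fin in auto)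
  have swap: "(\<Sum>a\<in>R. \<Sum>b\<in>R - {a}. F b a) = (\<Sum>a\<in>R. \<Sum>b\<in>R - {a}. F a b)" for F :: "real \<Rightarrow> real \<Rightarrow> real"
  proof -
    have "(\<Sum>a\<in>R. \<Sum>b\<in>R - {a}. F b a) = (\<Sum>b\<in>R. \<Sum>a\<in>R. if a = b then 0 else F b a)"
      unfolding del by (rule sum.swap)
    also have "\<dots> = (\<Sum>a\<in>R. \<Sum>b\<in>R - {a}. F a b)"
      unfolding del by (intro sum.cong refl) auto
    finally show ?thesis .
  qed
  \<comment> \<open>Adding the double sum to its copy with a and b exchanged replaces the pole at a
    = b by a divided difference of f. For f = 1/a and f = 1/a^3 this is a polynomial in 1/a and 1/b,
    and the sums of odd powers vanish by symmetry.\<close>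
  have symm: "(\<Sum>a\<in>R. f a * (a - u / a)) = (\<Sum>a\<in>R. \<Sum>b\<in>R - {a}. (f a - f b) / (a - b))" for f :: "real \<Rightarrow> real"
  proof -
    let ?S = "\<Sum>a\<in>R. \<Sum>b\<in>R - {a}. f a / (a - b)"
    have "(\<Sum>a\<in>R. f a * (a - u / a)) = (\<Sum>a\<in>R. f a * (\<Sum>b\<in>R - {a}. 2 / (a - b)))"
      using st by simp
    also have "\<dots> = ?S + ?S"
      unfolding sum_distrib_left sum.distrib[symmetric] by (intro sum.cong refl) (simp add: add_divide_distrib[symmetric])
    also have "\<dots> = ?S + (\<Sum>a\<in>R. \<Sum>b\<in>R - {a}. f b / (b - a))"
      by (simp only: swap[of "\<lambda>a b. f a / (a - b)"])
    also have "\<dots> = (\<Sum>a\<in>R. \<Sum>b\<in>R - {a}. (f a - f b) / (a - b))"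
      unfolding sum.distrib[symmetric]
    proof (intro sum.cong refl)
      fix a b assume "a \<in> R" "b \<in> R - {a}"
      have "f b / (b - a) = - f b / (a - b)" by (metis minus_diff_eq minus_divide_divide minus_minus)
      then show "f a / (a - b) + f b / (b - a) = (f a - f b) / (a - b)"
        by (simp add: diff_divide_distrib)
    qed
    finally show ?thesis .
  qed
  have nz: "a \<noteq> 0" if "a \<in> R" for a using that \<open>0 \<notin> R\<close> by auto
  have p1: "(\<Sum>a\<in>R. 1 / a) = 0" by (rule odd0) simp
  have "(\<Sum>a\<in>R. 1 / a * (a - u / a)) = real (card R) - u * (\<Sum>a\<in>R. 1 / a\<^sup>2)"
  proof -
    have "(\<Sum>a\<in>R. 1 / a * (a - u / a)) = (\<Sum>a\<in>R. 1 - u * (1 / a\<^sup>2))"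
      using nz by (intro sum.cong refl) (simp add: field_simps power2_eq_square)
    then show ?thesis by (simp add: sum_subtractf sum_distrib_left)
  qed
  moreover have "(\<Sum>a\<in>R. \<Sum>b\<in>R - {a}. (1 / a - 1 / b) / (a - b)) = (\<Sum>a\<in>R. \<Sum>b\<in>R - {a}. - (1 / a) * (1 / b))"
  proof (intro sum.cong refl)
    fix a b assume "a \<in> R" "b \<in> R - {a}"
    then have "a \<noteq> 0" "b \<noteq> 0" "a - b \<noteq> 0" using nz by auto
    then show "(1 / a - 1 / b) / (a - b) = - (1 / a) * (1 / b)"
      by (simp add: divide_simps)
  qed
  moreover have "(\<Sum>a\<in>R. \<Sum>b\<in>R - {a}. - (1 / a) * (1 / b)) = (\<Sum>a\<in>R. 1 / a\<^sup>2)"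
    unfolding off by (simp add: p1 sum_negf power2_eq_square)
  ultimately show "(1 + u) * (\<Sum>a\<in>R. 1 / a\<^sup>2) = real (card R)"
    using symm[of "\<lambda>a. 1 / a"] by (simp add: algebra_simps)
  have "(\<Sum>a\<in>R. 1 / a ^ 3 * (a - u / a)) = (\<Sum>a\<in>R. 1 / a\<^sup>2) - u * (\<Sum>a\<in>R. 1 / a ^ 4)"
    unfolding sum_distrib_left sum_subtractf[symmetric]
    using nz by (intro sum.cong refl) (simp add: field_simps power2_eq_square power3_eq_cube power4_eq_xxxx)
  moreover have "(\<Sum>a\<in>R. \<Sum>b\<in>R - {a}. (1 / a ^ 3 - 1 / b ^ 3) / (a - b)) =
     (\<Sum>a\<in>R. \<Sum>b\<in>R - {a}. - (1 / a) * (1 / b ^ 3)) + (\<Sum>a\<in>R. \<Sum>b\<in>R - {a}. - (1 / a\<^sup>2) * (1 / b\<^sup>2)) +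
     (\<Sum>a\<in>R. \<Sum>b\<in>R - {a}. - (1 / a ^ 3) * (1 / b))"
    unfolding sum.distrib[symmetric]
  proof (intro sum.cong refl)
    fix a b assume "a \<in> R" "b \<in> R - {a}"
    then have "a \<noteq> 0" "b \<noteq> 0" "a - b \<noteq> 0" using nz by auto
    then show "(1 / a ^ 3 - 1 / b ^ 3) / (a - b) = - (1 / a) * (1 / b ^ 3) + - (1 / a\<^sup>2) * (1 / b\<^sup>2) + - (1 / a ^ 3) * (1 / b)"
      by (simp add: divide_simps) (simp add: algebra_simps power2_eq_square power3_eq_cube)
  qed
  moreover have "(\<Sum>a\<in>R. \<Sum>b\<in>R - {a}. - (1 / a) * (1 / b ^ 3)) = (\<Sum>a\<in>R. 1 / a ^ 4)"
    unfolding off by (simp add: p1 sum_negf power3_eq_cube power4_eq_xxxx mult.assoc)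
  moreover have "(\<Sum>a\<in>R. \<Sum>b\<in>R - {a}. - (1 / a ^ 3) * (1 / b)) = (\<Sum>a\<in>R. 1 / a ^ 4)"
    unfolding off by (simp add: p1 sum_negf power3_eq_cube power4_eq_xxxx mult.assoc)
  moreover have "(\<Sum>a\<in>R. \<Sum>b\<in>R - {a}. - (1 / a\<^sup>2) * (1 / b\<^sup>2)) = (\<Sum>a\<in>R. 1 / a ^ 4) - (\<Sum>a\<in>R. 1 / a\<^sup>2)\<^sup>2"
    unfolding off by (simp add: sum_negf power2_eq_square power4_eq_xxxx mult.assoc)
  ultimately show "(3 + u) * (\<Sum>a\<in>R. 1 / a ^ 4) = (\<Sum>a\<in>R. 1 / a\<^sup>2) + (\<Sum>a\<in>R. 1 / a\<^sup>2)\<^sup>2"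
    using symm[of "\<lambda>a. 1 / a ^ 3"] by (simp add: algebra_simps)
qed

text \<open>Suppose that distinct squares differ by at least 3. If 0 is a zero, the mean of 1/a^2
  over the other zeros is exactly 1/3 although each a^2 is at least 3, so these zeros are among
  \<plusminus> sqrt 3, which is too few. Otherwise the sum of 1/a^2 is e, and only the pair of
  smallest modulus can carry most of it: there 1/a^2 is at least 5 * e / 12. The fourth powers of
  this pair alone then exceed the known sum (e + e^2) / 3 once e > 24.\<close>

lemma hermite_close_roots:
  fixes R :: "real set"
  assumes H: "hermite_eq e H" and fin: "finite R" and prod: "H = (\<Prod>a\<in>R. [:- a, 1:])"
    and sym: "uminus ` R = R" and card: "card R = e" and e: "e \<ge> 27"
  shows "\<exists>a\<in>R. \<exists>b\<in>R. 0 < \<bar>a\<^sup>2 - b\<^sup>2\<bar> \<and> \<bar>a\<^sup>2 - b\<^sup>2\<bar> < 3"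
proof (cases "0 \<in> R")
  case True
  define R0 where "R0 = R - {0}"
  have fin0: "finite R0" and card0: "card R0 = e - 1" using fin True card by (auto simp: R0_def)
  \<comment> \<open>The zero at the origin contributes 2/a to Stieltjes' relation; moved to the
    other side it yields the power sum identities with u = 2.\<close>
  have "(\<Sum>b\<in>R0 - {a}. 2 / (a - b)) = a - 2 / a" if "a \<in> R0" for a
  proof -
    have "a = (\<Sum>b\<in>R - {a}. 2 / (a - b))"
      using hermite_stieltjes[OF H fin prod] that by (simp add: R0_def)
    also have "R - {a} = insert 0 (R0 - {a})" using that True by (auto simp: R0_def)
    also have "(\<Sum>b\<in>insert 0 (R0 - {a}). 2 / (a - b)) = 2 / a + (\<Sum>b\<in>R0 - {a}. 2 / (a - b))"
      using fin0 by (subst sum.insert) (auto simp: R0_def)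
    finally show ?thesis by simp
  qed
  then have p2: "3 * (\<Sum>a\<in>R0. 1 / a\<^sup>2) = real (e - 1)"
    using hermite_inverse_power_sums(1)[OF fin0, of 2] sym card0 by (fastforce simp: R0_def image_iff)
  show ?thesis
  proof (rule ccontr)
    assume neg: "\<not> ?thesis"
    have far: "a\<^sup>2 \<ge> 3" if "a \<in> R0" for a
      using neg True that by (force simp: R0_def)
    have "R0 - {sqrt 3, - sqrt 3} \<noteq> {}"
    proof
      assume "R0 - {sqrt 3, - sqrt 3} = {}"
      then have "card R0 \<le> card {sqrt 3, - sqrt 3}" by (intro card_mono) auto
      also have "\<dots> \<le> 2" by (simp add: card_insert_if)
      finally show False using card0 e by simp
    qed
    then obtain c where c: "c \<in> R0" "c \<noteq> sqrt 3" "c \<noteq> - sqrt 3" by auto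
    then have "c\<^sup>2 \<noteq> 3" by (metis real_sqrt_abs abs_eq_iff')
    then have c3: "c\<^sup>2 > 3" using far[OF c(1)] by simp
    have "(\<Sum>a\<in>R0. 1 / a\<^sup>2) < (\<Sum>a\<in>R0. 1 / 3)"
    proof (rule sum_strict_mono_ex1[OF fin0])
      show "\<forall>a\<in>R0. 1 / a\<^sup>2 \<le> 1 / 3" 
      proof
        fix a assume "a \<in> R0"
        from far[OF this] show "1 / a\<^sup>2 \<le> 1 / 3" by (intro divide_left_mono) auto
      qed
      show "\<exists>a\<in>R0. 1 / a\<^sup>2 < 1 / 3" using c(1) c3 by (intro bexI[of _ c] divide_strict_left_mono) auto
    qed
    then show False using p2 card0 by simp
  qed
next
  case False
  have st: "(\<Sum>b\<in>R - {a}. 2 / (a - b)) = a - 0 / a" if "a \<in> R" for a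
    using hermite_stieltjes[OF H fin prod that] by simp
  have p2: "(\<Sum>a\<in>R. 1 / a\<^sup>2) = real e"
    using hermite_inverse_power_sums(1)[OF fin st sym False] card by simp
  have p4: "3 * (\<Sum>a\<in>R. 1 / a ^ 4) = real e + (real e)\<^sup>2"
    using hermite_inverse_power_sums(2)[OF fin st sym False] p2 by simp
  show ?thesis
  proof (rule ccontr)
    assume neg: "\<not> ?thesis"
    have far: "a\<^sup>2 = b\<^sup>2 \<or> \<bar>a\<^sup>2 - b\<^sup>2\<bar> \<ge> 3" if "a \<in> R" "b \<in> R" for a b
      using neg that by force
    have "R \<noteq> {}" using card e by auto
    then obtain m where m: "m \<in> R" "\<And>a. a \<in> R \<Longrightarrow> m\<^sup>2 \<le> a\<^sup>2"
      using arg_min_if_finite[OF fin, of "\<lambda>a. a\<^sup>2"] by (metis not_le)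
    have "m \<noteq> 0" using m False by auto
    have mR: "- m \<in> R" using m sym by force
    define R1 where "R1 = R - {m, - m}"
    have R1: "finite R1" "card R1 = e - 2"
      using fin mR m \<open>m \<noteq> 0\<close> card by (auto simp: R1_def card_Diff_subset)
    have split: "(\<Sum>a\<in>R. f a) = f m + f (- m) + (\<Sum>a\<in>R1. f a)" for f :: "real \<Rightarrow> real"
    proof -
      have "R = insert m (insert (- m) R1)" using m mR by (auto simp: R1_def)
      moreover have "(\<Sum>a\<in>insert m (insert (- m) R1). f a) = f m + (f (- m) + (\<Sum>a\<in>R1. f a))"
        using R1 \<open>m \<noteq> 0\<close> by (subst sum.insert; (subst sum.insert)?) (auto simp: R1_def)
      ultimately show ?thesis by simp
    qed
    have R1_ge: "a\<^sup>2 > 3" if "a \<in> R1" for a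
    proof -
      have "a\<^sup>2 \<noteq> m\<^sup>2" using that by (auto simp: R1_def power2_eq_iff)
      moreover have "m\<^sup>2 > 0" using \<open>m \<noteq> 0\<close> by simp
      moreover have "a\<^sup>2 = m\<^sup>2 \<or> \<bar>a\<^sup>2 - m\<^sup>2\<bar> \<ge> 3" "m\<^sup>2 \<le> a\<^sup>2"
        using far[of a m] m that by (auto simp: R1_def)
      ultimately show ?thesis by linarith
    qed
    define R2 where "R2 = {a \<in> R1. a\<^sup>2 < 6}"
    \<comment> \<open>Squares strictly between 3 and 6 are less than 3 apart, so they coincide and
      belong to a single pair of zeros.\<close>
    have "card R2 \<le> 2"
    proof (cases "R2 = {}")
      case False
      then obtain b where b: "b \<in> R2" by auto
      have "R2 \<subseteq> {b, - b}"
      proof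
        fix a assume a: "a \<in> R2"
        then have "a\<^sup>2 = b\<^sup>2" using far[of a b] b R1_ge[of a] R1_ge[of b] by (auto simp: R2_def R1_def)
        then show "a \<in> {b, - b}" by (auto simp: power2_eq_iff)
      qed
      then have "card R2 \<le> card {b, - b}" by (intro card_mono) auto
      also have "\<dots> \<le> 2" by (simp add: card_insert_if)
      finally show ?thesis .
    qed simp
    \<comment> \<open>At most two terms exceed 1/6, by at most 1/6 each; this makes up exactly for
      the removed pair: (e - 2) / 6 + 2 / 6 = e / 6.\<close>
    have "(\<Sum>a\<in>R1. 1 / a\<^sup>2) \<le> (\<Sum>a\<in>R1. 1 / 6 + (if a \<in> R2 then 1 / 6 else 0))"
    proof (rule sum_mono)
      fix a assume a: "a \<in> R1"
      show "1 / a\<^sup>2 \<le> 1 / 6 + (if a \<in> R2 then 1 / 6 else 0)"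
      proof (cases "a\<^sup>2 < 6")
        case True
        have "1 / a\<^sup>2 \<le> 1 / 3" using R1_ge[OF a] by (intro divide_left_mono) auto
        then show ?thesis using True a by (simp add: R2_def)
      next
        case False
        then have "1 / a\<^sup>2 \<le> 1 / 6" by (intro divide_left_mono) auto
        then show ?thesis by simp
      qed
    qed
    also have "\<dots> = real (e - 2) / 6 + real (card R2) / 6"
    proof -
      have "R1 \<inter> R2 = R2" by (auto simp: R2_def)
      then show ?thesis using R1 by (simp add: sum.distrib sum.If_cases)
    qed
    also have "\<dots> \<le> real e / 6"
    proof -
      have "real (card R2) \<le> 2" "real (e - 2) = real e - 2" using \<open>card R2 \<le> 2\<close> e by auto
      then show ?thesis by linarith
    qed
    finally have "real e \<le> 2 / m\<^sup>2 + real e / 6" using p2 split[of "\<lambda>a. 1 / a\<^sup>2"] by simp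
    then have ge: "5 / 12 * real e \<le> 1 / m\<^sup>2" by simp
    have "(\<Sum>a\<in>R1. 1 / a ^ 4) \<ge> 0" by (intro sum_nonneg) auto
    then have "2 * (1 / m ^ 4) \<le> (\<Sum>a\<in>R. 1 / a ^ 4)" using split[of "\<lambda>a. 1 / a ^ 4"] by simp
    also have "1 / m ^ 4 = (1 / m\<^sup>2)\<^sup>2" by (simp add: power_divide power_mult[symmetric])
    finally have "2 * (1 / m\<^sup>2)\<^sup>2 \<le> (\<Sum>a\<in>R. 1 / a ^ 4)" .
    moreover have "(5 / 12 * real e)\<^sup>2 \<le> (1 / m\<^sup>2)\<^sup>2" using ge by (intro power_mono) auto
    \<comment> \<open>The contradiction rests on 6 * (5 / 12)^2 = 25 / 24 being larger than
      1.\<close>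
    ultimately have "6 * (5 / 12 * real e)\<^sup>2 \<le> real e + (real e)\<^sup>2" using p4 by linarith
    then have "real e * real e \<le> 24 * real e" by (simp add: power2_eq_square)
    then show False using e by (simp add: mult_le_cancel_right)
  qed
qed

section \<open>Compactness of the rescaled zeros and the contradiction with integrality\<close>

lemma bounded_family_subsequence:
  fixes r :: "nat \<Rightarrow> nat \<Rightarrow> real"
  assumes "\<And>i. i < e \<Longrightarrow> Bseq (\<lambda>j. r j i)"
  shows "\<exists>\<phi> \<eta>. strict_mono \<phi> \<and> (\<forall>i<e. (\<lambda>j. r (\<phi> j) i) \<longlonglongrightarrow> \<eta> i)"
  using assms
proof (induction e)
  case 0
  then show ?case by (intro exI[of _ "\<lambda>j. j"]) (auto simp: strict_mono_def)
next
  case (Suc e)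
  obtain \<phi> \<eta> where \<phi>: "strict_mono \<phi>" "\<And>i. i < e \<Longrightarrow> (\<lambda>j. r (\<phi> j) i) \<longlonglongrightarrow> \<eta> i"
    using Suc by fastforce
  obtain \<psi> where \<psi>: "strict_mono \<psi>" "monoseq (\<lambda>j. r (\<phi> (\<psi> j)) e)"
    using seq_monosub[of "\<lambda>j. r (\<phi> j) e"] by blast
  have "Bseq (\<lambda>j. r (\<phi> (\<psi> j)) e)"
    using Bseq_subseq[of "\<lambda>j. r j e" "\<lambda>j. \<phi> (\<psi> j)"] Suc.prems[of e] by simp
  then have "convergent (\<lambda>j. r (\<phi> (\<psi> j)) e)"
    using \<psi>(2) by (rule Bseq_monoseq_convergent)
  then obtain L where L: "(\<lambda>j. r (\<phi> (\<psi> j)) e) \<longlonglongrightarrow> L" by (auto simp: convergent_def)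
  have "(\<lambda>j. r (\<phi> (\<psi> j)) i) \<longlonglongrightarrow> (\<eta>(e := L)) i" if "i < Suc e" for i
    using that L LIMSEQ_subseq_LIMSEQ[OF \<phi>(2)[of i] \<psi>(1)] by (cases "i = e") (auto simp: o_def)
  moreover have "strict_mono (\<lambda>j. \<phi> (\<psi> j))" using \<phi>(1) \<psi>(1) by (auto simp: strict_mono_def)
  ultimately show ?case by blast
qed

lemma monic_root_bound:
  fixes x :: real
  assumes "(\<Sum>i\<le>e. c i * x ^ i) = 0" "c e = 1"
  shows "\<bar>x\<bar> \<le> 1 + (\<Sum>i<e. \<bar>c i\<bar>)"
proof (rule ccontr)
  assume neg: "\<not> ?thesis"
  have S: "(\<Sum>i<e. \<bar>c i\<bar>) \<ge> 0" by (intro sum_nonneg) auto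
  then have x1: "\<bar>x\<bar> > 1" using neg by linarith
  show False
  proof (cases e)
    case 0 then show False using assms by simp
  next
    case (Suc d)
    have "x ^ e = - (\<Sum>i<e. c i * x ^ i)"
      using assms by (simp add: lessThan_Suc_atMost[symmetric])
    then have "\<bar>x\<bar> ^ e = \<bar>\<Sum>i<e. c i * x ^ i\<bar>" by (metis abs_minus power_abs)
    also have "\<dots> \<le> (\<Sum>i<e. \<bar>c i * x ^ i\<bar>)" by (rule sum_abs)
    also have "\<dots> \<le> (\<Sum>i<e. \<bar>c i\<bar> * \<bar>x\<bar> ^ d)"
      using x1 Suc by (intro sum_mono) (auto simp: abs_mult power_abs intro!: mult_left_mono power_increasing)
    also have "\<dots> = (\<Sum>i<e. \<bar>c i\<bar>) * \<bar>x\<bar> ^ d" by (simp add: sum_distrib_right)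
    finally have "\<bar>x\<bar> * \<bar>x\<bar> ^ d \<le> (\<Sum>i<e. \<bar>c i\<bar>) * \<bar>x\<bar> ^ d" using Suc by simp
    then have "\<bar>x\<bar> \<le> (\<Sum>i<e. \<bar>c i\<bar>)" using x1 by (simp add: mult_le_cancel_right_pos)
    then show False using neg by simp
  qed
qed

text \<open>Four zeros are combined because a sum of two still contains the centring constant; the
  difference of two such sums is an integer multiple of h, and it also cancels the term (e - 1) / 3
  that every symmetric pair contributes.\<close>

lemma scaled_hahn_roots_contradiction:
  fixes r :: "nat \<Rightarrow> nat \<Rightarrow> real" and h \<nu> \<rho> :: "nat \<Rightarrow> real" and e :: nat
  assumes e: "e \<ge> 27" and h: "h \<longlonglongrightarrow> 0" "\<And>j. h j \<noteq> 0" and nu: "\<nu> \<longlonglongrightarrow> 0"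
    and rho: "\<And>j. \<rho> j \<noteq> 0" "\<And>j. \<bar>\<rho> j\<bar> \<le> 1"
    and eq: "\<And>j. scaled_hahn_eq e (h j) (\<nu> j) (\<rho> j) (\<lambda>x. \<Prod>i<e. x - r j i)"
    and int: "\<And>j a b c d. a < e \<Longrightarrow> b < e \<Longrightarrow> c < e \<Longrightarrow> d < e \<Longrightarrow> (r j a + r j b - (r j c + r j d)) / h j \<in> \<int>"
  shows False
proof -
  define c where "c j k = coeff (\<Prod>i<e. [:- r j i, 1:]) k" for j k
  have deg: "degree (\<Prod>i<e. [:- r j i, 1:]) = e" for j
    by (subst degree_prod_eq_sum_degree) auto
  have F: "(\<Prod>i<e. x - r j i) = (\<Sum>k\<le>e. c j k * x ^ k)" for j x
  proof -
    have "(\<Prod>i<e. x - r j i) = poly (\<Prod>i<e. [:- r j i, 1:]) x" by (simp add: poly_prod)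
    then show ?thesis unfolding poly_altdef deg c_def .
  qed
  have monic: "c j e = 1" for j
    using lead_coeff_prod[of "\<lambda>i. [:- r j i, 1:]" "{..<e}"] unfolding deg c_def by simp
  define t where "t j k = (if even (e - k) then 1 else \<rho> j * h j)" for j k
  have t_nz: "t j k \<noteq> 0" for j k using rho h by (simp add: t_def)
  obtain g where g_e: "g e = 1" and g_gt: "\<And>k. k > e \<Longrightarrow> g k = 0"
    and g_lim: "\<And>k. k \<le> e \<Longrightarrow> (\<lambda>j. c j k / t j k) \<longlonglongrightarrow> g k"
    and g_rec: "\<And>k. k < e \<Longrightarrow> real (e - k) * g k + real ((k + 2) * (k + 1)) * g (k + 2) +
       (if odd (e - k) then real ((k + 1) * k) / 2 * g (k + 1) else 0) = 0"
    using scaled_hahn_coeff_limit[OF h nu rho monic eq[unfolded F]] unfolding t_def by blast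
  have rho_h: "(\<lambda>j. \<rho> j * h j) \<longlonglongrightarrow> 0"
    using h(1) rho(2) by (rule tendsto_mult_le_1_zero)
  \<comment> \<open>The coefficients of the parity of e build the limit H; those of the other
    parity, divided by \<rho> * h, build the correction G.\<close>
  define gH where "gH k = (if even (e - k) then g k else 0)" for k
  define gG where "gG k = (if odd (e - k) then g k else 0)" for k
  have c_lim: "(\<lambda>j. c j k) \<longlonglongrightarrow> gH k" if "k \<le> e" for k
  proof (cases "even (e - k)")
    case True
    then show ?thesis using g_lim[OF that] by (simp add: t_def gH_def)
  next
    case False
    have "(\<lambda>j. c j k / t j k * (\<rho> j * h j)) \<longlonglongrightarrow> g k * 0"
      by (intro tendsto_mult g_lim rho_h that)
    moreover have "c j k / t j k * (\<rho> j * h j) = c j k" for j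
      using False rho(1) h(2) by (simp add: t_def)
    ultimately show ?thesis using False by (simp add: gH_def)
  qed
  obtain \<phi> \<eta> where \<phi>: "strict_mono \<phi>" and \<eta>: "\<And>i. i < e \<Longrightarrow> (\<lambda>j. r (\<phi> j) i) \<longlonglongrightarrow> \<eta> i"
  proof -
    have "Bseq (\<lambda>j. r j i)" if "i < e" for i
    proof -
      have "(\<lambda>j. 1 + (\<Sum>k<e. \<bar>c j k\<bar>)) \<longlonglongrightarrow> 1 + (\<Sum>k<e. \<bar>gH k\<bar>)"
        by (intro tendsto_intros c_lim) auto
      then have "Bseq (\<lambda>j. 1 + (\<Sum>k<e. \<bar>c j k\<bar>))" by (rule convergent_imp_Bseq[OF convergentI])
      then obtain B where B: "\<And>j. \<bar>1 + (\<Sum>k<e. \<bar>c j k\<bar>)\<bar> \<le> B" by (auto simp: Bseq_def)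
      have "\<bar>r j i\<bar> \<le> B" for j
      proof -
        have "(\<Sum>k\<le>e. c j k * r j i ^ k) = 0" unfolding F[symmetric] using that by auto
        then have "\<bar>r j i\<bar> \<le> 1 + (\<Sum>k<e. \<bar>c j k\<bar>)" using monic by (rule monic_root_bound)
        then show ?thesis using B[of j] by linarith
      qed
      then show ?thesis by (intro BseqI') auto
    qed
    then show thesis using bounded_family_subsequence that by metis
  qed
  note sub = LIMSEQ_subseq_LIMSEQ[OF _ \<phi>, unfolded o_def]
  define H where "H = (\<Sum>k\<le>e. monom (gH k) k)"
  define G where "G = (\<Sum>k\<le>e. monom (gG k) k)"
  have coeff_H: "coeff H k = gH k" for k using g_gt[of k] by (cases "k \<le> e") (auto simp: H_def coeff_sum gH_def)
  have coeff_G: "coeff G k = gG k" for k using g_gt[of k] by (cases "k \<le> e") (auto simp: G_def coeff_sum gG_def)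
  have deg_H: "degree H \<le> e" by (rule degree_le) (simp add: coeff_H gH_def g_gt)
  have "pderiv (pderiv H) = pCons 0 (pderiv H) - smult (real e) H"
  proof (rule poly_eqI)
    fix k
    have "real ((k + 2) * (k + 1)) * gH (k + 2) = (real k - real e) * gH k"
    proof (cases "k < e")
      case True
      then have "even (e - (k + 2)) = even (e - k)" if "k + 2 \<le> e" using that by presburger
      then show ?thesis
        using g_rec[OF True] True g_gt[of "k + 2"] by (cases "k + 2 \<le> e") (auto simp: gH_def of_nat_diff algebra_simps)
    qed (use g_gt[of "k + 2"] g_gt[of k] in \<open>cases "k = e"; simp add: gH_def\<close>)
    then show "coeff (pderiv (pderiv H)) k = coeff (pCons 0 (pderiv H) - smult (real e) H) k"
      by (cases k) (simp_all add: coeff_pderiv coeff_pCons coeff_H algebra_simps)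
  qed
  then have HH: "hermite_eq e H" by (simp add: hermite_eq_def)
  have GG: "pderiv (pderiv G) - pCons 0 (pderiv G) + smult (real e) G + smult (1 / 2) (pCons 0 (pderiv (pderiv H))) = 0"
  proof (rule poly_eqI)
    fix k
    have "real ((k + 2) * (k + 1)) * gG (k + 2) + (real e - real k) * gG k + real ((k + 1) * k) / 2 * gH (k + 1) = 0"
    proof (cases "k < e")
      case True
      then have "even (e - (k + 2)) = even (e - k)" if "k + 2 \<le> e" using that by presburger
      moreover have "even (e - (k + 1)) = odd (e - k)" using True by presburger
      ultimately show ?thesis
        using g_rec[OF True] True g_gt[of "k + 2"]
        by (cases "k + 2 \<le> e"; cases "odd (e - k)") (auto simp: gG_def gH_def of_nat_diff algebra_simps)
    qed (use g_gt[of "k + 2"] g_gt[of "k + 1"] g_gt[of k] in \<open>cases "k = e"; simp add: gH_def gG_def\<close>)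
    moreover have "coeff (pderiv (pderiv G) - pCons 0 (pderiv G) + smult (real e) G + smult (1 / 2) (pCons 0 (pderiv (pderiv H)))) k =
        real ((k + 2) * (k + 1)) * gG (k + 2) + (real e - real k) * gG k + real ((k + 1) * k) / 2 * gH (k + 1)"
      by (cases k) (simp_all add: coeff_pderiv coeff_pCons coeff_H coeff_G algebra_simps add_divide_distrib)
    ultimately show "coeff (pderiv (pderiv G) - pCons 0 (pderiv G) + smult (real e) G + smult (1 / 2) (pCons 0 (pderiv (pderiv H)))) k = coeff 0 k"
      by simp
  qed
  have H_roots: "poly H x = (\<Prod>i<e. x - \<eta> i)" for x
  proof (rule LIMSEQ_unique)
    show "(\<lambda>j. \<Prod>i<e. x - r (\<phi> j) i) \<longlonglongrightarrow> (\<Prod>i<e. x - \<eta> i)" by (intro tendsto_intros \<eta>) auto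
    have "(\<lambda>j. \<Sum>k\<le>e. c (\<phi> j) k * x ^ k) \<longlonglongrightarrow> (\<Sum>k\<le>e. gH k * x ^ k)"
      by (intro tendsto_intros sub c_lim) auto
    then show "(\<lambda>j. \<Prod>i<e. x - r (\<phi> j) i) \<longlonglongrightarrow> poly H x"
      unfolding F by (simp add: H_def poly_sum poly_monom)
  qed
  have H_prod: "H = (\<Prod>i<e. [:- \<eta> i, 1:])"
    unfolding poly_eq_poly_eq_iff[symmetric] using H_roots by (simp add: fun_eq_iff poly_prod)
  have "H \<noteq> 0" using coeff_H[of e] g_e by (auto simp: gH_def)
  \<comment> \<open>Zeros could merge in the limit; simplicity of the zeros of H excludes this, so
    the limits form a symmetric set of e points that can be paired.\<close>
  have inj: "inj_on \<eta> {..<e}"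
  proof (rule inj_onI, rule ccontr)
    fix a b assume ab: "a \<in> {..<e}" "b \<in> {..<e}" "\<eta> a = \<eta> b" "a \<noteq> b"
    define K where "K = (\<Prod>i\<in>{..<e} - {a} - {b}. [:- \<eta> i, 1:])"
    have "H = [:- \<eta> a, 1:] * ([:- \<eta> a, 1:] * K)"
      unfolding H_prod K_def using ab by (subst prod.remove[of _ a], simp, simp, subst prod.remove[of _ b]) auto
    then have "poly (pderiv H) (\<eta> a) = 0" by (simp add: pderiv_mult del: mult_pCons_left)
    moreover have "poly H (\<eta> a) = 0" using ab by (auto simp: H_roots)
    ultimately show False using hermite_eq_simple_roots[OF HH \<open>H \<noteq> 0\<close>] by blast
  qed
  define R where "R = \<eta> ` {..<e}"
  have R: "finite R" "card R = e" "H = (\<Prod>a\<in>R. [:- a, 1:])"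
    using inj by (auto simp: R_def card_image H_prod prod.reindex)
  have R_root: "x \<in> R \<longleftrightarrow> poly H x = 0" for x by (auto simp: R_def H_roots)
  have neg_pow: "(- x) ^ k = (if even (e - k) then (- 1) ^ e * x ^ k else - ((- 1) ^ e * x ^ k))" if "k \<le> e" for x :: real and k
  proof -
    have "(- 1 :: real) ^ k = (if even (e - k) then (- 1) ^ e else - ((- 1) ^ e))"
      using that by (auto simp: minus_one_power_iff)
    then show ?thesis by (subst power_minus) (cases "even (e - k)"; simp only: mult_minus_left if_True if_False not_True_eq_False)
  qed
  have "poly H (- x) = (- 1) ^ e * poly H x" for x
  proof -
    have "poly H (- x) = (\<Sum>k\<le>e. gH k * (- x) ^ k)" by (simp add: H_def poly_sum poly_monom)
    also have "\<dots> = (\<Sum>k\<le>e. (- 1) ^ e * (gH k * x ^ k))"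
    proof (intro sum.cong refl)
      fix k assume "k \<in> {..e}"
      then have "(- x) ^ k = (if even (e - k) then (- 1) ^ e * x ^ k else - ((- 1) ^ e * x ^ k))"
        by (intro neg_pow) simp
      then show "gH k * (- x) ^ k = (- 1) ^ e * (gH k * x ^ k)"
        unfolding gH_def by (cases "even (e - k)") (simp_all only: if_True if_False mult_zero_left mult_zero_right mult.left_commute)
    qed
    finally show ?thesis by (simp add: H_def poly_sum poly_monom sum_distrib_left)
  qed
  then have neg_R: "- x \<in> R" if "x \<in> R" for x using that by (simp add: R_root)
  have sym: "uminus ` R = R"
  proof
    show "R \<subseteq> uminus ` R" using neg_R by (auto intro!: rev_image_eqI[of "- _"])
  qed (use neg_R in auto)
  have key: "(\<lambda>j. (r (\<phi> j) i + r (\<phi> j) i') / (\<rho> (\<phi> j) * h (\<phi> j))) \<longlonglongrightarrow> 2 * ((real e - 1) / 3 + (\<eta> i)\<^sup>2 / 6)"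
    if i: "i < e" "i' < e" "\<eta> i' = - \<eta> i" for i i'
  proof -
    define gj where "gj j = (\<Sum>k\<le>e. (if odd (e - k) then c (\<phi> j) k / t (\<phi> j) k else 0) * r (\<phi> j) i ^ k)" for j
    define pj where "pj j = (\<Prod>k\<in>{..<e} - {i'}. r (\<phi> j) i + r (\<phi> j) k)" for j
    have "(\<lambda>j. if odd (e - k) then c (\<phi> j) k / t (\<phi> j) k else 0) \<longlonglongrightarrow> gG k" if "k \<le> e" for k
      using sub[OF g_lim[OF that]] by (auto simp: gG_def)
    then have "gj \<longlonglongrightarrow> (\<Sum>k\<le>e. gG k * \<eta> i ^ k)"
      unfolding gj_def by (intro tendsto_intros \<eta> i) auto
    then have gj: "gj \<longlonglongrightarrow> poly G (\<eta> i)" by (simp add: G_def poly_sum poly_monom)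
    have "pj \<longlonglongrightarrow> (\<Prod>k\<in>{..<e} - {i'}. \<eta> i + \<eta> k)"
      unfolding pj_def by (intro tendsto_intros \<eta> i) auto
    also have "(\<Prod>k\<in>{..<e} - {i'}. \<eta> i + \<eta> k) = (\<Prod>b\<in>R - {- \<eta> i}. \<eta> i + b)"
    proof -
      have "R - {- \<eta> i} = \<eta> ` ({..<e} - {i'})" using i inj by (auto simp: R_def inj_on_def)
      then show ?thesis using inj by (simp add: prod.reindex inj_on_diff)
    qed
    also have "\<dots> = (\<Prod>b\<in>R - {\<eta> i}. \<eta> i - b)"
      by (rule prod.reindex_bij_witness[of _ uminus uminus]) (use neg_R in auto)
    also have "\<dots> = poly (pderiv H) (\<eta> i)"
      unfolding R(3) by (rule poly_pderiv_root_prod[symmetric]) (use R(1) i in \<open>auto simp: R_def\<close>)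
    finally have pj: "pj \<longlonglongrightarrow> poly (pderiv H) (\<eta> i)" .
    have root: "poly H (\<eta> i) = 0" using i by (auto simp: H_roots)
    have H'nz: "poly (pderiv H) (\<eta> i) \<noteq> 0" by (rule hermite_eq_simple_roots[OF HH \<open>H \<noteq> 0\<close> root])
    \<comment> \<open>For a zero x of F the product of all x + r_k is F(- x) up to the sign (-1)^e,
      and F(x) = 0 leaves of it only twice the terms of the opposite parity. The factor of i' is the
      sum of the pair; the remaining factors tend to the derivative of H at \<eta> i.\<close>
    have prod_eq: "(r (\<phi> j) i + r (\<phi> j) i') * pj j = - 2 * (\<rho> (\<phi> j) * h (\<phi> j)) * gj j" for j
    proof -
      let ?x = "r (\<phi> j) i"
      have "(?x + r (\<phi> j) i') * pj j = (\<Prod>k<e. ?x + r (\<phi> j) k)"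
        unfolding pj_def using i by (simp add: prod.remove[of _ i'])
      also have "\<dots> = (- 1) ^ e * (\<Prod>k<e. - ?x - r (\<phi> j) k)"
      proof -
        have "(\<Prod>k<e. ?x + r (\<phi> j) k) = (\<Prod>k<e. (- 1) * (- ?x - r (\<phi> j) k))" by (simp add: add.commute)
        also have "\<dots> = (\<Prod>k<e. - 1) * (\<Prod>k<e. - ?x - r (\<phi> j) k)" by (rule prod.distrib)
        finally show ?thesis by simp
      qed
      also have "(\<Prod>k<e. - ?x - r (\<phi> j) k) = (\<Sum>k\<le>e. c (\<phi> j) k * (- ?x) ^ k)" by (rule F)
      also have "\<dots> = (\<Sum>k\<le>e. (- 1) ^ e * (c (\<phi> j) k * ?x ^ k) -
          (- 1) ^ e * (2 * (\<rho> (\<phi> j) * h (\<phi> j)) * ((if odd (e - k) then c (\<phi> j) k / t (\<phi> j) k else 0) * ?x ^ k)))"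
      proof (intro sum.cong refl)
        fix k assume "k \<in> {..e}"
        then have k: "k \<le> e" by simp
        show "c (\<phi> j) k * (- ?x) ^ k = (- 1) ^ e * (c (\<phi> j) k * ?x ^ k) -
          (- 1) ^ e * (2 * (\<rho> (\<phi> j) * h (\<phi> j)) * ((if odd (e - k) then c (\<phi> j) k / t (\<phi> j) k else 0) * ?x ^ k))"
          using neg_pow[OF k, of ?x] rho(1) h(2) by (cases "even (e - k)") (simp_all add: t_def)
      qed
      also have "\<dots> = (- 1) ^ e * ((\<Sum>k\<le>e. c (\<phi> j) k * ?x ^ k) - 2 * (\<rho> (\<phi> j) * h (\<phi> j)) * gj j)"
        unfolding gj_def sum_subtractf sum_distrib_left[symmetric] by (simp only: right_diff_distrib)
      also have "(\<Sum>k\<le>e. c (\<phi> j) k * ?x ^ k) = 0" unfolding F[symmetric] using i by auto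
      finally show ?thesis by (simp add: power_mult_distrib[symmetric] mult.assoc[symmetric])
    qed
    have "(\<lambda>j. - 2 * gj j / pj j) \<longlonglongrightarrow> - 2 * poly G (\<eta> i) / poly (pderiv H) (\<eta> i)"
      by (intro tendsto_intros gj pj H'nz)
    also have "- 2 * poly G (\<eta> i) / poly (pderiv H) (\<eta> i) = 2 * ((real e - 1) / 3 + (\<eta> i)\<^sup>2 / 6)"
    proof -
      have "coeff H k = 0" if "odd (e - k)" for k using that by (simp add: coeff_H gH_def)
      moreover have "coeff G e = 0" by (simp add: coeff_G gG_def)
      ultimately have "poly G (\<eta> i) = - ((real e - 1) / 3 + (\<eta> i)\<^sup>2 / 6) * poly (pderiv H) (\<eta> i)"
        using hermite_perturbation_at_root[OF HH _ deg_H GG _ root] by blast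
      then show ?thesis using H'nz by (simp add: field_simps)
    qed
    finally have lim: "(\<lambda>j. - 2 * gj j / pj j) \<longlonglongrightarrow> 2 * ((real e - 1) / 3 + (\<eta> i)\<^sup>2 / 6)" .
    have "\<forall>\<^sub>F j in sequentially. pj j \<noteq> 0" using pj H'nz by (rule tendsto_imp_eventually_ne)
    then have "\<forall>\<^sub>F j in sequentially. - 2 * gj j / pj j = (r (\<phi> j) i + r (\<phi> j) i') / (\<rho> (\<phi> j) * h (\<phi> j))"
    proof eventually_elim
      case (elim j)
      have nz: "\<rho> (\<phi> j) * h (\<phi> j) \<noteq> 0" using rho(1) h(2) by simp
      then show ?case unfolding frac_eq_eq[OF elim nz] using prod_eq[of j] by (simp only: ac_simps)
    qed
    then show ?thesis using lim by (rule Lim_transform_eventually[rotated])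
  qed
  obtain i q where iq: "i < e" "q < e" "0 < \<bar>(\<eta> i)\<^sup>2 - (\<eta> q)\<^sup>2\<bar>" "\<bar>(\<eta> i)\<^sup>2 - (\<eta> q)\<^sup>2\<bar> < 3"
    using hermite_close_roots[OF HH R(1) R(3) sym R(2) e] by (auto simp: R_def)
  obtain i' where i': "i' < e" "\<eta> i' = - \<eta> i" using neg_R[of "\<eta> i"] iq(1) by (fastforce simp: R_def)
  obtain q' where q': "q' < e" "\<eta> q' = - \<eta> q" using neg_R[of "\<eta> q"] iq(2) by (fastforce simp: R_def)
  define \<kappa> where "\<kappa> = ((\<eta> i)\<^sup>2 - (\<eta> q)\<^sup>2) / 3"
  define z where "z j = (r (\<phi> j) i + r (\<phi> j) i' - (r (\<phi> j) q + r (\<phi> j) q')) / h (\<phi> j)" for j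
  have "(\<lambda>j. (r (\<phi> j) i + r (\<phi> j) i') / (\<rho> (\<phi> j) * h (\<phi> j)) - (r (\<phi> j) q + r (\<phi> j) q') / (\<rho> (\<phi> j) * h (\<phi> j)))
     \<longlonglongrightarrow> 2 * ((real e - 1) / 3 + (\<eta> i)\<^sup>2 / 6) - 2 * ((real e - 1) / 3 + (\<eta> q)\<^sup>2 / 6)"
    by (intro tendsto_diff key iq i' q')
  then have "(\<lambda>j. z j / \<rho> (\<phi> j)) \<longlonglongrightarrow> \<kappa>"
    by (simp add: z_def \<kappa>_def diff_divide_distrib[symmetric] mult.commute)
  then have lim: "(\<lambda>j. \<bar>z j / \<rho> (\<phi> j)\<bar>) \<longlonglongrightarrow> \<bar>\<kappa>\<bar>" by (rule tendsto_rabs)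
  have "0 < \<bar>\<kappa>\<bar>" "\<bar>\<kappa>\<bar> < 1" using iq by (auto simp: \<kappa>_def)
  then have "\<forall>\<^sub>F j in sequentially. 0 < \<bar>z j / \<rho> (\<phi> j)\<bar> \<and> \<bar>z j / \<rho> (\<phi> j)\<bar> < 1"
    using order_tendstoD[OF lim] by (auto intro: eventually_conj)
  then obtain j where j: "0 < \<bar>z j / \<rho> (\<phi> j)\<bar>" "\<bar>z j / \<rho> (\<phi> j)\<bar> < 1"
    using eventually_happens'[OF sequentially_bot] by blast
  have "z j \<in> \<int>" unfolding z_def using int iq i' q' by blast
  moreover have "z j \<noteq> 0" using j by auto
  ultimately have "1 \<le> \<bar>z j\<bar>" by (rule Ints_nonzero_abs_ge1)
  moreover have "\<bar>z j\<bar> < \<bar>\<rho> (\<phi> j)\<bar>" using j(2) rho(1)[of "\<phi> j"] by (simp add: divide_less_eq_1)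
  ultimately show False using rho(2)[of "\<phi> j"] by linarith
qed

section \<open>Polynomials on set systems\<close>

text \<open>Polynomials of degree at most k in the 0/1 coordinates of a set, as the span of
  squarefree monomials. The inductive form lets linear identities be checked on monomials. Arguments
  are arbitrary sets A, but only A \<inter> U matters.\<close>

inductive lowdeg :: "'a set \<Rightarrow> nat \<Rightarrow> ('a set \<Rightarrow> real) \<Rightarrow> bool" for U k where
  mono: "T \<subseteq> U \<Longrightarrow> finite T \<Longrightarrow> card T \<le> k \<Longrightarrow> lowdeg U k (\<lambda>A. of_bool (T \<subseteq> A))"
| add: "lowdeg U k f \<Longrightarrow> lowdeg U k g \<Longrightarrow> lowdeg U k (\<lambda>A. f A + g A)"
| scale: "lowdeg U k f \<Longrightarrow> lowdeg U k (\<lambda>A. c * f A)"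

lemma lowdeg_const: "lowdeg U k (\<lambda>A. c)"
  using lowdeg.scale[OF lowdeg.mono[of "{}" U k], of c] by simp

lemma lowdeg_sum:
  assumes "\<And>i. i \<in> I \<Longrightarrow> lowdeg U k (f i)"
  shows "lowdeg U k (\<lambda>A. \<Sum>i\<in>I. f i A)"
proof (cases "finite I")
  case True
  from this assms show ?thesis
    by (induction I) (auto intro: lowdeg_const lowdeg.add)
qed (simp add: lowdeg_const)

lemma lowdeg_diff: "lowdeg U k f \<Longrightarrow> lowdeg U k g \<Longrightarrow> lowdeg U k (\<lambda>A. f A - g A)"
  using lowdeg.add[OF _ lowdeg.scale[of U k g "-1"], of f] by simp

lemma lowdeg_le: "lowdeg U k f \<Longrightarrow> k \<le> k' \<Longrightarrow> lowdeg U k' f"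
  by (induction rule: lowdeg.induct) (auto intro: lowdeg.intros)

text \<open>Coordinates are idempotent: the product of the monomials of S and T is that of S
  \<union> T.\<close>

lemma lowdeg_mult:
  assumes "lowdeg U j f" "lowdeg U k g"
  shows "lowdeg U (j + k) (\<lambda>A. f A * g A)"
  using assms
proof (induction arbitrary: g rule: lowdeg.induct)
  case (mono S)
  note S = mono(1-3)
  from mono(4) show ?case
  proof (induction rule: lowdeg.induct)
    case (mono T)
    have "card (S \<union> T) \<le> j + k" using card_Un_le[of S T] S mono by linarith
    then have "lowdeg U (j + k) (\<lambda>A. of_bool (S \<union> T \<subseteq> A))" using S mono by (intro lowdeg.mono) auto
    then show ?case by (simp add: of_bool_conj[symmetric] del: of_bool_conj)
  next
    case (add f g)
    then show ?case by (simp add: distrib_left lowdeg.add)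
  next
    case (scale f c)
    then show ?case using lowdeg.scale[OF scale(2), of c] by (simp add: mult.left_commute)
  qed
next
  case (add f1 f2)
  then show ?case by (simp add: distrib_right lowdeg.add)
next
  case (scale f c)
  then show ?case using lowdeg.scale[OF scale(2), of g c] by (simp add: mult.assoc)
qed

lemma lowdeg_power: "lowdeg U 1 g \<Longrightarrow> lowdeg U i (\<lambda>A. g A ^ i)"
proof (induction i)
  case 0
  show ?case using lowdeg_const[of U 0 1] by simp
next
  case (Suc i)
  then show ?case using lowdeg_mult[of U 1 g i "\<lambda>A. g A ^ i"] by simp
qed

lemma lowdeg_poly:
  assumes "lowdeg U 1 g" "degree q \<le> k"
  shows "lowdeg U k (\<lambda>A. poly q (g A))"
  unfolding poly_altdef
  by (intro lowdeg_sum lowdeg.scale) (use lowdeg_le[OF lowdeg_power[OF assms(1)]] assms(2) in auto)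

lemma lowdeg_card_inter:
  assumes "finite y" "y \<subseteq> U"
  shows "lowdeg U 1 (\<lambda>A. real (card (A \<inter> y)))"
proof -
  have eq: "real (card (A \<inter> y)) = (\<Sum>i\<in>y. of_bool ({i} \<subseteq> A))" for A
    using assms(1) by (simp add: Int_commute)
  show ?thesis
    unfolding eq by (intro lowdeg_sum lowdeg.mono) (use assms in auto)
qed

lemma lowdeg_functional_eq:
  assumes "lowdeg U k f" "\<And>T. T \<subseteq> U \<Longrightarrow> finite T \<Longrightarrow> card T \<le> k \<Longrightarrow>
     (\<Sum>A\<in>Y. a A * of_bool (T \<subseteq> A)) = (\<Sum>A\<in>Z. b A * of_bool (T \<subseteq> A))"
  shows "(\<Sum>A\<in>Y. a A * f A) = (\<Sum>A\<in>Z. b A * (f A :: real))"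
  using assms(1)
proof (induction rule: lowdeg.induct)
  case (mono T) then show ?case using assms(2) by blast
next
  case (add f g) then show ?case by (simp add: distrib_left sum.distrib)
next
  case (scale f c)
  have "(\<Sum>A\<in>Y. a A * (c * f A)) = c * (\<Sum>A\<in>Y. a A * f A)" by (simp add: sum_distrib_left mult.left_commute)
  also have "\<dots> = (\<Sum>A\<in>Z. b A * (c * f A))" unfolding scale by (simp add: sum_distrib_left mult.left_commute)
  finally show ?case .
qed

section \<open>Averages over sets of equal size and over the stabilizer of a set\<close>

lemma sum_Pow_card:
  assumes "finite S"
  shows "(\<Sum>B\<in>Pow S. \<phi> (card B)) = (\<Sum>j\<le>card S. real (card S choose j) * (\<phi> j :: real))"
proof -
  have "(\<Sum>B\<in>Pow S. \<phi> (card B)) = (\<Sum>j\<le>card S. \<Sum>B\<in>{B \<in> Pow S. card B = j}. \<phi> (card B))"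
    by (rule sum.group[symmetric]) (use assms in \<open>auto intro: card_mono\<close>)
  also have "\<dots> = (\<Sum>j\<le>card S. real (card S choose j) * \<phi> j)"
    using n_subsets[OF assms] by (intro sum.cong refl) simp
  finally show ?thesis .
qed

lemma sum_Pow_superset:
  fixes \<gamma> :: "nat \<Rightarrow> real"
  assumes "finite S" "T \<subseteq> S"
  shows "(\<Sum>A\<in>Pow S. of_bool (T \<subseteq> A) * \<gamma> (card A)) = (\<Sum>A\<in>Pow (S - T). \<gamma> (card T + card A))"
proof -
  have "(\<Sum>A\<in>Pow S. of_bool (T \<subseteq> A) * \<gamma> (card A)) = (\<Sum>A\<in>{A \<in> Pow S. T \<subseteq> A}. \<gamma> (card A))"
    using assms by (intro sum.mono_neutral_cong_right) auto
  also have "\<dots> = (\<Sum>A\<in>Pow (S - T). \<gamma> (card T + card A))"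
  proof (rule sum.reindex_bij_witness[of _ "\<lambda>A. T \<union> A" "\<lambda>A. A - T"])
    fix A assume A: "A \<in> {A \<in> Pow S. T \<subseteq> A}"
    then have "card A = card T + card (A - T)"
      using assms finite_subset[of A S] finite_subset[of T S] by (simp add: card_Diff_subset card_mono)
    then show "\<gamma> (card T + card (A - T)) = \<gamma> (card A)" by simp
  qed (use assms in auto)
  finally show ?thesis .
qed

text \<open>The left hand side depends only on \<open>card T\<close>, so \<open>T\<close> may be averaged over all subsets of
  \<open>S\<close> of the same size.\<close>

lemma sum_Pow_average:
  fixes \<gamma> :: "nat \<Rightarrow> real"
  assumes "finite S" "T \<subseteq> S"
  shows "(\<Sum>A\<in>Pow S. of_bool (T \<subseteq> A) * \<gamma> (card A)) =
    (\<Sum>A\<in>Pow S. real (card A choose card T) / real (card S choose card T) * \<gamma> (card A))"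
proof -
  define \<Phi> where "\<Phi> T = (\<Sum>A\<in>Pow S. of_bool (T \<subseteq> A) * \<gamma> (card A))" for T
  have same: "\<Phi> T' = \<Phi> T" if "T' \<subseteq> S" "card T' = card T" for T'
  proof -
    have "card (S - T') = card (S - T)" using that assms finite_subset by (metis card_Diff_subset)
    then show ?thesis
      unfolding \<Phi>_def sum_Pow_superset[OF assms] sum_Pow_superset[OF assms(1) that(1)]
      using that assms sum_Pow_card[of "S - T" "\<lambda>j. \<gamma> (card T + j)"] sum_Pow_card[of "S - T'" "\<lambda>j. \<gamma> (card T + j)"] by simp
  qed
  let ?\<T> = "{T' \<in> Pow S. card T' = card T}"
  have "real (card S choose card T) * \<Phi> T = (\<Sum>T'\<in>?\<T>. \<Phi> T')"
    using n_subsets[OF assms(1), of "card T"] same by (simp add: Pow_def)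
  also have "\<dots> = (\<Sum>A\<in>Pow S. \<Sum>T'\<in>?\<T>. of_bool (T' \<subseteq> A) * \<gamma> (card A))"
    unfolding \<Phi>_def by (rule sum.swap)
  also have "\<dots> = (\<Sum>A\<in>Pow S. real (card A choose card T) * \<gamma> (card A))"
  proof (intro sum.cong refl)
    fix A assume "A \<in> Pow S"
    then have fA: "finite A" and sub: "A \<subseteq> S" using assms finite_subset by auto
    have "(\<Sum>T'\<in>?\<T>. of_bool (T' \<subseteq> A) * \<gamma> (card A)) = (\<Sum>T'\<in>{T'. T' \<subseteq> A \<and> card T' = card T}. \<gamma> (card A))"
      using assms sub by (intro sum.mono_neutral_cong_right) auto
    then show "(\<Sum>T'\<in>?\<T>. of_bool (T' \<subseteq> A) * \<gamma> (card A)) = real (card A choose card T) * \<gamma> (card A)"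
      using n_subsets[OF fA] by simp
  qed
  finally have "real (card S choose card T) * \<Phi> T = (\<Sum>A\<in>Pow S. real (card A choose card T) * \<gamma> (card A))" .
  moreover have "real (card S choose card T) > 0" using assms by (simp add: card_mono)
  ultimately show ?thesis
    unfolding \<Phi>_def by (simp add: sum_divide_distrib[symmetric] field_simps)
qed

lemma sum_Pow_split:
  assumes "y \<subseteq> U"
  shows "(\<Sum>A\<in>Pow U. f (A \<inter> y) (A - y)) = (\<Sum>A1\<in>Pow y. \<Sum>A2\<in>Pow (U - y). (f A1 A2 :: real))"
  unfolding sum.cartesian_product
  by (rule sum.reindex_bij_witness[of _ "\<lambda>(A1, A2). A1 \<union> A2" "\<lambda>A. (A \<inter> y, A - y)"])
    (use assms in \<open>auto simp: Int_Un_distrib2 Un_Diff\<close>)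

text \<open>Average of the indicator of T' \<subseteq> A over the images T' of T under the
  permutations of U that fix y setwise, for subsets of U. The closed form with binomial coefficients
  avoids a group action.\<close>

definition zavg :: "'a set \<Rightarrow> 'a set \<Rightarrow> 'a set \<Rightarrow> 'a set \<Rightarrow> real" where
  "zavg U y T A = real (card (A \<inter> y) choose card (T \<inter> y)) / real (card y choose card (T \<inter> y)) *
     (real (card (A - y) choose card (T - y)) / real (card (U - y) choose card (T - y)))"

text \<open>Against a function of card (A \<inter> y) and card (A - y) the monomial of T gives a
  value depending only on card (T \<inter> y) and card (T - y), so T may be averaged inside y and
  inside U - y separately.\<close>

lemma zonal_average:
  fixes \<gamma> :: "nat \<Rightarrow> nat \<Rightarrow> real"
  assumes fin: "finite U" and "y \<subseteq> U" "T \<subseteq> U"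
  shows "(\<Sum>A\<in>Pow U. of_bool (T \<subseteq> A) * \<gamma> (card (A \<inter> y)) (card (A - y))) =
         (\<Sum>A\<in>Pow U. zavg U y T A * \<gamma> (card (A \<inter> y)) (card (A - y)))"
proof -
  have fy: "finite y" "finite (U - y)" using assms finite_subset by auto
  let ?c1 = "\<lambda>A. real (card A choose card (T \<inter> y)) / real (card y choose card (T \<inter> y))"
  let ?c2 = "\<lambda>A. real (card A choose card (T - y)) / real (card (U - y) choose card (T - y))"
  have "(\<Sum>A\<in>Pow U. of_bool (T \<subseteq> A) * \<gamma> (card (A \<inter> y)) (card (A - y))) =
    (\<Sum>A\<in>Pow U. of_bool (T \<inter> y \<subseteq> A \<inter> y) * (of_bool (T - y \<subseteq> A - y) * \<gamma> (card (A \<inter> y)) (card (A - y))))"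
    by (intro sum.cong refl) auto
  also have "\<dots> = (\<Sum>A1\<in>Pow y. \<Sum>A2\<in>Pow (U - y). of_bool (T \<inter> y \<subseteq> A1) * (of_bool (T - y \<subseteq> A2) * \<gamma> (card A1) (card A2)))"
    by (rule sum_Pow_split) fact
  also have "\<dots> = (\<Sum>A1\<in>Pow y. of_bool (T \<inter> y \<subseteq> A1) * (\<Sum>A2\<in>Pow (U - y). ?c2 A2 * \<gamma> (card A1) (card A2)))"
    using sum_Pow_average[of "U - y" "T - y"] fy assms by (simp add: sum_distrib_left[symmetric] Diff_mono)
  also have "\<dots> = (\<Sum>A1\<in>Pow y. ?c1 A1 * (\<Sum>A2\<in>Pow (U - y). ?c2 A2 * \<gamma> (card A1) (card A2)))"
    by (rule sum_Pow_average) (use fy in auto)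
  also have "\<dots> = (\<Sum>A1\<in>Pow y. \<Sum>A2\<in>Pow (U - y). ?c1 A1 * ?c2 A2 * \<gamma> (card A1) (card A2))"
    by (simp add: sum_distrib_left mult.assoc)
  also have "\<dots> = (\<Sum>A\<in>Pow U. ?c1 (A \<inter> y) * ?c2 (A - y) * \<gamma> (card (A \<inter> y)) (card (A - y)))"
    by (rule sum_Pow_split[symmetric]) fact
  finally show ?thesis by (simp add: zavg_def)
qed

text \<open>Up to normalization the average counts the subsets of A of the same type as T, so it is
  a combination of monomials of degree card T. The intersection with U reconciles two conventions:
  \<open>zavg\<close> counts all elements of its argument, whereas low degree functions ignore those
  outside U.\<close>

lemma lowdeg_zavg:
  assumes fin: "finite U" and "y \<subseteq> U" "T \<subseteq> U" "card T \<le> k"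
  shows "lowdeg U k (\<lambda>A. zavg U y T (A \<inter> U))"
proof -
  define \<T> where "\<T> = {T' \<in> Pow U. card (T' \<inter> y) = card (T \<inter> y) \<and> card (T' - y) = card (T - y)}"
  have fT: "finite \<T>" using fin by (simp add: \<T>_def)
  have "zavg U y T (A \<inter> U) = (1 / (real (card y choose card (T \<inter> y)) * real (card (U - y) choose card (T - y)))) *
    (\<Sum>T'\<in>\<T>. of_bool (T' \<subseteq> A))" for A
  proof -
    let ?A1 = "A \<inter> U \<inter> y" and ?A2 = "A \<inter> U - y"
    let ?S1 = "{S. S \<subseteq> ?A1 \<and> card S = card (T \<inter> y)}" and ?S2 = "{S. S \<subseteq> ?A2 \<and> card S = card (T - y)}"
    have "(\<Sum>T'\<in>\<T>. of_bool (T' \<subseteq> A)) = real (card {T' \<in> \<T>. T' \<subseteq> A})"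
      using fT by (simp add: Collect_conj_eq[symmetric] Int_def)
    also have "card {T' \<in> \<T>. T' \<subseteq> A} = card (?S1 \<times> ?S2)"
    proof (rule bij_betw_same_card[of "\<lambda>S. (S \<inter> y, S - y)"], rule bij_betwI[where g = "\<lambda>(S1, S2). S1 \<union> S2"])
      have inv: "(S1 \<union> S2) \<inter> y = S1" "S1 \<union> S2 - y = S2" if "S1 \<subseteq> ?A1" "S2 \<subseteq> ?A2" for S1 S2 using that by auto
      show "(\<lambda>S. (S \<inter> y, S - y)) \<in> {T' \<in> \<T>. T' \<subseteq> A} \<rightarrow> ?S1 \<times> ?S2" by (auto simp: \<T>_def)
      show "(\<lambda>(S1, S2). S1 \<union> S2) \<in> ?S1 \<times> ?S2 \<rightarrow> {T' \<in> \<T>. T' \<subseteq> A}"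
      proof (clarify)
        fix S1 S2 assume "S1 \<subseteq> ?A1" "card S1 = card (T \<inter> y)" "S2 \<subseteq> ?A2" "card S2 = card (T - y)"
        then show "S1 \<union> S2 \<in> \<T> \<and> S1 \<union> S2 \<subseteq> A" using inv[of S1 S2] by (auto simp: \<T>_def)
      qed
      show "(\<lambda>(S1, S2). S1 \<union> S2) (S \<inter> y, S - y) = S" for S by auto
      show "(\<lambda>S. (S \<inter> y, S - y)) ((\<lambda>(S1, S2). S1 \<union> S2) p) = p" if "p \<in> ?S1 \<times> ?S2" for p
        using that inv by (cases p) simp
    qed
    also have "\<dots> = card ?S1 * card ?S2" by (rule card_cartesian_product)
    also have "card ?S1 = card ?A1 choose card (T \<inter> y)" by (rule n_subsets) (use fin in auto)
    also have "card ?S2 = card ?A2 choose card (T - y)" by (rule n_subsets) (use fin in auto)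
    finally show ?thesis by (simp add: zavg_def)
  qed
  moreover have "lowdeg U k (\<lambda>A. of_bool (T' \<subseteq> A))" if "T' \<in> \<T>" for T'
  proof (rule lowdeg.mono)
    show "T' \<subseteq> U" using that by (simp add: \<T>_def)
    then show "finite T'" using fin finite_subset by auto
    have split: "card S = card (S \<inter> y) + card (S - y)" if "finite S" for S :: "'a set"
      using that by (metis Int_Diff_disjoint Int_Diff_Un card_Un_disjoint finite_Diff finite_Int)
    have "card T' = card T"
      using that split[OF \<open>finite T'\<close>] split[OF finite_subset[OF \<open>T \<subseteq> U\<close> fin]] by (simp add: \<T>_def)
    then show "card T' \<le> k" using assms by simp
  qed
  ultimately show ?thesis by (simp only:) (intro lowdeg.scale lowdeg_sum)
qed

text \<open>The stabilizer fixes y, so averaging does not change the value there.\<close>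

lemma zavg_self:
  assumes "finite U" "y \<subseteq> U" "T \<subseteq> U"
  shows "zavg U y T y = of_bool (T \<subseteq> y)"
proof (cases "T \<subseteq> y")
  case True
  then have "card (T \<inter> y) \<le> card y" using assms finite_subset by (metis card_mono inf_le2)
  moreover have "card (T - y) = 0" using True by (metis Diff_eq_empty_iff card.empty)
  ultimately show ?thesis using True by (simp add: zavg_def)
next
  case False
  then have "T - y \<noteq> {}" by auto
  moreover have "finite (T - y)" using finite_subset[OF assms(3,1)] by simp
  ultimately have "card (T - y) > 0" by (simp add: card_gt_0_iff)
  then show ?thesis using False by (simp add: zavg_def)
qed

section \<open>Tight weighted designs on two shells\<close>

lemma lowdeg_repr:
  assumes "lowdeg U k f" "finite U"
  shows "\<exists>c. \<forall>A. f A = (\<Sum>T\<in>{T \<in> Pow U. card T \<le> k}. c T * of_bool (T \<subseteq> A))"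
  using assms(1)
proof (induction rule: lowdeg.induct)
  case (mono S)
  have "(\<Sum>T\<in>{T \<in> Pow U. card T \<le> k}. of_bool (T = S) * of_bool (T \<subseteq> A)) = (of_bool (S \<subseteq> A) :: real)" for A
  proof -
    have "(\<Sum>T\<in>{T \<in> Pow U. card T \<le> k}. of_bool (T = S) * of_bool (T \<subseteq> A)) =
      (\<Sum>T\<in>{T \<in> Pow U. card T \<le> k}. if T = S then of_bool (S \<subseteq> A) else (0 :: real))"
      by (intro sum.cong refl) auto
    then show ?thesis using mono assms(2) by simp
  qed
  then show ?case by (intro exI[of _ "\<lambda>T. of_bool (T = S)"]) simp
next
  case (add f g)
  then obtain c d where "\<And>A. f A = (\<Sum>T\<in>{T \<in> Pow U. card T \<le> k}. c T * of_bool (T \<subseteq> A))"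
    "\<And>A. g A = (\<Sum>T\<in>{T \<in> Pow U. card T \<le> k}. d T * of_bool (T \<subseteq> A))" by blast
  then show ?case by (intro exI[of _ "\<lambda>T. c T + d T"]) (simp add: distrib_right sum.distrib)
next
  case (scale f a)
  then obtain c where "\<And>A. f A = (\<Sum>T\<in>{T \<in> Pow U. card T \<le> k}. c T * of_bool (T \<subseteq> A))" by blast
  then show ?case by (intro exI[of _ "\<lambda>T. a * c T"]) (simp add: sum_distrib_left mult.assoc)
qed

lemma coeff_mult_degree_le:
  fixes p q :: "real poly"
  assumes "degree p \<le> a" "degree q \<le> b"
  shows "coeff (p * q) (a + b) = coeff p a * coeff q b"
proof (cases "degree p = a \<and> degree q = b")
  case True
  then show ?thesis using coeff_mult_degree_sum[of p q] by simp
next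
  case False
  then have "degree p + degree q < a + b" using assms by linarith
  then have "coeff (p * q) (a + b) = 0" using degree_mult_le[of p q] by (intro coeff_eq_0) linarith
  moreover have "coeff p a = 0 \<or> coeff q b = 0" using False assms by (meson coeff_eq_0 le_neq_implies_less)
  ultimately show ?thesis by auto
qed

text \<open>The binomial coefficient of u + d * x over a, as a polynomial in x. Its coefficient of
  x^a is free of u; this later makes top coefficients independent of the shell.\<close>

definition binom_poly :: "nat \<Rightarrow> real \<Rightarrow> real \<Rightarrow> real poly" where
  "binom_poly a u d = smult (1 / fact a) (\<Prod>i<a. [:u - real i, d:])"

lemma poly_binom_poly: "u + x * d = real v \<Longrightarrow> poly (binom_poly a u d) x = real (v choose a)"
proof -
  assume *: "u + x * d = real v"
  have "real (v choose a) = (\<Prod>i<a. real v - real i) / fact a"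
    unfolding binomial_gbinomial gbinomial_prod_rev by (simp add: atLeast0LessThan)
  also have "(\<Prod>i<a. real v - real i) = (\<Prod>i<a. u - real i + x * d)"
    unfolding *[symmetric] by (simp add: algebra_simps)
  finally show ?thesis by (simp add: binom_poly_def poly_prod)
qed

lemma binom_poly_degree_coeff:
  "degree (binom_poly a u d) \<le> a" "coeff (binom_poly a u d) a = d ^ a / fact a"
proof -
  have "degree (\<Prod>i<a. [:u - real i, d:]) \<le> a \<and> coeff (\<Prod>i<a. [:u - real i, d:]) a = d ^ a"
  proof (induction a)
    case (Suc a)
    let ?P = "\<Prod>i<a. [:u - real i, d:]" and ?q = "[:u - real a, d:]"
    have "degree (?P * ?q) \<le> a + 1" using degree_mult_le[of ?P ?q] Suc by (auto split: if_splits)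
    moreover have "coeff (?P * ?q) (a + 1) = coeff ?P a * coeff ?q 1"
      using Suc by (intro coeff_mult_degree_le) auto
    ultimately show ?case using Suc by (simp add: mult.commute)
  qed simp
  then show "degree (binom_poly a u d) \<le> a" "coeff (binom_poly a u d) a = d ^ a / fact a"
    by (auto simp: binom_poly_def)
qed

text \<open>Omit t elements of y and fill up with r - card y + t elements outside. Every admissible
  t occurs on a shell in this way, which provides the many zeros used in degree arguments.\<close>

lemma subset_with_cards:
  assumes "finite U" "y \<subseteq> U" "t \<le> card y" "card y \<le> r" "r - card y + t \<le> card U - card y"
  shows "\<exists>A\<subseteq>U. card A = r \<and> card (y - A) = t"
proof -
  have fy: "finite y" using assms finite_subset by auto
  obtain B where B: "B \<subseteq> y" "card B = card y - t" using obtain_subset_with_card_n[of "card y - t" y] by auto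
  have "r - card y + t \<le> card (U - y)" using assms fy by (simp add: card_Diff_subset)
  then obtain C where C: "C \<subseteq> U - y" "card C = r - card y + t" using obtain_subset_with_card_n by metis
  have fin: "finite B" "finite C" using B C fy assms(1) finite_subset by (auto intro: finite_subset[of C "U - y"] finite_subset[of B y])
  have "card (B \<union> C) = card B + card C" using B C fin by (intro card_Un_disjoint) auto
  moreover have "y - (B \<union> C) = y - B" using C by auto
  moreover have "card (y - B) = t" using B fin assms by (simp add: card_Diff_subset)
  ultimately show ?thesis using B C assms by (intro exI[of _ "B \<union> C"]) auto
qed

text \<open>The base vertex has become the empty set. In \<open>balanced\<close> the values
  \<open>lam\<close> are left open; they turn out to be determined by the masses of the two
  shells.\<close>

locale shell_design =
  fixes U :: "'a set" and Y :: "'a set set" and \<omega> :: "'a set \<Rightarrow> real" and l m e :: nat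
  assumes fin: "finite U" and Y_sub: "Y \<subseteq> Pow U"
    and pos: "\<And>A. A \<in> Y \<Longrightarrow> \<omega> A > 0"
    and sizes: "\<And>A. A \<in> Y \<Longrightarrow> card A = l \<or> card A = m"
    and meets: "\<exists>A\<in>Y. card A = l" "\<exists>A\<in>Y. card A = m"
    and bounds: "1 \<le> e" "e \<le> l" "l < m" "m \<le> card U - l"
    and balanced: "\<exists>lam. \<forall>T\<subseteq>U. card T \<le> 2 * e \<longrightarrow> (\<Sum>A\<in>Y. \<omega> A * of_bool (T \<subseteq> A)) = lam (card T)"
begin

text \<open>Weight received by each r-set when the mass of the shell is spread evenly over all of
  them.\<close>

definition W :: "nat \<Rightarrow> real" where
  "W r = (\<Sum>A\<in>{A \<in> Y. card A = r}. \<omega> A) / real (card U choose r)"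

definition wt :: "nat \<Rightarrow> real" where
  "wt r = (if r = l \<or> r = m then W r else 0)"

lemma finY: "finite Y"
  using Y_sub fin by (meson finite_Pow_iff finite_subset)

lemma cardU: "l \<le> card U" "m \<le> card U" "2 * l < card U"
  using bounds by auto

lemma W_pos: "r = l \<or> r = m \<Longrightarrow> W r > 0"
proof -
  assume r: "r = l \<or> r = m"
  have "(\<Sum>A\<in>{A \<in> Y. card A = r}. \<omega> A) > 0"
    using r meets finY pos by (intro sum_pos) auto
  then show ?thesis using r cardU by (auto simp: W_def)
qed

lemma wt_nonneg: "wt r \<ge> 0"
  using W_pos[of r] by (auto simp: wt_def)

text \<open>Averaging the balance condition over all T' with card T' = t computes
  \<open>lam t\<close> from the two shell masses, with coefficients depending only on t and the
  sizes. The evenly spread weight has the same averages, so both weights agree on monomials.\<close>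

lemma quad:
  assumes "lowdeg U (2 * e) f"
  shows "(\<Sum>A\<in>Y. \<omega> A * f A) = (\<Sum>A\<in>Pow U. wt (card A) * f A)"
  using assms
proof (rule lowdeg_functional_eq)
  fix T assume T: "T \<subseteq> U" "finite T" "card T \<le> 2 * e"
  let ?t = "card T"
  obtain lam where lam: "\<And>T. T \<subseteq> U \<Longrightarrow> card T \<le> 2 * e \<Longrightarrow> (\<Sum>A\<in>Y. \<omega> A * of_bool (T \<subseteq> A)) = lam (card T)"
    using balanced by blast
  let ?\<T> = "{T'. T' \<subseteq> U \<and> card T' = ?t}"
  have "real (card U choose ?t) * lam ?t = (\<Sum>T'\<in>?\<T>. \<Sum>A\<in>Y. \<omega> A * of_bool (T' \<subseteq> A))"
    using n_subsets[OF fin, of ?t] lam T by simp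
  also have "\<dots> = (\<Sum>A\<in>Y. \<omega> A * (\<Sum>T'\<in>?\<T>. of_bool (T' \<subseteq> A)))"
    by (subst sum.swap) (simp add: sum_distrib_left)
  also have "\<dots> = (\<Sum>A\<in>Y. \<omega> A * real (card A choose ?t))"
  proof (intro sum.cong refl)
    fix A assume "A \<in> Y"
    then have A: "A \<subseteq> U" "finite A" using Y_sub finite_subset[OF _ fin] by auto
    have "finite ?\<T>" by (rule finite_subset[of _ "Pow U"]) (use fin in auto)
    then have "(\<Sum>T'\<in>?\<T>. of_bool (T' \<subseteq> A)) = real (card {T' \<in> ?\<T>. T' \<subseteq> A})"
      by (simp add: Int_def)
    also have "{T' \<in> ?\<T>. T' \<subseteq> A} = {T'. T' \<subseteq> A \<and> card T' = ?t}" using A by auto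
    finally show "\<omega> A * (\<Sum>T'\<in>?\<T>. of_bool (T' \<subseteq> A)) = \<omega> A * real (card A choose ?t)"
      using n_subsets[OF A(2)] by simp
  qed
  also have "\<dots> = (\<Sum>A\<in>{A \<in> Y. card A = l}. \<omega> A * real (card A choose ?t)) + (\<Sum>A\<in>{A \<in> Y. card A = m}. \<omega> A * real (card A choose ?t))"
    using finY sizes bounds by (subst sum.union_disjoint[symmetric]) (auto intro!: sum.cong)
  also have "\<dots> = (card U choose l) * W l * real (l choose ?t) + (card U choose m) * W m * real (m choose ?t)"
    using cardU by (simp add: W_def sum_distrib_right)
  finally have 1: "real (card U choose ?t) * lam ?t = (card U choose l) * W l * real (l choose ?t) + (card U choose m) * W m * real (m choose ?t)" .
  have C: "real (card U choose ?t) > 0" using T fin by (simp add: card_mono)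
  have "(\<Sum>A\<in>Pow U. wt (card A) * of_bool (T \<subseteq> A)) = (\<Sum>A\<in>Pow U. of_bool (T \<subseteq> A) * wt (card A))"
    by (simp add: mult.commute)
  also have "\<dots> = (\<Sum>A\<in>Pow U. real (card A choose ?t) / real (card U choose ?t) * wt (card A))"
    by (rule sum_Pow_average[OF fin T(1)])
  also have "\<dots> = (\<Sum>j\<le>card U. real (card U choose j) * (real (j choose ?t) / real (card U choose ?t) * wt j))"
    by (rule sum_Pow_card[OF fin])
  also have "\<dots> = (\<Sum>j\<in>{l, m}. real (card U choose j) * (real (j choose ?t) / real (card U choose ?t) * wt j))"
    using cardU by (intro sum.mono_neutral_right) (auto simp: wt_def)
  also have "\<dots> = lam ?t" using 1 C bounds by (simp add: wt_def field_simps)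
  finally show "(\<Sum>A\<in>Y. \<omega> A * of_bool (T \<subseteq> A)) = (\<Sum>A\<in>Pow U. wt (card A) * of_bool (T \<subseteq> A))"
    using lam[OF T(1,3)] by simp
qed

lemma vanish_of_square_sum:
  assumes "(\<Sum>A\<in>Pow U. wt (card A) * (g A)\<^sup>2) = 0" and "A \<subseteq> U" "card A = l \<or> card A = m"
  shows "g A = 0"
proof -
  have "\<forall>A\<in>Pow U. wt (card A) * (g A)\<^sup>2 = 0"
    using assms(1) fin by (subst (asm) sum_nonneg_eq_0_iff) (auto simp: wt_nonneg)
  then have "wt (card A) * (g A)\<^sup>2 = 0" using assms(2) by auto
  then show ?thesis using W_pos[of "card A"] assms(3) by (auto simp: wt_def)
qed

text \<open>The square of g stays within degree 2 * e, and the evenly spread weight is positive on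
  all sets of both shells. This injectivity of restriction to Y is what the lower bound on the size
  of Y expresses.\<close>

lemma vanish:
  assumes "lowdeg U e g" "\<And>A. A \<in> Y \<Longrightarrow> g A = 0" and "A \<subseteq> U" "card A = l \<or> card A = m"
  shows "g A = 0"
proof (rule vanish_of_square_sum[OF _ assms(3,4)])
  have "lowdeg U (2 * e) (\<lambda>A. (g A)\<^sup>2)"
    using lowdeg_mult[OF assms(1) assms(1)] by (simp add: power2_eq_square mult_2)
  from quad[OF this] show "(\<Sum>A\<in>Pow U. wt (card A) * (g A)\<^sup>2) = 0" using assms(2) by simp
qed

lemma sum_delta:
  assumes "y \<in> Y" "\<And>A. A \<in> Y \<Longrightarrow> f A = of_bool (A = y)"
  shows "(\<Sum>A\<in>Y. \<omega> A * (f A * g A)) = \<omega> y * g y"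
proof -
  have "(\<Sum>A\<in>Y. \<omega> A * (f A * g A)) = (\<Sum>A\<in>Y. if A = y then \<omega> y * g y else 0)"
    using assms by (intro sum.cong refl) auto
  then show ?thesis using finY assms(1) by simp
qed

text \<open>Averaging \<open>f\<close> over the stabilizer of \<open>y\<close> preserves its reproducing property, hence \<open>f\<close> itself.\<close>

lemma delta_is_zonal:
  assumes y: "y \<in> Y" and f: "\<And>A. f A = (\<Sum>T\<in>{T \<in> Pow U. card T \<le> e}. c T * of_bool (T \<subseteq> A))"
    and delta: "\<And>A. A \<in> Y \<Longrightarrow> f A = of_bool (A = y)"
    and A: "A \<subseteq> U" "card A = l \<or> card A = m"
  shows "f A = (\<Sum>T\<in>{T \<in> Pow U. card T \<le> e}. c T * zavg U y T A)"
proof -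
  let ?\<T> = "{T \<in> Pow U. card T \<le> e}"
  define fb where "fb A = (\<Sum>T\<in>?\<T>. c T * zavg U y T A)" for A
  have yU: "y \<subseteq> U" using y Y_sub by auto
  have fT: "finite T" if "T \<subseteq> U" for T using that fin finite_subset by auto
  have lowf: "lowdeg U e f"
    unfolding f by (intro lowdeg_sum lowdeg.scale lowdeg.mono) (auto simp: fT)
  have lowfb: "lowdeg U e (\<lambda>A. fb (A \<inter> U))"
    unfolding fb_def by (intro lowdeg_sum lowdeg.scale lowdeg_zavg) (use fin yU in auto)
  have split: "card A = card (A \<inter> y) + card (A - y)" if "A \<subseteq> U" for A
    using fT[OF that] by (metis Int_Diff_disjoint Int_Diff_Un card_Un_disjoint finite_Diff finite_Int)
  define z where "z T i j = real (i choose card (T \<inter> y)) / real (card y choose card (T \<inter> y)) *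
     (real (j choose card (T - y)) / real (card (U - y) choose card (T - y)))" for T :: "'a set" and i j
  have z: "zavg U y T A = z T (card (A \<inter> y)) (card (A - y))" for T A by (simp add: zavg_def z_def)
  \<comment> \<open>The average is moved from \<open>fb\<close> to the monomial of S:
    \<open>zonal_average\<close> is applied once to S and once backwards to each T. The reproducing
    property of f then meets an averaged monomial, whose value at y is unchanged.\<close>
  have "(\<Sum>A\<in>Pow U. of_bool (S \<subseteq> A) * (wt (card A) * fb A)) = \<omega> y * of_bool (S \<subseteq> y)" if S: "S \<in> ?\<T>" for S
  proof -
    have SU: "S \<subseteq> U" using S by auto
    have "(\<Sum>A\<in>Pow U. of_bool (S \<subseteq> A) * (wt (card A) * fb A)) = (\<Sum>A\<in>Pow U. zavg U y S A * (wt (card A) * fb A))"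
      using zonal_average[OF fin yU SU, of "\<lambda>i j. wt (i + j) * (\<Sum>T\<in>?\<T>. c T * z T i j)"]
      by (simp add: fb_def z split[symmetric] cong: sum.cong_simp)
    also have "\<dots> = (\<Sum>T\<in>?\<T>. c T * (\<Sum>A\<in>Pow U. zavg U y T A * (wt (card A) * zavg U y S A)))"
      unfolding fb_def sum_distrib_left by (subst sum.swap) (simp only: ac_simps)
    also have "\<dots> = (\<Sum>T\<in>?\<T>. c T * (\<Sum>A\<in>Pow U. of_bool (T \<subseteq> A) * (wt (card A) * zavg U y S A)))"
    proof (intro sum.cong refl)
      fix T assume "T \<in> ?\<T>"
      then show "c T * (\<Sum>A\<in>Pow U. zavg U y T A * (wt (card A) * zavg U y S A)) =
          c T * (\<Sum>A\<in>Pow U. of_bool (T \<subseteq> A) * (wt (card A) * zavg U y S A))"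
        using zonal_average[OF fin yU, of T "\<lambda>i j. wt (i + j) * z S i j"]
        by (simp add: z split[symmetric] cong: sum.cong_simp)
    qed
    also have "\<dots> = (\<Sum>A\<in>Pow U. wt (card A) * (f A * zavg U y S A))"
      unfolding f sum_distrib_left sum_distrib_right by (subst sum.swap) (simp only: ac_simps)
    also have "\<dots> = (\<Sum>A\<in>Pow U. wt (card A) * (f A * zavg U y S (A \<inter> U)))"
      by (intro sum.cong refl) (auto simp: Int_absorb2)
    also have "\<dots> = (\<Sum>A\<in>Y. \<omega> A * (f A * zavg U y S (A \<inter> U)))"
      using S lowdeg_mult[OF lowf lowdeg_zavg[OF fin yU SU, of e]] by (intro quad[symmetric]) (simp add: mult_2)
    also have "\<dots> = \<omega> y * zavg U y S (y \<inter> U)" by (rule sum_delta[OF y delta])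
    also have "\<dots> = \<omega> y * of_bool (S \<subseteq> y)" using zavg_self[OF fin yU SU] yU by (simp add: Int_absorb2)
    finally show ?thesis .
  qed
  moreover have "(\<Sum>A\<in>Pow U. of_bool (S \<subseteq> A) * (wt (card A) * f A)) = \<omega> y * of_bool (S \<subseteq> y)" if S: "S \<in> ?\<T>" for S
  proof -
    have "lowdeg U e (\<lambda>A. of_bool (S \<subseteq> A))" using S fT by (intro lowdeg.mono) auto
    then have "lowdeg U (2 * e) (\<lambda>A. f A * of_bool (S \<subseteq> A))" using lowdeg_mult[OF lowf] by (simp add: mult_2)
    then have "(\<Sum>A\<in>Pow U. wt (card A) * (f A * of_bool (S \<subseteq> A))) = (\<Sum>A\<in>Y. \<omega> A * (f A * of_bool (S \<subseteq> A)))"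
      by (rule quad[symmetric])
    also have "\<dots> = \<omega> y * of_bool (S \<subseteq> y)" by (rule sum_delta[OF y delta])
    finally have "(\<Sum>A\<in>Pow U. wt (card A) * (f A * of_bool (S \<subseteq> A))) = \<omega> y * of_bool (S \<subseteq> y)" .
    then show ?thesis by (simp only: ac_simps)
  qed
  ultimately have orth: "(\<Sum>A\<in>Pow U. (wt (card A) * (f A - fb A)) * of_bool (S \<subseteq> A)) = 0" if "S \<in> ?\<T>" for S
    using that by (simp add: right_diff_distrib left_diff_distrib sum_subtractf mult.commute)
  \<comment> \<open>The difference f - fb has degree at most e and is orthogonal to all monomials of
    such degree, hence to itself.\<close>
  have "lowdeg U e (\<lambda>A. f A - fb (A \<inter> U))" using lowf lowfb by (rule lowdeg_diff)
  then have "(\<Sum>A\<in>Pow U. (wt (card A) * (f A - fb A)) * (f A - fb (A \<inter> U))) = (\<Sum>A\<in>{}. 0 * (f A - fb (A \<inter> U)))"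
    by (rule lowdeg_functional_eq) (use orth in auto)
  moreover have "(\<Sum>A\<in>Pow U. (wt (card A) * (f A - fb A)) * (f A - fb (A \<inter> U))) = (\<Sum>A\<in>Pow U. wt (card A) * (f A - fb A)\<^sup>2)"
    by (intro sum.cong refl) (auto simp: Int_absorb2 power2_eq_square)
  ultimately have "(\<Sum>A\<in>Pow U. wt (card A) * (f A - fb A)\<^sup>2) = 0" by simp
  from vanish_of_square_sum[OF this A] show ?thesis by (simp add: fb_def)
qed

lemma card_inter_diff:
  assumes "A \<subseteq> U" "y \<subseteq> U"
  shows "real (card (A \<inter> y)) = real (card y) - real (card (y - A))"
    and "real (card (A - y)) = real (card A) - real (card y) + real (card (y - A))"
proof -
  have fin': "finite A" "finite y" using assms finite_subset[OF _ fin] by auto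
  have "card y = card (A \<inter> y) + card (y - A)"
    using fin' by (metis Int_Diff_disjoint Int_Diff_Un Int_commute card_Un_disjoint finite_Diff finite_Int)
  moreover have "card A = card (A \<inter> y) + card (A - y)"
    using fin' by (metis Int_Diff_disjoint Int_Diff_Un card_Un_disjoint finite_Diff finite_Int)
  ultimately show "real (card (A \<inter> y)) = real (card y) - real (card (y - A))"
    "real (card (A - y)) = real (card A) - real (card y) + real (card (y - A))" by linarith+
qed

text \<open>For A of given size, card (A \<inter> y) and card (A - y) are affine in card (y - A)
  with slopes -1 and 1. The size enters only the constant terms, so the coefficient of degree e is
  common to the shells; this is the link between them.\<close>

lemma zonal_polynomials:
  assumes y: "y \<in> Y" and f: "lowdeg U e f" "\<And>A. A \<in> Y \<Longrightarrow> f A = of_bool (A = y)"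
  shows "\<exists>Q :: nat \<Rightarrow> real poly. (\<forall>r. degree (Q r) \<le> e) \<and> (\<forall>r s. coeff (Q r) e = coeff (Q s) e) \<and>
    (\<forall>A\<subseteq>U. card A = l \<or> card A = m \<longrightarrow> f A = poly (Q (card A)) (real (card (y - A))))"
proof -
  let ?\<T> = "{T \<in> Pow U. card T \<le> e}"
  obtain c where c: "\<And>A. f A = (\<Sum>T\<in>?\<T>. c T * of_bool (T \<subseteq> A))"
    using lowdeg_repr[OF f(1) fin] by blast
  have yU: "y \<subseteq> U" using y Y_sub by auto
  define d where "d T = c T / (real (card y choose card (T \<inter> y)) * real (card (U - y) choose card (T - y)))" for T
  define P where "P r T = binom_poly (card (T \<inter> y)) (real (card y)) (-1) * binom_poly (card (T - y)) (real r - real (card y)) 1" for r T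
  define Q where "Q r = (\<Sum>T\<in>?\<T>. smult (d T) (P r T))" for r
  have cardT: "card T = card (T \<inter> y) + card (T - y)" if "T \<in> ?\<T>" for T
    using that finite_subset[OF _ fin, of T] by (metis (no_types, lifting) Int_Diff_disjoint Int_Diff_Un card_Un_disjoint finite_Diff finite_Int mem_Collect_eq PowD)
  have degP: "degree (P r T) \<le> card T" if "T \<in> ?\<T>" for r T
  proof -
    have "degree (P r T) \<le> card (T \<inter> y) + card (T - y)"
      unfolding P_def by (rule order_trans[OF degree_mult_le add_mono]) (rule binom_poly_degree_coeff)+
    then show ?thesis using cardT[OF that] by simp
  qed
  have "degree (Q r) \<le> e" for r
    unfolding Q_def
  proof (rule degree_sum_le)
    show "finite ?\<T>" using fin by simp
    fix T assume T: "T \<in> ?\<T>"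
    show "degree (smult (d T) (P r T)) \<le> e"
      using degree_smult_le[of "d T" "P r T"] degP[OF T, of r] T by auto
  qed
  moreover have "coeff (Q r) e = coeff (Q s) e" for r s
  proof -
    have "coeff (P r T) e = coeff (P s T) e" if T: "T \<in> ?\<T>" for T
    proof (cases "card T = e")
      case True
      then have e: "e = card (T \<inter> y) + card (T - y)" using cardT[OF T] by simp
      show ?thesis unfolding P_def
        by (subst (1 2) e, subst (1 2) coeff_mult_degree_le) (simp_all add: binom_poly_degree_coeff)
    next
      case False
      then have "degree (P r T) < e" "degree (P s T) < e" using degP[OF T, of r] degP[OF T, of s] T by auto
      then show ?thesis by (simp add: coeff_eq_0)
    qed
    then show ?thesis unfolding Q_def coeff_sum coeff_smult by (intro sum.cong refl) simp
  qed
  moreover have "f A = poly (Q (card A)) (real (card (y - A)))" if A: "A \<subseteq> U" "card A = l \<or> card A = m" for A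
  proof -
    have "f A = (\<Sum>T\<in>?\<T>. c T * zavg U y T A)" by (rule delta_is_zonal[OF y c f(2) A])
    also have "\<dots> = (\<Sum>T\<in>?\<T>. d T * poly (P (card A) T) (real (card (y - A))))"
    proof (intro sum.cong refl)
      fix T
      have "poly (P (card A) T) (real (card (y - A))) = real (card (A \<inter> y) choose card (T \<inter> y)) * real (card (A - y) choose card (T - y))"
        unfolding P_def poly_mult
        by (subst poly_binom_poly[of _ _ _ "card (A \<inter> y)"], use card_inter_diff[OF A(1) yU] in simp,
            subst poly_binom_poly[of _ _ _ "card (A - y)"], use card_inter_diff[OF A(1) yU] in simp, rule refl)
      then show "c T * zavg U y T A = d T * poly (P (card A) T) (real (card (y - A)))"
        by (simp add: zavg_def d_def)
    qed
    finally show ?thesis by (simp add: Q_def poly_sum)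
  qed
  ultimately show ?thesis by blast
qed

lemma lowdeg_diff_card:
  assumes "y \<subseteq> U" "card y = l" "degree q \<le> k"
  shows "lowdeg U k (\<lambda>A. poly q (real l - real (card (A \<inter> y))))"
proof -
  have "lowdeg U 1 (\<lambda>A. real l - real (card (A \<inter> y)))"
    by (intro lowdeg_diff lowdeg_const lowdeg_card_inter) (use assms finite_subset[OF _ fin] in auto)
  from lowdeg_poly[OF this assms(3)] show ?thesis .
qed

lemma lowdeg_size: "lowdeg U 1 (\<lambda>A. real (card (A \<inter> U)) - real s)"
  by (intro lowdeg_diff lowdeg_const lowdeg_card_inter) (use fin in auto)

text \<open>If f vanished on the other shell, the common coefficient of degree e would be 0, so on
  its own shell f = q(t) with t = card (y - A) and degree of q below e. Then t * q(t) is an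
  admissible test function; it is zero at y, so the sum of t * q(t)^2 over the shell vanishes and q
  has the zeros 1, ..., l. Hence q = 0, against f y = 1.\<close>

lemma delta_nonzero_on_other_shell:
  assumes y: "y \<in> Y" "card y = l" and f: "lowdeg U e f" "\<And>A. A \<in> Y \<Longrightarrow> f A = of_bool (A = y)"
  shows "\<exists>A\<subseteq>U. card A = m \<and> f A \<noteq> 0"
proof (rule ccontr)
  assume "\<not> ?thesis"
  then have f0: "f A = 0" if "A \<subseteq> U" "card A = m" for A using that by auto
  have yU: "y \<subseteq> U" using y Y_sub by auto
  obtain Q :: "nat \<Rightarrow> real poly" where Q: "\<And>r. degree (Q r) \<le> e" "\<And>r s. coeff (Q r) e = coeff (Q s) e"
    "\<And>A. A \<subseteq> U \<Longrightarrow> card A = l \<or> card A = m \<Longrightarrow> f A = poly (Q (card A)) (real (card (y - A)))"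
    using zonal_polynomials[OF y(1) f] by blast
  have many: "q = 0" if "\<And>t. t \<in> S \<Longrightarrow> poly q (real t) = 0" "finite S" "degree q < card S" for q :: "real poly" and S
  proof (rule ccontr)
    assume q: "q \<noteq> 0"
    have "card S = card (real ` S)" by (simp add: card_image)
    also have "\<dots> \<le> card {x. poly q x = 0}" using that q by (intro card_mono poly_roots_finite) auto
    also have "\<dots> \<le> degree q" using q by (rule card_poly_roots_bound)
    finally show False using that(3) by simp
  qed
  have "Q m = 0"
  proof (rule many[of "{..l}"])
    fix t assume "t \<in> {..l}"
    then have "m - card y + t \<le> card U - card y" "t \<le> card y" "card y \<le> m" using y(2) bounds by auto
    then obtain A where "A \<subseteq> U" "card A = m" "card (y - A) = t"
      using subset_with_cards[OF fin yU] by blast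
    then show "poly (Q m) (real t) = 0" using Q(3)[of A] f0[of A] by simp
  qed (use Q(1)[of m] bounds in auto)
  then have "coeff (Q l) e = 0" using Q(2)[of l m] by simp
  then have degl: "degree (Q l) < e"
    using Q(1)[of l] bounds by (metis le_neq_implies_less leading_coeff_0_iff degree_0 not_one_le_zero)
  define g where "g A = poly (pCons 0 (Q l)) (real l - real (card (A \<inter> y)))" for A
  have low: "lowdeg U e g"
    unfolding g_def by (rule lowdeg_diff_card[OF yU y(2)]) (use degl degree_pCons_le[of 0 "Q l"] in linarith)
  have "(\<Sum>A\<in>Pow U. wt (card A) * (f A * g A)) = (\<Sum>A\<in>Y. \<omega> A * (f A * g A))"
    using lowdeg_mult[OF f(1) low] by (intro quad[symmetric]) (simp add: mult_2)
  also have "\<dots> = \<omega> y * g y" by (rule sum_delta[OF y(1) f(2)])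
  also have "g y = 0" using y(2) by (simp add: g_def)
  finally have sum0: "(\<Sum>A\<in>Pow U. wt (card A) * (f A * g A)) = 0" by simp
  have val: "wt (card A) * (f A * g A) = (if card A = l then W l * (real (card (y - A)) * (poly (Q l) (real (card (y - A))))\<^sup>2) else 0)"
    if A: "A \<in> Pow U" for A
  proof (cases "card A = l")
    case True
    have t: "real l - real (card (A \<inter> y)) = real (card (y - A))"
      using card_inter_diff(1)[of A y] A yU y(2) by simp
    show ?thesis using True A Q(3)[of A] by (simp add: g_def t wt_def power2_eq_square)
  next
    case False
    then show ?thesis using f0[of A] A by (cases "card A = m") (auto simp: wt_def)
  qed
  have zero0: "\<forall>A\<in>Pow U. wt (card A) * (f A * g A) = 0"
    using sum0 fin W_pos[of l] by (subst (asm) sum_nonneg_eq_0_iff) (auto simp: val less_imp_le)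
  then have zero: "real (card (y - A)) * (poly (Q l) (real (card (y - A))))\<^sup>2 = 0" if "A \<subseteq> U" "card A = l" for A
  proof -
    have "W l * (real (card (y - A)) * (poly (Q l) (real (card (y - A))))\<^sup>2) = 0"
      using that val[of A] bspec[OF zero0, of A] by (simp only: Pow_iff if_True simp_thms)
    then show ?thesis using W_pos[of l] by simp
  qed
  have "Q l = 0"
  proof (rule many[of "{1..l}"])
    fix t assume t: "t \<in> {1..l}"
    obtain A where "A \<subseteq> U" "card A = l" "card (y - A) = t"
      using subset_with_cards[OF fin yU, of t l] y(2) bounds t by auto
    then show "poly (Q l) (real t) = 0" using zero[of A] t by auto
  qed (use degl bounds in auto)
  moreover have "f y = 1" using f(2)[OF y(1)] by simp
  ultimately show False using Q(3)[OF yU] y(2) by simp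
qed

end

locale tight_shell_design = shell_design +
  assumes interpol: "\<And>y. y \<in> Y \<Longrightarrow> \<exists>f. lowdeg U e f \<and> (\<forall>A\<in>Y. f A = of_bool (A = y))"
begin

text \<open>The factor card A - l annihilates the shell of y at the cost of one degree. With fewer
  than e values of card (y - z) it would complete a function of degree at most e that is zero on Y
  but not on the shell; more than e values are too many zeros for the polynomial of degree at most e
  representing the indicator of y. In degree 2 * e it leaves room for e zeros and a factor of degree
  e - 1, which is exactly orthogonality.\<close>

lemma hahn_orthogonal_integer_roots:
  "\<exists>D\<subseteq>{..l}. card D = e \<and> (\<forall>F :: real poly. degree F < e \<longrightarrow>
     (\<Sum>t\<le>l. hahn_weight (card U) l m t * (\<Prod>\<xi>\<in>D. real t - real \<xi>) * poly F (real t)) = 0)"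
proof -
  obtain y where y: "y \<in> Y" "card y = l" using meets(1) by auto
  have yU: "y \<subseteq> U" using y Y_sub by auto
  have fy: "finite y" using yU fin finite_subset by auto
  obtain f where f: "lowdeg U e f" "\<And>A. A \<in> Y \<Longrightarrow> f A = of_bool (A = y)" using interpol[OF y(1)] by blast
  obtain Q :: "nat \<Rightarrow> real poly" where Q: "\<And>r. degree (Q r) \<le> e"
    "\<And>A. A \<subseteq> U \<Longrightarrow> card A = l \<or> card A = m \<Longrightarrow> f A = poly (Q (card A)) (real (card (y - A)))"
    using zonal_polynomials[OF y(1) f] by blast
  define D where "D = (\<lambda>z. card (y - z)) ` {z \<in> Y. card z = m}"
  have finD: "finite D" using finY by (simp add: D_def)
  have Dl: "D \<subseteq> {..l}" using fy y(2) by (auto simp: D_def intro: card_mono)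
  define P where "P = (\<Prod>\<xi>\<in>D. [:- real \<xi>, 1:])"
  have P: "poly P (real t) = (\<Prod>\<xi>\<in>D. real t - real \<xi>)" for t by (simp add: P_def poly_prod)
  have degP: "degree P = card D" unfolding P_def by (subst degree_prod_eq_sum_degree) auto
  have tval: "real l - real (card (A \<inter> y)) = real (card (y - A))" if "A \<subseteq> U" for A
    using card_inter_diff(1)[OF that yU] y(2) by simp
  have "card D \<le> e"
  proof -
    have nz: "Q m \<noteq> 0"
    proof
      assume "Q m = 0"
      then have "\<And>A. A \<subseteq> U \<Longrightarrow> card A = m \<Longrightarrow> f A = 0" using Q(2) by simp
      then show False using delta_nonzero_on_other_shell[OF y f] by blast
    qed
    have "card D = card (real ` D)" by (simp add: card_image)
    also have "\<dots> \<le> card {x. poly (Q m) x = 0}"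
    proof (intro card_mono poly_roots_finite nz subsetI)
      fix x assume "x \<in> real ` D"
      then obtain z where z: "z \<in> Y" "card z = m" "x = real (card (y - z))" by (auto simp: D_def)
      then have "z \<noteq> y" using y bounds by auto
      then show "x \<in> {x. poly (Q m) x = 0}" using Q(2)[of z] f(2)[of z] z Y_sub by auto
    qed
    also have "\<dots> \<le> degree (Q m)" using nz by (rule card_poly_roots_bound)
    finally show ?thesis using Q(1)[of m] by simp
  qed
  moreover have "e \<le> card D"
  proof (rule ccontr)
    assume "\<not> e \<le> card D"
    define g where "g A = poly P (real l - real (card (A \<inter> y))) * (real (card (A \<inter> U)) - real l)" for A
    have "lowdeg U (card D + 1) g"
      unfolding g_def by (intro lowdeg_mult lowdeg_size lowdeg_diff_card[OF yU y(2)]) (simp add: degP)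
    then have low: "lowdeg U e g" by (rule lowdeg_le) (use \<open>\<not> e \<le> card D\<close> in simp)
    have g: "g A = poly P (real (card (y - A))) * (real (card A) - real l)" if "A \<subseteq> U" for A
      using that by (simp add: g_def tval Int_absorb2)
    have gY: "g A = 0" if "A \<in> Y" for A
    proof (cases "card A = l")
      case False
      then have "card (y - A) \<in> D" using that sizes by (auto simp: D_def)
      then have "poly P (real (card (y - A))) = 0" unfolding P using finD by auto
      then show ?thesis using g that Y_sub by auto
    qed (use g that Y_sub in auto)
    have "card D < card {..l}" using \<open>\<not> e \<le> card D\<close> bounds by simp
    then obtain t where t: "t \<le> l" "t \<notin> D" using Dl by (metis atMost_iff less_irrefl subsetI subset_antisym)
    have "m - card y + t \<le> card U - card y" "t \<le> card y" "card y \<le> m" using y(2) bounds t by auto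
    then obtain A where A: "A \<subseteq> U" "card A = m" "card (y - A) = t"
      using subset_with_cards[OF fin yU] by blast
    have "g A = 0" by (rule vanish[OF low gY]) (use A in auto)
    then have "poly P (real t) = 0" using g[OF A(1)] A bounds by simp
    then show False unfolding P using t finD by auto
  qed
  ultimately have cardD: "card D = e" by simp
  have "(\<Sum>t\<le>l. hahn_weight (card U) l m t * (\<Prod>\<xi>\<in>D. real t - real \<xi>) * poly F (real t)) = 0" if F: "degree F < e" for F :: "real poly"
  proof -
    define g where "g A = (real (card (A \<inter> U)) - real l) * poly (P * F) (real l - real (card (A \<inter> y)))" for A
    have dPF: "degree (P * F) \<le> 2 * e - 1" using degree_mult_le[of P F] degP cardD F by linarith
    have "lowdeg U (1 + (2 * e - 1)) g"
      unfolding g_def by (intro lowdeg_mult lowdeg_size lowdeg_diff_card[OF yU y(2)] dPF)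
    then have low: "lowdeg U (2 * e) g" using bounds by simp
    have g: "g A = (real (card A) - real l) * poly (P * F) (real (card (y - A)))" if "A \<subseteq> U" for A
      using that by (simp add: g_def tval Int_absorb2)
    have gY: "g A = 0" if "A \<in> Y" for A
    proof (cases "card A = l")
      case False
      then have "card (y - A) \<in> D" using that sizes by (auto simp: D_def)
      then have "poly P (real (card (y - A))) = 0" unfolding P using finD by auto
      then show ?thesis using g that Y_sub by auto
    qed (use g that Y_sub in auto)
    define \<phi> where "\<phi> t = poly (P * F) (real t)" for t
    define n where "n = card U"
    have "0 = (\<Sum>A\<in>Pow U. wt (card A) * g A)" using quad[OF low] gY by simp
    also have "\<dots> = (\<Sum>A\<in>Pow U. (\<lambda>A1 A2. if card A1 + card A2 = m then W m * (real m - real l) * \<phi> (l - card A1) else 0) (A \<inter> y) (A - y))"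
    proof (intro sum.cong refl)
      fix A assume A: "A \<in> Pow U"
      then have fA: "finite A" using fin finite_subset by auto
      have sp: "card (A \<inter> y) + card (A - y) = card A"
        using fA by (metis Int_Diff_disjoint Int_Diff_Un card_Un_disjoint finite_Diff finite_Int)
      have "card (y - A) = l - card (A \<inter> y)" using tval[of A] A by (simp add: of_nat_diff)
      then show "wt (card A) * g A = (\<lambda>A1 A2. if card A1 + card A2 = m then W m * (real m - real l) * \<phi> (l - card A1) else 0) (A \<inter> y) (A - y)"
        using A g[of A] unfolding sp by (auto simp: wt_def \<phi>_def)
    qed
    also have "\<dots> = (\<Sum>A1\<in>Pow y. \<Sum>A2\<in>Pow (U - y). if card A1 + card A2 = m then W m * (real m - real l) * \<phi> (l - card A1) else 0)"
      by (rule sum_Pow_split[OF yU])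
    also have "\<dots> = (\<Sum>A1\<in>Pow y. real ((n - l) choose (m - card A1)) * (W m * (real m - real l) * \<phi> (l - card A1)))"
    proof (intro sum.cong refl)
      fix A1 assume "A1 \<in> Pow y"
      then have A1: "card A1 \<le> l" using fy y(2) card_mono by auto
      have cU: "card (U - y) = n - l" using fy yU y(2) by (simp add: card_Diff_subset n_def)
      have "(\<Sum>A2\<in>Pow (U - y). if card A1 + card A2 = m then W m * (real m - real l) * \<phi> (l - card A1) else 0) =
         (\<Sum>j\<le>n - l. real ((n - l) choose j) * (if card A1 + j = m then W m * (real m - real l) * \<phi> (l - card A1) else 0))"
        using sum_Pow_card[of "U - y" "\<lambda>j. if card A1 + j = m then W m * (real m - real l) * \<phi> (l - card A1) else 0"] fin cU by simp
      also have "\<dots> = (\<Sum>j\<in>{m - card A1}. real ((n - l) choose j) * (if card A1 + j = m then W m * (real m - real l) * \<phi> (l - card A1) else 0))"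
        using A1 bounds by (intro sum.mono_neutral_right) (auto simp: n_def)
      finally show "(\<Sum>A2\<in>Pow (U - y). if card A1 + card A2 = m then W m * (real m - real l) * \<phi> (l - card A1) else 0) =
         real ((n - l) choose (m - card A1)) * (W m * (real m - real l) * \<phi> (l - card A1))"
        using A1 bounds by simp
    qed
    also have "\<dots> = (\<Sum>i\<le>l. real (l choose i) * (real ((n - l) choose (m - i)) * (W m * (real m - real l) * \<phi> (l - i))))"
      using sum_Pow_card[OF fy, of "\<lambda>i. real ((n - l) choose (m - i)) * (W m * (real m - real l) * \<phi> (l - i))"] y(2) by simp
    also have "\<dots> = (\<Sum>t\<le>l. W m * (real m - real l) * (hahn_weight n l m t * \<phi> t))"
    proof (rule sum.reindex_bij_witness[of _ "\<lambda>t. l - t" "\<lambda>i. l - i"])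
      fix i assume "i \<in> {..l}"
      then have "l choose (l - i) = l choose i" "m - l + (l - i) = m - i" using bounds binomial_symmetric[of i l] by auto
      then show "W m * (real m - real l) * (hahn_weight n l m (l - i) * \<phi> (l - i)) =
         real (l choose i) * (real ((n - l) choose (m - i)) * (W m * (real m - real l) * \<phi> (l - i)))"
        by (simp add: hahn_weight_def)
    qed auto
    also have "\<dots> = W m * (real m - real l) * (\<Sum>t\<le>l. hahn_weight n l m t * \<phi> t)" by (simp add: sum_distrib_left)
    finally have "(\<Sum>t\<le>l. hahn_weight n l m t * \<phi> t) = 0" using W_pos[of m] bounds by simp
    then show ?thesis by (simp add: \<phi>_def n_def P mult.assoc)
  qed
  then show ?thesis using Dl cardD by blast
qed

text \<open>The test function (card A - s) * f, with s the size of the other shell, removes that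
  shell, and its degree e + 1 is at most 2 * e. The weight of y is thus expressed by one shell mass
  and by f, whose choice depends on Y only.\<close>

lemma weight_from_delta:
  assumes y: "y \<in> Y" and f: "lowdeg U e f" "\<And>A. A \<in> Y \<Longrightarrow> f A = of_bool (A = y)"
  shows "\<omega> y = W (card y) * (\<Sum>A\<in>{A \<in> Pow U. card A = card y}. f A)"
proof -
  define s where "s = (if card y = l then m else l)"
  have s: "card y \<noteq> s" "s = l \<or> s = m" "card y = l \<or> card y = m" "{l, m} = {card y, s}"
    using sizes[OF y] bounds by (auto simp: s_def)
  have yU: "y \<subseteq> U" using y Y_sub by auto
  have "lowdeg U (1 + e) (\<lambda>A. (real (card (A \<inter> U)) - real s) * f A)"
    by (intro lowdeg_mult lowdeg_size f)
  then have "lowdeg U (2 * e) (\<lambda>A. (real (card (A \<inter> U)) - real s) * f A)"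
    by (rule lowdeg_le) (use bounds in simp)
  from quad[OF this] have "(\<Sum>A\<in>Pow U. wt (card A) * ((real (card (A \<inter> U)) - real s) * f A)) =
     (\<Sum>A\<in>Y. \<omega> A * (f A * (real (card (A \<inter> U)) - real s)))" by (simp add: mult.commute)
  also have "\<dots> = \<omega> y * (real (card (y \<inter> U)) - real s)" by (rule sum_delta[OF y f(2)])
  also have "y \<inter> U = y" using yU by auto
  also have "(\<Sum>A\<in>Pow U. wt (card A) * ((real (card (A \<inter> U)) - real s) * f A)) =
     (\<Sum>A\<in>{A \<in> Pow U. card A = card y}. W (card y) * ((real (card y) - real s) * f A))"
    using fin s by (intro sum.mono_neutral_cong_right) (auto simp: wt_def Int_absorb2)
  also have "\<dots> = (W (card y) * (\<Sum>A\<in>{A \<in> Pow U. card A = card y}. f A)) * (real (card y) - real s)"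
    by (simp add: sum_distrib_left sum_distrib_right ac_simps)
  finally show ?thesis using s(1) by simp
qed

text \<open>The test function f^2 sees both shells and so ties W l to W m. Nonvanishing of f on the
  other shell makes the relation solvable for W m.\<close>

lemma weight_ratio:
  assumes y: "y \<in> Y" "card y = l" and f: "lowdeg U e f" "\<And>A. A \<in> Y \<Longrightarrow> f A = of_bool (A = y)"
  shows "W l * ((\<Sum>A\<in>{A \<in> Pow U. card A = l}. f A) - (\<Sum>A\<in>{A \<in> Pow U. card A = l}. (f A)\<^sup>2)) =
     W m * (\<Sum>A\<in>{A \<in> Pow U. card A = m}. (f A)\<^sup>2)"
    and "(\<Sum>A\<in>{A \<in> Pow U. card A = m}. (f A)\<^sup>2) > 0"
proof -
  have "lowdeg U (2 * e) (\<lambda>A. f A * f A)" using lowdeg_mult[OF f(1) f(1)] by (simp add: mult_2)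
  from quad[OF this] have "(\<Sum>A\<in>Pow U. wt (card A) * (f A)\<^sup>2) = (\<Sum>A\<in>Y. \<omega> A * (f A * f A))" by (simp add: power2_eq_square)
  also have "\<dots> = \<omega> y * f y" by (rule sum_delta[OF y(1) f(2)])
  also have "f y = 1" using f(2)[OF y(1)] by simp
  also have "(\<Sum>A\<in>Pow U. wt (card A) * (f A)\<^sup>2) =
    (\<Sum>A\<in>{A \<in> Pow U. card A = l} \<union> {A \<in> Pow U. card A = m}. wt (card A) * (f A)\<^sup>2)"
    using fin by (intro sum.mono_neutral_right) (auto simp: wt_def)
  also have "\<dots> = (\<Sum>A\<in>{A \<in> Pow U. card A = l}. wt (card A) * (f A)\<^sup>2) + (\<Sum>A\<in>{A \<in> Pow U. card A = m}. wt (card A) * (f A)\<^sup>2)"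
    using fin bounds by (intro sum.union_disjoint) auto
  also have "\<dots> = W l * (\<Sum>A\<in>{A \<in> Pow U. card A = l}. (f A)\<^sup>2) + W m * (\<Sum>A\<in>{A \<in> Pow U. card A = m}. (f A)\<^sup>2)"
    by (simp add: sum_distrib_left wt_def)
  finally show "W l * ((\<Sum>A\<in>{A \<in> Pow U. card A = l}. f A) - (\<Sum>A\<in>{A \<in> Pow U. card A = l}. (f A)\<^sup>2)) =
     W m * (\<Sum>A\<in>{A \<in> Pow U. card A = m}. (f A)\<^sup>2)"
    using weight_from_delta[OF y(1) f] y(2) by (simp add: right_diff_distrib)
  obtain A where "A \<subseteq> U" "card A = m" "f A \<noteq> 0" using delta_nonzero_on_other_shell[OF y f] by blast
  then show "(\<Sum>A\<in>{A \<in> Pow U. card A = m}. (f A)\<^sup>2) > 0"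
    using fin by (intro sum_pos2[of _ A]) auto
qed

end

text \<open>The interpolating functions belong to Y alone, so both weights obey the same linear
  relations: the masses of the two shells have the same ratio, and each single weight is a shell
  mass times a common factor.\<close>

lemma tight_shell_design_unique:
  assumes "tight_shell_design U Y \<omega> l m e" "tight_shell_design U Y \<omega>' l m e"
  shows "\<exists>a>0. \<forall>A\<in>Y. \<omega>' A = a * \<omega> A"
proof -
  interpret d: tight_shell_design U Y \<omega> l m e by fact
  interpret d': tight_shell_design U Y \<omega>' l m e by fact
  obtain y where y: "y \<in> Y" "card y = l" using d.meets by auto
  obtain f where f: "lowdeg U e f" "\<And>A. A \<in> Y \<Longrightarrow> f A = of_bool (A = y)" using d.interpol[OF y(1)] by blast
  define \<alpha> where "\<alpha> = (\<Sum>A\<in>{A \<in> Pow U. card A = l}. f A) - (\<Sum>A\<in>{A \<in> Pow U. card A = l}. (f A)\<^sup>2)"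
  define \<gamma> where "\<gamma> = (\<Sum>A\<in>{A \<in> Pow U. card A = m}. (f A)\<^sup>2)"
  have 1: "d.W l * \<alpha> = d.W m * \<gamma>" "d'.W l * \<alpha> = d'.W m * \<gamma>" "\<gamma> > 0"
    unfolding \<alpha>_def \<gamma>_def
    by (rule d.weight_ratio(1)[OF y f], simp, rule d'.weight_ratio(1)[OF y f], simp, rule d.weight_ratio(2)[OF y f], simp)
  define a where "a = d'.W l / d.W l"
  have Wp: "d.W l > 0" "d'.W l > 0" using d.W_pos d'.W_pos by auto
  have al: "d'.W l = a * d.W l" using Wp by (simp add: a_def)
  have "d'.W m * \<gamma> = a * d.W m * \<gamma>" using 1 al by (metis mult.assoc)
  then have am: "d'.W m = a * d.W m" using 1 by simp
  have "\<omega>' z = a * \<omega> z" if z: "z \<in> Y" for z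
  proof -
    obtain g where g: "lowdeg U e g" "\<And>A. A \<in> Y \<Longrightarrow> g A = of_bool (A = z)" using d.interpol[OF z] by blast
    show ?thesis using d.weight_from_delta[OF z g] d'.weight_from_delta[OF z g] al am d.sizes[OF z] by auto
  qed
  then show ?thesis using Wp by (intro exI[of _ a]) (auto simp: a_def)
qed

section \<open>Fourier analysis on the cube\<close>

definition flips :: "vertex \<Rightarrow> vertex \<Rightarrow> nat set" where
  "flips x y = {i. i < length x \<and> x ! i \<noteq> y ! i}"

definition unflip :: "vertex \<Rightarrow> nat set \<Rightarrow> vertex" where
  "unflip x A = map (\<lambda>i. (x ! i) \<noteq> (i \<in> A)) [0..<length x]"

lemma length_unflip [simp]: "length (unflip x A) = length x"
  by (simp add: unflip_def)

lemma unflip_flips: "length y = length x \<Longrightarrow> unflip x (flips x y) = y"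
  by (auto simp: unflip_def flips_def intro!: nth_equalityI)

lemma flips_unflip: "A \<subseteq> {..<length x} \<Longrightarrow> flips x (unflip x A) = A"
  by (auto simp: unflip_def flips_def)

lemma hdist_eq_card_flips: "hdist x y = card (flips x y)"
  by (simp add: hdist_def flips_def)

lemma flips_subset: "x \<in> cube n \<Longrightarrow> flips x y \<subseteq> {..<n}"
  by (auto simp: cube_def flips_def)

lemma bij_betw_flips: "x \<in> cube n \<Longrightarrow> bij_betw (flips x) (cube n) (Pow {..<n})"
  by (rule bij_betw_byWitness[of _ "unflip x"])
    (use flips_subset[of x n] in \<open>auto simp: unflip_flips flips_unflip cube_def\<close>)

lemma inj_on_flips: "x \<in> cube n \<Longrightarrow> inj_on (flips x) (cube n)"
  using bij_betw_flips bij_betw_imp_inj_on by blast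

lemma finite_cube: "finite (cube n)"
  using finite_lists_length_eq[of "UNIV :: bool set" n] by (simp add: cube_def)

lemma hdist_flips:
  assumes "x \<in> cube n" "y \<in> cube n" "z \<in> cube n"
  shows "hdist y z = card ((flips x y - flips x z) \<union> (flips x z - flips x y))"
  unfolding hdist_eq_card_flips
  by (rule arg_cong[of _ _ card]) (use assms in \<open>auto simp: flips_def cube_def\<close>)

section \<open>Walsh characters\<close>

definition walsh :: "nat set \<Rightarrow> nat set \<Rightarrow> real" where
  "walsh S A = (- 1) ^ card (S \<inter> A)"

lemma walsh_commute: "walsh S A = walsh A S"
  by (simp add: walsh_def Int_commute)

lemma walsh_empty [simp]: "walsh S {} = 1" "walsh {} A = 1"
  by (simp_all add: walsh_def)

lemma walsh_prod: "finite S \<Longrightarrow> walsh S A = (\<Prod>i\<in>S. if i \<in> A then - 1 else 1)"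
  by (simp add: walsh_def prod.If_cases Int_def)

lemma sum_walsh_Pow:
  assumes "finite U"
  shows "(\<Sum>S\<in>Pow U. \<Prod>i\<in>S. g i) = (\<Prod>i\<in>U. 1 + g i :: real)"
  using prod_add[OF assms, of g "\<lambda>_. 1"] by (simp add: add.commute)

lemma walsh_orthogonal:
  assumes "finite U" "A \<subseteq> U" "B \<subseteq> U"
  shows "(\<Sum>S\<in>Pow U. walsh S A * walsh S B) = (if A = B then 2 ^ card U else 0)"
proof -
  have "(\<Sum>S\<in>Pow U. walsh S A * walsh S B) = (\<Sum>S\<in>Pow U. \<Prod>i\<in>S. (if i \<in> A then - 1 else 1) * (if i \<in> B then - 1 else 1))"
    using finite_subset[OF _ assms(1)] by (intro sum.cong refl) (simp add: walsh_prod prod.distrib)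
  also have "\<dots> = (\<Prod>i\<in>U. 1 + (if i \<in> A then - 1 else 1) * (if i \<in> B then - 1 else 1))"
    by (rule sum_walsh_Pow[OF assms(1)])
  also have "\<dots> = (if A = B then 2 ^ card U else 0)"
  proof (cases "A = B")
    case True
    then have "(\<Prod>i\<in>U. 1 + (if i \<in> A then - 1 else 1) * (if i \<in> B then - 1 else 1)) = (\<Prod>i\<in>U. 2 :: real)"
      by (intro prod.cong) auto
    then show ?thesis using True by simp
  next
    case False
    then obtain i where "i \<in> U" "(i \<in> A) \<noteq> (i \<in> B)" using assms by blast
    then have "(\<Prod>i\<in>U. 1 + (if i \<in> A then - 1 else 1) * (if i \<in> B then - 1 else 1)) = (0 :: real)"
      using assms(1) by (intro prod_zero) (auto intro!: bexI[of _ i])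
    then show ?thesis using False by simp
  qed
  finally show ?thesis .
qed

text \<open>Expansion of the product over i \<in> T of (1 - \<chi> i) / 2, where \<chi> i is the
  character of {i} and equals -1 exactly on sets containing i.\<close>

lemma walsh_indicator:
  assumes "finite T"
  shows "of_bool (T \<subseteq> A) = (\<Sum>S\<in>Pow T. (- 1) ^ card S * walsh S A) / 2 ^ card T"
proof -
  have "(\<Sum>S\<in>Pow T. (- 1) ^ card S * walsh S A) = (\<Sum>S\<in>Pow T. \<Prod>i\<in>S. (if i \<in> A then 1 else - 1))"
  proof (intro sum.cong refl)
    fix S assume "S \<in> Pow T"
    then have "finite S" using assms finite_subset by auto
    then have "(- 1) ^ card S * walsh S A = (\<Prod>i\<in>S. (- 1) * (if i \<in> A then - 1 else 1))"
      unfolding prod.distrib walsh_prod[OF \<open>finite S\<close>] by simp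
    also have "\<dots> = (\<Prod>i\<in>S. (if i \<in> A then 1 else - 1))" by (intro prod.cong) auto
    finally show "(- 1) ^ card S * walsh S A = (\<Prod>i\<in>S. (if i \<in> A then 1 else - 1))" .
  qed
  also have "\<dots> = (\<Prod>i\<in>T. 1 + (if i \<in> A then 1 else - 1))" by (rule sum_walsh_Pow[OF assms])
  also have "\<dots> = of_bool (T \<subseteq> A) * 2 ^ card T"
  proof (cases "T \<subseteq> A")
    case True
    then have "(\<Prod>i\<in>T. 1 + (if i \<in> A then 1 else - 1)) = (\<Prod>i\<in>T. 2 :: real)" by (intro prod.cong) auto
    then show ?thesis using True by simp
  next
    case False
    then have "(\<Prod>i\<in>T. 1 + (if i \<in> A then 1 else - 1)) = (0 :: real)"
      using assms by (intro prod_zero) auto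
    then show ?thesis using False by simp
  qed
  finally show ?thesis by simp
qed

lemma lowdeg_walsh:
  assumes "finite S" "S \<subseteq> U"
  shows "lowdeg U (card S) (walsh S)"
  using assms
proof (induction S)
  case empty
  have "walsh {} = (\<lambda>_. 1)" by (simp add: fun_eq_iff)
  then show ?case using lowdeg_const by simp
next
  case (insert i S)
  have "lowdeg U 1 (\<lambda>A. 1 - 2 * of_bool ({i} \<subseteq> A))"
    using insert.prems by (intro lowdeg_diff lowdeg_const lowdeg.scale lowdeg.mono) auto
  then have "lowdeg U (1 + card S) (\<lambda>A. (1 - 2 * of_bool ({i} \<subseteq> A)) * walsh S A)"
    by (rule lowdeg_mult) (use insert in auto)
  moreover have "(1 - 2 * of_bool ({i} \<subseteq> A)) * walsh S A = walsh (insert i S) A" for A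
    using insert.hyps by (simp add: walsh_prod)
  ultimately show ?case using insert.hyps by simp
qed

text \<open>Centring the characters at the base vertex \<open>x\<close> gives them all the value \<open>1\<close> at \<open>x\<close>, so the
  Fourier coefficients of the characteristic vector of \<open>x\<close> are all equal.\<close>

definition chr :: "vertex \<Rightarrow> nat set \<Rightarrow> vertex \<Rightarrow> complex" where
  "chr x S y = of_real (walsh S (flips x y))"

definition fcoeff :: "nat \<Rightarrow> vertex \<Rightarrow> nat set \<Rightarrow> cvec \<Rightarrow> complex" where
  "fcoeff n x S v = (\<Sum>y\<in>cube n. v y * chr x S y)"

section \<open>Fourier coefficients and the projections onto the eigenspaces\<close>

context
  fixes n :: nat and x :: vertex
  assumes x: "x \<in> cube n"
begin

lemma sum_cube_flips: "(\<Sum>y\<in>cube n. g (flips x y)) = (\<Sum>A\<in>Pow {..<n}. g A)"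
  using sum.reindex_bij_betw[OF bij_betw_flips[OF x]] .

lemma chr_orthogonal_index:
  assumes "y \<in> cube n" "z \<in> cube n"
  shows "(\<Sum>S\<in>Pow {..<n}. chr x S y * chr x S z) = (if y = z then 2 ^ n else 0)"
proof -
  have "(\<Sum>S\<in>Pow {..<n}. chr x S y * chr x S z) = of_real (\<Sum>S\<in>Pow {..<n}. walsh S (flips x y) * walsh S (flips x z))"
    by (simp add: chr_def)
  then show ?thesis
    using inj_on_flips[OF x] assms walsh_orthogonal[OF _ flips_subset[OF x] flips_subset[OF x], of y z]
    by (auto simp: inj_on_eq_iff)
qed

lemma chr_orthogonal:
  assumes "S \<subseteq> {..<n}" "T \<subseteq> {..<n}"
  shows "(\<Sum>y\<in>cube n. chr x S y * chr x T y) = (if S = T then 2 ^ n else 0)"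
proof -
  have "(\<Sum>y\<in>cube n. chr x S y * chr x T y) = of_real (\<Sum>A\<in>Pow {..<n}. walsh A S * walsh A T)"
    unfolding chr_def walsh_commute[of S] walsh_commute[of T]
    using sum_cube_flips[of "\<lambda>A. walsh A S * walsh A T"] by (simp add: of_real_mult[symmetric] of_real_sum[symmetric] del: of_real_mult of_real_sum)
  then show ?thesis using walsh_orthogonal[of "{..<n}" S T] assms by auto
qed

lemma fourier_inversion:
  assumes "y \<in> cube n"
  shows "v y = (\<Sum>S\<in>Pow {..<n}. fcoeff n x S v * chr x S y) / 2 ^ n"
proof -
  have "(\<Sum>S\<in>Pow {..<n}. fcoeff n x S v * chr x S y) = (\<Sum>z\<in>cube n. v z * (\<Sum>S\<in>Pow {..<n}. chr x S z * chr x S y))"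
    unfolding fcoeff_def sum_distrib_left sum_distrib_right by (subst sum.swap) (simp only: mult.assoc)
  also have "\<dots> = (\<Sum>z\<in>cube n. if z = y then v y * 2 ^ n else 0)"
    using chr_orthogonal_index assms by (intro sum.cong refl) auto
  also have "\<dots> = v y * 2 ^ n" using finite_cube assms by simp
  finally show ?thesis by simp
qed

text \<open>Neighbours of y arise by toggling one coordinate i, which changes the sign of the
  character exactly when i \<in> S; this happens for card S of the n coordinates.\<close>

lemma A1_chr:
  assumes "S \<subseteq> {..<n}" "y \<in> cube n"
  shows "(\<Sum>z\<in>cube n. A1 y z * chr x S z) = (of_nat n - 2 * of_nat (card S)) * chr x S y"
proof -
  let ?A = "flips x y"
  let ?f = "\<lambda>i. if i \<in> ?A then ?A - {i} else insert i ?A"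
  have fS: "finite S" using assms finite_subset by blast
  have "(\<Sum>z\<in>cube n. A1 y z * chr x S z) = of_real (\<Sum>z\<in>cube n. of_bool (card ((?A - flips x z) \<union> (flips x z - ?A)) = 1) * walsh S (flips x z))"
    unfolding of_real_sum by (intro sum.cong refl) (simp add: A1_def chr_def hdist_flips[OF x assms(2)])
  also have "(\<Sum>z\<in>cube n. of_bool (card ((?A - flips x z) \<union> (flips x z - ?A)) = 1) * walsh S (flips x z)) =
     (\<Sum>B\<in>Pow {..<n}. of_bool (card ((?A - B) \<union> (B - ?A)) = 1) * walsh S B)"
    by (rule sum_cube_flips)
  also have "\<dots> = (\<Sum>B\<in>?f ` {..<n}. walsh S B)"
  proof (rule sum.mono_neutral_cong_right)
    have one: "card ((?A - ?f i) \<union> (?f i - ?A)) = 1" for i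
    proof -
      have "(?A - ?f i) \<union> (?f i - ?A) = {i}" by auto
      then show ?thesis by simp
    qed
    show "?f ` {..<n} \<subseteq> Pow {..<n}" using flips_subset[OF x, of y] by auto
    show "of_bool (card ((?A - B) \<union> (B - ?A)) = 1) * walsh S B = walsh S B" if "B \<in> ?f ` {..<n}" for B
    proof -
      from that obtain i where "B = ?f i" by (rule imageE)
      then have "card ((?A - B) \<union> (B - ?A)) = 1" using one[of i] by (simp only:)
      then show ?thesis by simp
    qed
    show "\<forall>B\<in>Pow {..<n} - ?f ` {..<n}. of_bool (card ((?A - B) \<union> (B - ?A)) = 1) * walsh S B = 0"
    proof
      fix B assume B: "B \<in> Pow {..<n} - ?f ` {..<n}"
      have "card ((?A - B) \<union> (B - ?A)) \<noteq> 1"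
      proof
        assume "card ((?A - B) \<union> (B - ?A)) = 1"
        then obtain i where i: "(?A - B) \<union> (B - ?A) = {i}" by (auto simp: card_1_singleton_iff)
        then have mem: "(j \<in> ?A) \<noteq> (j \<in> B) \<longleftrightarrow> j = i" for j by blast
        have "B = ?f i"
        proof (rule set_eqI)
          fix j show "j \<in> B \<longleftrightarrow> j \<in> ?f i" using mem[of j] mem[of i] by (cases "i \<in> ?A"; cases "j = i") simp_all
        qed
        moreover have "i < n" using i B flips_subset[OF x, of y] by auto
        ultimately show False using B by blast
      qed
      then show "of_bool (card ((?A - B) \<union> (B - ?A)) = 1) * walsh S B = 0" by simp
    qed
  qed simp
  also have "\<dots> = (\<Sum>i<n. walsh S (?f i))"
  proof (subst sum.reindex)
    have mem: "b \<in> ?f a \<longleftrightarrow> (if b = a then b \<notin> ?A else b \<in> ?A)" for a b by simp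
    show "inj_on ?f {..<n}"
    proof (rule inj_onI)
      fix a b assume "?f a = ?f b"
      then have "a \<in> ?f a \<longleftrightarrow> a \<in> ?f b" by (simp only:)
      then show "a = b" unfolding mem by (simp split: if_splits)
    qed
  qed simp
  also have "\<dots> = (\<Sum>i<n. (if i \<in> S then - 1 else 1) * walsh S ?A)"
  proof (intro sum.cong refl)
    fix i
    show "walsh S (?f i) = (if i \<in> S then - 1 else 1) * walsh S ?A"
    proof (cases "i \<in> S")
      case True
      have "walsh S B = (if i \<in> B then - 1 else 1) * (\<Prod>j\<in>S - {i}. if j \<in> B then - 1 else 1)" for B
        unfolding walsh_prod[OF fS] by (rule prod.remove[OF fS True])
      moreover have "(\<Prod>j\<in>S - {i}. if j \<in> ?f i then - 1 else 1) = (\<Prod>j\<in>S - {i}. if j \<in> ?A then - 1 else (1::real))"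
        by (intro prod.cong) auto
      ultimately have "walsh S (?f i) = (if i \<in> ?f i then - 1 else 1) * ((if i \<in> ?A then - 1 else 1) * walsh S ?A)"
        by (simp only: mult.assoc[symmetric]) simp
      then show ?thesis using True by simp
    next
      case False
      then have "walsh S (?f i) = walsh S ?A" unfolding walsh_prod[OF fS] by (intro prod.cong) auto
      then show ?thesis using False by simp
    qed
  qed
  also have "\<dots> = (\<Sum>i<n. if i \<in> S then - 1 else 1) * walsh S ?A" by (simp add: sum_distrib_right)
  also have "(\<Sum>i<n. if i \<in> S then - 1 else 1) = real n - 2 * real (card S)"
  proof -
    have "(\<Sum>i<n. if i \<in> S then - 1 else 1) = (\<Sum>i<n. 1 - 2 * of_bool (i \<in> S) :: real)"
      by (intro sum.cong) auto
    also have "\<dots> = real n - 2 * (\<Sum>i<n. of_bool (i \<in> S))" by (simp add: sum_subtractf sum_distrib_left del: sum_of_bool_eq)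
    also have "(\<Sum>i<n. of_bool (i \<in> S)) = real (card S)" using assms(1) by (simp add: Int_absorb1)
    finally show ?thesis .
  qed
  finally show ?thesis by (simp add: chr_def)
qed

lemma A1_sym: "y \<in> cube n \<Longrightarrow> z \<in> cube n \<Longrightarrow> A1 y z = A1 z y"
  using hdist_flips[OF x, of y z] hdist_flips[OF x, of z y] by (simp add: A1_def Un_commute)

lemma fcoeff_A1:
  assumes "S \<subseteq> {..<n}"
  shows "fcoeff n x S (mat_app n A1 v) = (of_nat n - 2 * of_nat (card S)) * fcoeff n x S v"
proof -
  have "fcoeff n x S (mat_app n A1 v) = (\<Sum>y\<in>cube n. \<Sum>z\<in>cube n. A1 y z * v z * chr x S y)"
    by (simp add: fcoeff_def mat_app_def sum_distrib_right)
  also have "\<dots> = (\<Sum>z\<in>cube n. v z * (\<Sum>y\<in>cube n. A1 z y * chr x S y))"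
    unfolding sum_distrib_left by (subst sum.swap, intro sum.cong refl) (simp add: A1_sym ac_simps)
  also have "\<dots> = (\<Sum>z\<in>cube n. v z * ((of_nat n - 2 * of_nat (card S)) * chr x S z))"
    using A1_chr[OF assms] by simp
  finally show ?thesis by (simp add: fcoeff_def sum_distrib_left ac_simps)
qed

lemma eigsp_fcoeff:
  assumes "v \<in> eigsp n i" "S \<subseteq> {..<n}" "card S \<noteq> i"
  shows "fcoeff n x S v = 0"
proof -
  have "fcoeff n x S (mat_app n A1 v) = (of_nat n - 2 * of_nat i) * fcoeff n x S v"
    using assms(1) by (simp add: eigsp_def fcoeff_def cscale_def sum_distrib_left ac_simps)
  then have "fcoeff n x S v = 0 \<or> of_nat n - 2 * of_nat (card S) = (of_nat n - 2 * of_nat i :: complex)"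
    unfolding fcoeff_A1[OF assms(2)] by (metis mult_right_cancel)
  then show ?thesis using assms(3) by auto
qed

definition eigproj :: "nat \<Rightarrow> cvec \<Rightarrow> cvec" where
  "eigproj i v y = (if y \<in> cube n then (\<Sum>S\<in>{S \<in> Pow {..<n}. card S = i}. fcoeff n x S v * chr x S y) / 2 ^ n else 0)"

lemma eigproj_in: "eigproj i v \<in> eigsp n i"
proof -
  have "mat_app n A1 (eigproj i v) y = cscale (of_nat n - 2 * of_nat i) (eigproj i v) y" for y
  proof (cases "y \<in> cube n")
    case True
    have "mat_app n A1 (eigproj i v) y = (\<Sum>z\<in>cube n. \<Sum>S\<in>{S \<in> Pow {..<n}. card S = i}. fcoeff n x S v * (A1 y z * chr x S z) / 2 ^ n)"
      using True by (simp add: mat_app_def eigproj_def sum_distrib_left sum_divide_distrib ac_simps)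
    also have "\<dots> = (\<Sum>S\<in>{S \<in> Pow {..<n}. card S = i}. fcoeff n x S v * (\<Sum>z\<in>cube n. A1 y z * chr x S z) / 2 ^ n)"
      by (subst sum.swap) (simp add: sum_distrib_left sum_divide_distrib)
    also have "\<dots> = (\<Sum>S\<in>{S \<in> Pow {..<n}. card S = i}. (of_nat n - 2 * of_nat i) * (fcoeff n x S v * chr x S y / 2 ^ n))"
      using True by (intro sum.cong refl) (simp add: A1_chr)
    finally show ?thesis using True by (simp add: cscale_def eigproj_def sum_distrib_left sum_divide_distrib)
  qed (simp add: mat_app_def cscale_def eigproj_def)
  then show ?thesis by (auto simp: eigsp_def vecs_def eigproj_def)
qed

lemma fcoeff_eigproj:
  assumes "S \<subseteq> {..<n}"
  shows "fcoeff n x S (eigproj i v) = (if card S = i then fcoeff n x S v else 0)"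
proof -
  have "fcoeff n x S (eigproj i v) = (\<Sum>y\<in>cube n. \<Sum>T\<in>{T \<in> Pow {..<n}. card T = i}. fcoeff n x T v * (chr x T y * chr x S y) / 2 ^ n)"
    unfolding fcoeff_def[of n x S]
    by (intro sum.cong refl) (simp add: eigproj_def sum_distrib_right sum_distrib_left sum_divide_distrib ac_simps)
  also have "\<dots> = (\<Sum>T\<in>{T \<in> Pow {..<n}. card T = i}. fcoeff n x T v * (\<Sum>y\<in>cube n. chr x T y * chr x S y) / 2 ^ n)"
    by (subst sum.swap) (simp add: sum_distrib_left sum_divide_distrib)
  also have "\<dots> = (\<Sum>T\<in>{T \<in> Pow {..<n}. card T = i}. if T = S then fcoeff n x S v else 0)"
    using assms by (intro sum.cong refl) (auto simp: chr_orthogonal)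
  finally show ?thesis using assms by simp
qed

lemma herm_fourier: "herm n u w = (\<Sum>S\<in>Pow {..<n}. fcoeff n x S u * cnj (fcoeff n x S w)) / 2 ^ n"
proof -
  have cnj_chr: "cnj (chr x S y) = chr x S y" for S y by (simp add: chr_def)
  have "herm n u w = (\<Sum>y\<in>cube n. \<Sum>S\<in>Pow {..<n}. u y * (cnj (fcoeff n x S w) * chr x S y) / 2 ^ n)"
    unfolding herm_def
  proof (intro sum.cong refl)
    fix y assume "y \<in> cube n"
    then have "cnj (w y) = cnj ((\<Sum>S\<in>Pow {..<n}. fcoeff n x S w * chr x S y) / 2 ^ n)" using fourier_inversion by simp
    then show "u y * cnj (w y) = (\<Sum>S\<in>Pow {..<n}. u y * (cnj (fcoeff n x S w) * chr x S y) / 2 ^ n)"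
      by (simp add: cnj_chr sum_distrib_left sum_divide_distrib)
  qed
  also have "\<dots> = (\<Sum>S\<in>Pow {..<n}. \<Sum>y\<in>cube n. u y * (cnj (fcoeff n x S w) * chr x S y) / 2 ^ n)"
    by (rule sum.swap)
  finally show ?thesis
    unfolding fcoeff_def[of n x _ u] by (simp add: sum_distrib_left sum_distrib_right sum_divide_distrib ac_simps)
qed

lemma fcoeff_diff: "fcoeff n x S (u - v) = fcoeff n x S u - fcoeff n x S v"
  by (simp add: fcoeff_def left_diff_distrib sum_subtractf)

text \<open>\<open>THE\<close> requires existence and uniqueness of the decomposition. In Fourier
  coordinates an eigenvector has coefficients of order i only, so the residual is orthogonal to it;
  conversely, testing a candidate against each single character of order i fixes all its
  coefficients.\<close>

lemma E_eq_eigproj: "E n i v = eigproj i v"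
  unfolding E_def orth_proj_def
proof (rule the_equality)
  have orth: "herm n (v - eigproj i v) w = 0" if w: "w \<in> eigsp n i" for w
    unfolding herm_fourier
    using eigsp_fcoeff[OF w] by (simp add: fcoeff_diff fcoeff_eigproj) (auto intro!: sum.neutral simp: fcoeff_diff fcoeff_eigproj)
  then show "eigproj i v \<in> eigsp n i \<and> (\<forall>w\<in>eigsp n i. herm n (v - eigproj i v) w = 0)"
    using eigproj_in by blast
  fix u assume u: "u \<in> eigsp n i \<and> (\<forall>w\<in>eigsp n i. herm n (v - u) w = 0)"
  have eq: "fcoeff n x S u = fcoeff n x S (eigproj i v)" if S: "S \<subseteq> {..<n}" for S
  proof (cases "card S = i")
    case True
    define w where "w = (\<lambda>y. if y \<in> cube n then chr x S y else 0)"
    have wS: "fcoeff n x T w = (if T = S then 2 ^ n else 0)" if "T \<subseteq> {..<n}" for T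
      using chr_orthogonal[OF S that] by (auto simp: fcoeff_def w_def)
    have "w = eigproj i w"
    proof
      fix y show "w y = eigproj i w y"
      proof (cases "y \<in> cube n")
        case True
        have "(\<Sum>T\<in>{T \<in> Pow {..<n}. card T = i}. fcoeff n x T w * chr x T y) = (\<Sum>T\<in>{T \<in> Pow {..<n}. card T = i}. if T = S then 2 ^ n * chr x S y else 0)"
          by (intro sum.cong refl) (auto simp: wS)
        then show ?thesis using True S \<open>card S = i\<close> by (simp add: eigproj_def w_def)
      qed (simp add: w_def eigproj_def)
    qed
    then have "w \<in> eigsp n i" using eigproj_in by metis
    then have "herm n (v - u) w = 0" using u by blast
    moreover have "herm n (v - u) w = (\<Sum>T\<in>Pow {..<n}. if T = S then fcoeff n x S (v - u) * 2 ^ n else 0) / 2 ^ n"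
      unfolding herm_fourier by (intro arg_cong2[of _ _ _ _ "(/)"] sum.cong refl) (auto simp: wS)
    ultimately have "fcoeff n x S (v - u) = 0" using S by simp
    then show ?thesis using S True by (simp add: fcoeff_diff fcoeff_eigproj)
  next
    case False
    then show ?thesis using eigsp_fcoeff[of u i S] u S by (simp add: fcoeff_eigproj)
  qed
  show "u = eigproj i v"
  proof
    fix y show "u y = eigproj i v y"
    proof (cases "y \<in> cube n")
      case True
      show ?thesis
        unfolding fourier_inversion[OF True, of u] fourier_inversion[OF True, of "eigproj i v"] using eq by simp
    next
      case False
      then show ?thesis using u by (simp add: eigsp_def vecs_def eigproj_def)
    qed
  qed
qed

end

section \<open>Relative designs as balanced set systems\<close>

lemma flips_self [simp]: "flips x x = {}"
  by (simp add: flips_def)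

text \<open>Every coefficient of the characteristic vector of x is 1, so if the component of order i
  is a multiple of that of x, all coefficients of order i equal the multiplier.\<close>

lemma design_fourier:
  assumes x: "x \<in> cube n" and design: "relative_design n x t Y \<omega>"
  shows "\<exists>a. \<forall>S\<subseteq>{..<n}. card S \<le> t \<longrightarrow> (\<Sum>y\<in>cube n. \<omega> y * walsh S (flips x y)) = a (card S)"
proof -
  let ?w = "\<lambda>y. complex_of_real (\<omega> y)"
  have "\<exists>k. E n i ?w = cscale k (E n i (char_vec x))" if "i \<in> {1..t}" for i
    using design that unfolding relative_design_def cvec.span_singleton by blast
  then obtain k where k: "\<And>i. i \<in> {1..t} \<Longrightarrow> E n i ?w = cscale (k i) (E n i (char_vec x))" by metis
  \<comment> \<open>Order 0 lies outside {1..t}; its only index set is the empty one, so the total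
    weight serves as the value.\<close>
  define a where "a i = (if i = 0 then \<Sum>y\<in>cube n. \<omega> y else Re (k i))" for i
  have "(\<Sum>y\<in>cube n. \<omega> y * walsh S (flips x y)) = a (card S)" if S: "S \<subseteq> {..<n}" "card S \<le> t" for S
  proof (cases "card S = 0")
    case True
    then have "S = {}" using finite_subset[OF S(1)] by simp
    then show ?thesis by (simp add: a_def)
  next
    case False
    have "fcoeff n x S ?w = fcoeff n x S (E n (card S) ?w)"
      unfolding E_eq_eigproj[OF x] using fcoeff_eigproj[OF x S(1)] by simp
    also have "\<dots> = k (card S) * fcoeff n x S (E n (card S) (char_vec x))"
      using k[of "card S"] S False by (simp add: fcoeff_def cscale_def sum_distrib_left mult.assoc)
    also have "fcoeff n x S (E n (card S) (char_vec x)) = fcoeff n x S (char_vec x)"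
      unfolding E_eq_eigproj[OF x] using fcoeff_eigproj[OF x S(1)] by simp
    also have "\<dots> = (\<Sum>y\<in>cube n. if y = x then 1 else 0)"
      unfolding fcoeff_def by (intro sum.cong refl) (auto simp: char_vec_def chr_def)
    also have "\<dots> = 1" using x finite_cube by simp
    finally have "complex_of_real (\<Sum>y\<in>cube n. \<omega> y * walsh S (flips x y)) = k (card S)"
      by (simp add: fcoeff_def chr_def)
    then show ?thesis using False by (metis Re_complex_of_real a_def)
  qed
  then show ?thesis by blast
qed

text \<open>The indicator of T \<subseteq> A is a signed sum of the characters indexed by subsets of
  T, and the number of these of each size depends only on card T.\<close>

lemma design_balanced:
  assumes x: "x \<in> cube n" and design: "relative_design n x t Y \<omega>"
  shows "\<exists>lam. \<forall>T\<subseteq>{..<n}. card T \<le> t \<longrightarrow> (\<Sum>y\<in>Y. \<omega> y * of_bool (T \<subseteq> flips x y)) = lam (card T)"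
proof -
  obtain a where a: "\<And>S. S \<subseteq> {..<n} \<Longrightarrow> card S \<le> t \<Longrightarrow> (\<Sum>y\<in>cube n. \<omega> y * walsh S (flips x y)) = a (card S)"
    using design_fourier[OF assms] by blast
  have Y: "Y = {y \<in> cube n. \<omega> y > 0}" "\<And>y. y \<in> cube n \<Longrightarrow> \<omega> y \<ge> 0"
    using design by (auto simp: relative_design_def weighted_subset_def)
  have "(\<Sum>y\<in>Y. \<omega> y * of_bool (T \<subseteq> flips x y)) =
     (\<Sum>j\<le>card T. real (card T choose j) * ((- 1) ^ j * a j)) / 2 ^ card T" if T: "T \<subseteq> {..<n}" "card T \<le> t" for T
  proof -
    have fT: "finite T" using T finite_subset by auto
    have "(\<Sum>y\<in>Y. \<omega> y * of_bool (T \<subseteq> flips x y)) = (\<Sum>y\<in>cube n. \<omega> y * of_bool (T \<subseteq> flips x y))"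
      by (rule sum.mono_neutral_left) (use Y finite_cube in force)+
    also have "\<dots> = (\<Sum>y\<in>cube n. \<Sum>S\<in>Pow T. (- 1) ^ card S * (\<omega> y * walsh S (flips x y)) / 2 ^ card T)"
      by (simp add: walsh_indicator[OF fT] sum_distrib_left sum_divide_distrib ac_simps)
    also have "\<dots> = (\<Sum>S\<in>Pow T. (- 1) ^ card S * (\<Sum>y\<in>cube n. \<omega> y * walsh S (flips x y)) / 2 ^ card T)"
      by (subst sum.swap) (simp add: sum_distrib_left sum_divide_distrib)
    also have "\<dots> = (\<Sum>S\<in>Pow T. (- 1) ^ card S * a (card S)) / 2 ^ card T"
    proof -
      have "(\<Sum>y\<in>cube n. \<omega> y * walsh S (flips x y)) = a (card S)" if "S \<in> Pow T" for S
        using that T card_mono[OF fT, of S] by (intro a) auto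
      then show ?thesis by (simp add: sum_divide_distrib)
    qed
    finally show ?thesis using sum_Pow_card[OF fT, of "\<lambda>j. (- 1) ^ j * a j"] by simp
  qed
  then show ?thesis by (intro exI[of _ "\<lambda>i. (\<Sum>j\<le>i. real (i choose j) * ((- 1) ^ j * a j)) / 2 ^ i"]) blast
qed

lemma shell_design_of_relative_design:
  assumes x: "x \<in> cube n" and design: "relative_design n x (2 * e) Y \<omega>" and supp: "supported_on_shells n x l m Y"
    and bounds: "1 \<le> e" "e \<le> l" "l < m" "m \<le> n - l"
  shows "shell_design {..<n} (flips x ` Y) (\<lambda>A. \<omega> (unflip x A)) l m e"
proof
  have Y: "Y = {y \<in> cube n. \<omega> y > 0}"
    using design by (auto simp: relative_design_def weighted_subset_def)
  have un: "unflip x (flips x y) = y" if "y \<in> cube n" for y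
    using that x by (intro unflip_flips) (simp add: cube_def)
  have inj: "inj_on (flips x) Y" using inj_on_flips[OF x] Y by (auto intro: inj_on_subset)
  show "flips x ` Y \<subseteq> Pow {..<n}" using flips_subset[OF x] by auto
  show "\<omega> (unflip x A) > 0" if "A \<in> flips x ` Y" for A using that un Y by auto
  show "card A = l \<or> card A = m" if "A \<in> flips x ` Y" for A
    using that supp by (auto simp: supported_on_shells_def shell_def hdist_eq_card_flips)
  show "\<exists>A\<in>flips x ` Y. card A = l" "\<exists>A\<in>flips x ` Y. card A = m"
    using supp by (auto simp: supported_on_shells_def shell_def hdist_eq_card_flips)
  show "m \<le> card {..<n} - l" using bounds by simp
  obtain lam where lam: "\<And>T. T \<subseteq> {..<n} \<Longrightarrow> card T \<le> 2 * e \<Longrightarrow> (\<Sum>y\<in>Y. \<omega> y * of_bool (T \<subseteq> flips x y)) = lam (card T)"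
    using design_balanced[OF x design] by blast
  have "(\<Sum>A\<in>flips x ` Y. \<omega> (unflip x A) * of_bool (T \<subseteq> A)) = (\<Sum>y\<in>Y. \<omega> y * of_bool (T \<subseteq> flips x y))" for T
    unfolding sum.reindex[OF inj] o_def by (intro sum.cong refl) (use un Y in auto)
  then show "\<exists>lam. \<forall>T\<subseteq>{..<n}. card T \<le> 2 * e \<longrightarrow> (\<Sum>A\<in>flips x ` Y. \<omega> (unflip x A) * of_bool (T \<subseteq> A)) = lam (card T)"
    using lam by auto
qed (use bounds in auto)

section \<open>Tightness as interpolation on the support\<close>

lemma sum_eigenspaces_walsh:
  assumes x: "x \<in> cube n" and "v \<in> (\<Sum>i\<le>e. E n i ` vecs n)"
  shows "\<exists>c. (\<forall>S. card S > e \<longrightarrow> c S = 0) \<and> (\<forall>y\<in>cube n. v y = (\<Sum>S\<in>Pow {..<n}. c S * chr x S y))"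
proof -
  have single: "\<exists>c. (\<forall>S. card S \<noteq> i \<longrightarrow> c S = 0) \<and> (\<forall>y\<in>cube n. v y = (\<Sum>S\<in>Pow {..<n}. c S * chr x S y))"
    if "v \<in> E n i ` vecs n" for v i
  proof -
    from that obtain u where "v = E n i u" by (rule imageE)
    then have u: "v = eigproj n x i u" by (simp only: E_eq_eigproj[OF x])
    define c where "c S = (if card S = i then fcoeff n x S u / 2 ^ n else 0)" for S
    have "v y = (\<Sum>S\<in>Pow {..<n}. c S * chr x S y)" if "y \<in> cube n" for y
    proof -
      have "v y = (\<Sum>S\<in>{S \<in> Pow {..<n}. card S = i}. fcoeff n x S u * chr x S y / 2 ^ n)"
        unfolding u using that by (simp add: eigproj_def[OF x] sum_divide_distrib)
      also have "\<dots> = (\<Sum>S\<in>Pow {..<n}. c S * chr x S y)"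
        by (rule sum.mono_neutral_cong_left) (auto simp: c_def)
      finally show ?thesis .
    qed
    then show ?thesis by (intro exI[of _ c]) (auto simp: c_def)
  qed
  show ?thesis
    using assms(2)
  proof (induction e arbitrary: v)
    case 0
    then have "v \<in> E n 0 ` vecs n" by simp
    from single[OF this] obtain c where c: "\<And>S. card S \<noteq> 0 \<Longrightarrow> c S = 0"
      "\<And>y. y \<in> cube n \<Longrightarrow> v y = (\<Sum>S\<in>Pow {..<n}. c S * chr x S y)" by blast
    show ?case
    proof (intro exI conjI allI ballI impI)
      show "c S = 0" if "0 < card S" for S using c(1)[of S] that by simp
    qed (rule c(2))
  next
    case (Suc e)
    then have "v \<in> (\<Sum>i\<le>e. E n i ` vecs n) + E n (Suc e) ` vecs n" by simp
    then obtain v1 v2 where v: "v = v1 + v2" "v1 \<in> (\<Sum>i\<le>e. E n i ` vecs n)" "v2 \<in> E n (Suc e) ` vecs n"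
      by (rule set_plus_elim)
    obtain c where c: "\<And>S. card S > e \<Longrightarrow> c S = 0" "\<And>y. y \<in> cube n \<Longrightarrow> v1 y = (\<Sum>S\<in>Pow {..<n}. c S * chr x S y)"
      using Suc.IH[OF v(2)] by blast
    obtain d where d: "\<And>S. card S \<noteq> Suc e \<Longrightarrow> d S = 0" "\<And>y. y \<in> cube n \<Longrightarrow> v2 y = (\<Sum>S\<in>Pow {..<n}. d S * chr x S y)"
      using single[OF v(3)] by blast
    show ?case
    proof (intro exI conjI allI ballI impI)
      show "c S + d S = 0" if "Suc e < card S" for S using c(1)[of S] d(1)[of S] that by simp
      show "v y = (\<Sum>S\<in>Pow {..<n}. (c S + d S) * chr x S y)" if "y \<in> cube n" for y
        unfolding v(1) plus_fun_apply c(2)[OF that] d(2)[OF that] distrib_right sum.distrib ..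
    qed
  qed
qed

text \<open>Explicit space containing the one whose dimension defines tightness: an element is zero
  off the two shells and agrees on them with a combination of characters of order at most e. Its
  elements split into real and imaginary polynomials of low degree.\<close>

definition lowfun :: "nat \<Rightarrow> vertex \<Rightarrow> nat \<Rightarrow> nat \<Rightarrow> nat \<Rightarrow> cvec set" where
  "lowfun n x e l m = {w. (\<forall>y. \<not> (y \<in> cube n \<and> (hdist x y = l \<or> hdist x y = m)) \<longrightarrow> w y = 0) \<and>
     (\<exists>c. (\<forall>S. card S > e \<longrightarrow> c S = 0) \<and>
        (\<forall>y\<in>cube n. hdist x y = l \<or> hdist x y = m \<longrightarrow> w y = (\<Sum>S\<in>Pow {..<n}. c S * chr x S y)))}"

lemma lowfunI:
  assumes "\<And>y. \<not> (y \<in> cube n \<and> (hdist x y = l \<or> hdist x y = m)) \<Longrightarrow> w y = 0" "\<And>S. card S > e \<Longrightarrow> c S = 0"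
    and "\<And>y. y \<in> cube n \<Longrightarrow> hdist x y = l \<or> hdist x y = m \<Longrightarrow> w y = (\<Sum>S\<in>Pow {..<n}. c S * chr x S y)"
  shows "w \<in> lowfun n x e l m"
  unfolding lowfun_def using assms by blast

lemma lowfunD1: "w \<in> lowfun n x e l m \<Longrightarrow> \<not> (y \<in> cube n \<and> (hdist x y = l \<or> hdist x y = m)) \<Longrightarrow> w y = 0"
  unfolding lowfun_def by blast

lemma lowfunD2:
  "w \<in> lowfun n x e l m \<Longrightarrow> \<exists>c. (\<forall>S. card S > e \<longrightarrow> c S = 0) \<and>
    (\<forall>y\<in>cube n. hdist x y = l \<or> hdist x y = m \<longrightarrow> w y = (\<Sum>S\<in>Pow {..<n}. c S * chr x S y))"
  unfolding lowfun_def by blast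

lemma subspace_lowfun: "cvec.subspace (lowfun n x e l m)"
proof (rule cvec.subspaceI)
  show "0 \<in> lowfun n x e l m" by (rule lowfunI[where c = "\<lambda>_. 0"]) simp_all
next
  fix v w assume v: "v \<in> lowfun n x e l m" and w: "w \<in> lowfun n x e l m"
  obtain c where c: "\<forall>S. card S > e \<longrightarrow> c S = 0"
    "\<forall>y\<in>cube n. hdist x y = l \<or> hdist x y = m \<longrightarrow> v y = (\<Sum>S\<in>Pow {..<n}. c S * chr x S y)"
    using lowfunD2[OF v] by blast
  obtain d where d: "\<forall>S. card S > e \<longrightarrow> d S = 0"
    "\<forall>y\<in>cube n. hdist x y = l \<or> hdist x y = m \<longrightarrow> w y = (\<Sum>S\<in>Pow {..<n}. d S * chr x S y)"
    using lowfunD2[OF w] by blast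
  show "v + w \<in> lowfun n x e l m"
  proof (rule lowfunI[where c = "\<lambda>S. c S + d S"])
    fix y assume y: "y \<in> cube n" "hdist x y = l \<or> hdist x y = m"
    show "(v + w) y = (\<Sum>S\<in>Pow {..<n}. (c S + d S) * chr x S y)"
      unfolding plus_fun_apply c(2)[rule_format, OF y] d(2)[rule_format, OF y] distrib_right sum.distrib ..
  next
    fix y assume "\<not> (y \<in> cube n \<and> (hdist x y = l \<or> hdist x y = m))"
    from lowfunD1[OF v this] lowfunD1[OF w this] show "(v + w) y = 0" by simp
  qed (simp only: c(1)[rule_format] d(1)[rule_format] add_0)
next
  fix k w assume w: "w \<in> lowfun n x e l m"
  obtain d where d: "\<forall>S. card S > e \<longrightarrow> d S = 0"
    "\<forall>y\<in>cube n. hdist x y = l \<or> hdist x y = m \<longrightarrow> w y = (\<Sum>S\<in>Pow {..<n}. d S * chr x S y)"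
    using lowfunD2[OF w] by blast
  show "cscale k w \<in> lowfun n x e l m"
  proof (rule lowfunI[where c = "\<lambda>S. k * d S"])
    fix y assume y: "y \<in> cube n" "hdist x y = l \<or> hdist x y = m"
    show "cscale k w y = (\<Sum>S\<in>Pow {..<n}. k * d S * chr x S y)"
      unfolding cscale_def d(2)[rule_format, OF y] sum_distrib_left mult.assoc ..
  next
    fix y assume "\<not> (y \<in> cube n \<and> (hdist x y = l \<or> hdist x y = m))"
    from lowfunD1[OF w this] show "cscale k w y = 0" by (simp add: cscale_def)
  qed (simp only: d(1)[rule_format] mult_zero_right)
qed

lemma shells_image_lowfun:
  assumes x: "x \<in> cube n" and "l \<noteq> m"
  shows "mat_app n (Estar x l + Estar x m) ` (\<Sum>i\<le>e. E n i ` vecs n) \<subseteq> lowfun n x e l m"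
proof (rule image_subsetI)
  fix v assume "v \<in> (\<Sum>i\<le>e. E n i ` vecs n)"
  then obtain c where c: "\<And>S. card S > e \<Longrightarrow> c S = 0" "\<And>y. y \<in> cube n \<Longrightarrow> v y = (\<Sum>S\<in>Pow {..<n}. c S * chr x S y)"
    using sum_eigenspaces_walsh[OF x] by blast
  have "mat_app n (Estar x l + Estar x m) v y = (if y \<in> cube n \<and> (hdist x y = l \<or> hdist x y = m) then v y else 0)" for y
  proof (cases "y \<in> cube n")
    case True
    have "mat_app n (Estar x l + Estar x m) v y =
      (\<Sum>z\<in>cube n. if z = y then (if hdist x y = l \<or> hdist x y = m then v y else 0) else 0)"
      unfolding mat_app_def if_P[OF True] by (intro sum.cong refl) (use \<open>l \<noteq> m\<close> in \<open>auto simp: Estar_def\<close>)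
    then show ?thesis using True finite_cube by simp
  qed (simp add: mat_app_def)
  then show "mat_app n (Estar x l + Estar x m) v \<in> lowfun n x e l m"
    using c by (intro lowfunI[where c = c]) auto
qed

lemma sum_cvec_apply: "(\<Sum>i\<in>I. f i) y = (\<Sum>i\<in>I. (f i :: cvec) y)"
  by (induction I rule: infinite_finite_induct) auto

text \<open>The characters are real valued, so the coefficients can be split; this is the passage
  from complex vectors to real polynomials on sets.\<close>

lemma lowfun_real_parts:
  assumes x: "x \<in> cube n" and "w \<in> lowfun n x e l m"
  shows "\<exists>g g'. lowdeg {..<n} e g \<and> lowdeg {..<n} e g' \<and>
    (\<forall>y\<in>cube n. hdist x y = l \<or> hdist x y = m \<longrightarrow> w y = Complex (g (flips x y)) (g' (flips x y)))"
proof -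
  obtain c where c0: "\<forall>S. card S > e \<longrightarrow> c S = 0"
    and c1: "\<forall>y\<in>cube n. hdist x y = l \<or> hdist x y = m \<longrightarrow> w y = (\<Sum>S\<in>Pow {..<n}. c S * chr x S y)"
    using lowfunD2[OF assms(2)] by blast
  note c = c0[rule_format] c1[rule_format]
  have low: "lowdeg {..<n} e (\<lambda>A. \<Sum>S\<in>Pow {..<n}. d S * walsh S A)" if "\<And>S. card S > e \<Longrightarrow> d S = 0" for d
  proof (rule lowdeg_sum)
    fix S assume S: "S \<in> Pow {..<n}"
    show "lowdeg {..<n} e (\<lambda>A. d S * walsh S A)"
    proof (cases "card S \<le> e")
      case True
      have "S \<subseteq> {..<n}" using S by simp
      then have "lowdeg {..<n} (card S) (walsh S)" by (intro lowdeg_walsh finite_subset[of S "{..<n}"]) simp_all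
      from lowdeg.scale[OF lowdeg_le[OF this True]] show ?thesis .
    next
      case False
      then show ?thesis using that[of S] lowdeg_const[of "{..<n}" e 0] by simp
    qed
  qed
  let ?g = "\<lambda>A. \<Sum>S\<in>Pow {..<n}. Re (c S) * walsh S A" and ?g' = "\<lambda>A. \<Sum>S\<in>Pow {..<n}. Im (c S) * walsh S A"
  have "lowdeg {..<n} e ?g" "lowdeg {..<n} e ?g'" by (rule low, simp add: c(1))+
  moreover have "w y = Complex (?g (flips x y)) (?g' (flips x y))" if "y \<in> cube n" "hdist x y = l \<or> hdist x y = m" for y
    unfolding c(2)[OF that] by (simp add: complex_eq_iff chr_def)
  ultimately show ?thesis by (intro exI[of _ ?g] exI[of _ ?g'] conjI ballI impI)
qed

text \<open>Tightness makes the injective restriction map from \<open>lowfun\<close> to functions on \<open>Y\<close> surjective.\<close>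

lemma tight_shell_design_of_tight_relative_design:
  assumes x: "x \<in> cube n" and tight: "tight_relative_design n x e l m Y \<omega>"
    and bounds: "1 \<le> e" "e \<le> l" "l < m" "m \<le> n - l"
  shows "tight_shell_design {..<n} (flips x ` Y) (\<lambda>A. \<omega> (unflip x A)) l m e"
proof -
  have design: "relative_design n x (2 * e) Y \<omega>" and supp: "supported_on_shells n x l m Y"
    and card: "card Y = cvec.dim (mat_app n (Estar x l + Estar x m) ` (\<Sum>i\<le>e. E n i ` vecs n))"
    using tight unfolding tight_relative_design_def by blast+
  interpret shell_design "{..<n}" "flips x ` Y" "\<lambda>A. \<omega> (unflip x A)" l m e
    by (rule shell_design_of_relative_design[OF x design supp bounds])
  interpret vp: vector_space_pair cscale cscale by unfold_locales
  have Y: "Y = {y \<in> cube n. \<omega> y > 0}"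
    using design by (auto simp: relative_design_def weighted_subset_def)
  then have finY: "finite Y" using finite_cube by simp
  have Y_shell: "y \<in> cube n" "hdist x y = l \<or> hdist x y = m" if "y \<in> Y" for y
    using that supp unfolding supported_on_shells_def shell_def by blast+
  \<comment> \<open>Restriction to Y, written as extension by zero, so that all spans stay in one
    vector space.\<close>
  define \<rho> :: "cvec \<Rightarrow> cvec" where "\<rho> v = (\<lambda>y. of_bool (y \<in> Y) * v y)" for v
  have lin: "Vector_Spaces.linear cscale cscale \<rho>"
    unfolding Vector_Spaces.linear_iff
  proof (intro conjI allI)
    show "vector_space cscale" by (rule cvec.vector_space_axioms)
    show "vector_space cscale" by (rule cvec.vector_space_axioms)
    show "\<rho> (u + v) = \<rho> u + \<rho> v" for u v by (rule ext) (simp add: \<rho>_def distrib_left)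
    show "\<rho> (cscale k v) = cscale k (\<rho> v)" for k v by (rule ext) (simp add: \<rho>_def cscale_def)
  qed
  let ?W = "mat_app n (Estar x l + Estar x m) ` (\<Sum>i\<le>e. E n i ` vecs n)"
  obtain B where B: "B \<subseteq> ?W" "cvec.independent B" "?W \<subseteq> cvec.span B" "card B = cvec.dim ?W"
    by (rule cvec.basis_exists)
  have "l \<noteq> m" using bounds by simp
  have "B \<subseteq> lowfun n x e l m" by (rule order_trans[OF B(1) shells_image_lowfun[OF x \<open>l \<noteq> m\<close>]])
  then have span_low: "cvec.span B \<subseteq> lowfun n x e l m" using subspace_lowfun by (rule cvec.span_minimal)
  have inj: "inj_on \<rho> (cvec.span B)"
    unfolding vp.linear_inj_on_iff_eq_0[OF lin cvec.subspace_span]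
  proof (intro ballI impI)
    fix w assume w: "w \<in> cvec.span B" "\<rho> w = 0"
    then have wl: "w \<in> lowfun n x e l m" using span_low by blast
    obtain g g' where g: "lowdeg {..<n} e g" "lowdeg {..<n} e g'"
      and gval: "\<forall>y\<in>cube n. hdist x y = l \<or> hdist x y = m \<longrightarrow> w y = Complex (g (flips x y)) (g' (flips x y))"
      using lowfun_real_parts[OF x wl] by blast
    have w0: "w y = 0" if "y \<in> Y" for y using fun_cong[OF w(2), of y] that by (simp add: \<rho>_def)
    have "g (flips x y) = 0 \<and> g' (flips x y) = 0" if "y \<in> Y" for y
      using w0[OF that] gval Y_shell[OF that] by (simp add: complex_eq_iff)
    then have g0: "g A = 0" "g' A = 0" if "A \<in> flips x ` Y" for A using that by blast+
    show "w = 0"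
    proof
      fix y show "w y = 0 y"
      proof (cases "y \<in> cube n \<and> (hdist x y = l \<or> hdist x y = m)")
        case True
        then have sz: "card (flips x y) = l \<or> card (flips x y) = m" by (simp add: hdist_eq_card_flips)
        have "g (flips x y) = 0" by (rule vanish[OF g(1) g0(1) flips_subset[OF x] sz])
        moreover have "g' (flips x y) = 0" by (rule vanish[OF g(2) g0(2) flips_subset[OF x] sz])
        moreover have "w y = Complex (g (flips x y)) (g' (flips x y))" using gval True by blast
        ultimately show ?thesis by (simp add: complex_eq_iff)
      next
        case False
        then show ?thesis using lowfunD1[OF wl False] by simp
      qed
    qed
  qed
  have ind: "cvec.independent (\<rho> ` B)"
    using inj by (rule vp.linear_independent_injective_image[OF lin B(2)])
  have cardB: "card (\<rho> ` B) = card Y"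
    using card_image[OF inj_on_subset[OF inj cvec.span_superset]] B(4) card by simp
  have in_span: "\<rho> v \<in> cvec.span (char_vec ` Y)" for v
  proof -
    have "\<rho> v = (\<Sum>y\<in>Y. cscale (v y) (char_vec y))"
    proof
      fix z
      have "(\<Sum>y\<in>Y. cscale (v y) (char_vec y)) z = (\<Sum>y\<in>Y. if y = z then v z else 0)"
        unfolding sum_cvec_apply by (intro sum.cong refl) (auto simp: cscale_def char_vec_def)
      then show "\<rho> v z = (\<Sum>y\<in>Y. cscale (v y) (char_vec y)) z" using finY by (simp add: \<rho>_def)
    qed
    then show ?thesis by (simp add: cvec.span_sum cvec.span_scale cvec.span_base)
  qed
  have "\<exists>f. lowdeg {..<n} e f \<and> (\<forall>A\<in>flips x ` Y. f A = of_bool (A = a))" if a: "a \<in> flips x ` Y" for a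
  proof -
    obtain y where y: "y \<in> Y" "a = flips x y" using a by auto
    \<comment> \<open>The restricted basis consists of card Y independent vectors in the span of
      card Y point masses; a further independent vector would not fit.\<close>
    have "char_vec y \<in> cvec.span (\<rho> ` B)"
    proof (rule ccontr)
      assume n: "char_vec y \<notin> cvec.span (\<rho> ` B)"
      then have ind': "cvec.independent (insert (char_vec y) (\<rho> ` B))" using ind by (rule cvec.independent_insertI)
      have sub: "insert (char_vec y) (\<rho> ` B) \<subseteq> cvec.span (char_vec ` Y)"
      proof (unfold insert_subset, intro conjI image_subsetI in_span)
        show "char_vec y \<in> cvec.span (char_vec ` Y)" using y(1) by (intro cvec.span_base imageI)
      qed
      have bound: "finite (insert (char_vec y) (\<rho> ` B)) \<and> card (insert (char_vec y) (\<rho> ` B)) \<le> card (char_vec ` Y)"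
        by (rule cvec.independent_span_bound[OF finite_imageI[OF finY] ind' sub])
      have "char_vec y \<notin> \<rho> ` B"
      proof
        assume "char_vec y \<in> \<rho> ` B"
        then have "char_vec y \<in> cvec.span (\<rho> ` B)" by (rule cvec.span_base)
        with n show False by (rule notE)
      qed
      then have "card (insert (char_vec y) (\<rho> ` B)) = Suc (card Y)"
        using conjunct1[OF bound] unfolding finite_insert cardB[symmetric] by (intro card_insert_disjoint)
      then show False using conjunct2[OF bound] card_image_le[OF finY, of char_vec] by linarith
    qed
    then have "char_vec y \<in> \<rho> ` cvec.span B" unfolding vp.linear_span_image[OF lin] .
    then obtain w where w: "char_vec y = \<rho> w" "w \<in> cvec.span B" by (rule imageE)
    have wl: "w \<in> lowfun n x e l m" using w(2) span_low by blast
    obtain g g' where g: "lowdeg {..<n} e g"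
      and gval: "\<forall>y\<in>cube n. hdist x y = l \<or> hdist x y = m \<longrightarrow> w y = Complex (g (flips x y)) (g' (flips x y))"
      using lowfun_real_parts[OF x wl] by blast
    have "g (flips x z) = of_bool (flips x z = flips x y)" if z: "z \<in> Y" for z
    proof -
      have "w z = char_vec y z" using fun_cong[OF w(1), of z] z by (simp add: \<rho>_def)
      moreover have "w z = Complex (g (flips x z)) (g' (flips x z))" using gval Y_shell[OF z] by blast
      ultimately have "Re (char_vec y z) = g (flips x z)" by (metis complex.sel(1))
      then have "g (flips x z) = of_bool (z = y)" by (cases "z = y") (simp_all add: char_vec_def)
      moreover have "flips x z = flips x y \<longleftrightarrow> z = y"
        using inj_on_flips[OF x] Y_shell(1)[OF z] Y_shell(1)[OF y(1)] by (rule inj_on_eq_iff)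
      ultimately show ?thesis by simp
    qed
    then have "\<forall>A\<in>flips x ` Y. g A = of_bool (A = a)" unfolding y(2) by simp
    with g show ?thesis by (intro exI[of _ g] conjI)
  qed
  then show ?thesis
    by (intro tight_shell_design.intro[OF shell_design_axioms] tight_shell_design_axioms.intro)
qed

section \<open>Bounding the parameters\<close>

text \<open>The zeros are listed by an index i < e, so that along a sequence of designs each of them
  forms a sequence of its own; the recurrence returns to the integers for the divisibility
  arguments.\<close>

lemma hahn_integer_roots_data:
  assumes "tight_shell_design {..<n} Y \<omega> l m e"
  shows "\<exists>(\<xi> :: nat \<Rightarrow> nat) (a :: nat \<Rightarrow> int). a e = 1 \<and>
    (\<forall>k<e. a k * ((int e - int k) * (int n + 1 - int e - int k)) +
         (int k + 1) * (int l - int k) * (int n - int m - int k) * a (Suc k) = 0) \<and>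
    (\<forall>t. hahn_op n l m (\<lambda>t. \<Prod>i<e. t - real (\<xi> i)) t =
       - real e * (real n + 1 - real e) * (\<Prod>i<e. t - real (\<xi> i)))"
proof -
  interpret tight_shell_design "{..<n}" Y \<omega> l m e by fact
  obtain D where D: "D \<subseteq> {..l}" "card D = e"
    "\<And>F :: real poly. degree F < e \<Longrightarrow> (\<Sum>t\<le>l. hahn_weight n l m t * (\<Prod>\<xi>\<in>D. real t - real \<xi>) * poly F (real t)) = 0"
    using hahn_orthogonal_integer_roots by auto
  have finD: "finite D" using D(1) finite_subset by blast
  obtain a :: "nat \<Rightarrow> int" where a: "a e = 1" "\<And>t. (\<Prod>\<xi>\<in>D. t - real \<xi>) = (\<Sum>k\<le>e. of_int (a k) * falling k t)"
    using falling_expansion[OF finD] D(2) by auto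
  obtain \<xi> where \<xi>: "bij_betw \<xi> {..<e} D"
    using ex_bij_betw_nat_finite[OF finD] D(2) by (auto simp: atLeast0LessThan)
  have prod_eq: "(\<Prod>\<xi>\<in>D. t - real \<xi>) = (\<Prod>i<e. t - real (\<xi> i))" for t
    by (rule prod.reindex_bij_betw[OF \<xi>, symmetric])
  have orth: "(\<Sum>t\<le>l. hahn_weight n l m t * (\<Prod>\<xi>\<in>D. real t - real \<xi>) * falling j (real t)) = 0" if "j < e" for j
  proof -
    have "degree (\<Prod>i<j. [:- real i, 1:]) = j" by (subst degree_prod_eq_sum_degree) auto
    then have "(\<Sum>t\<le>l. hahn_weight n l m t * (\<Prod>\<xi>\<in>D. real t - real \<xi>) * poly (\<Prod>i<j. [:- real i, 1:]) (real t)) = 0"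
      using that by (intro D(3)) simp
    then show ?thesis by (simp add: falling_def poly_prod)
  qed
  have bd: "e \<le> l" "l \<le> m" "m \<le> n - l" "l \<le> n" using bounds by auto
  have rec: "a k * ((int e - int k) * (int n + 1 - int e - int k)) +
         (int k + 1) * (int l - int k) * (int n - int m - int k) * a (Suc k) = 0" if "k < e" for k
  proof -
    have "real_of_int (a k * ((int e - int k) * (int n + 1 - int e - int k)) +
         (int k + 1) * (int l - int k) * (int n - int m - int k) * a (Suc k)) = 0"
      using hahn_recurrence(1)[OF bd a(2) orth that] by simp
    then show ?thesis by (simp only: of_int_eq_0_iff)
  qed
  have "0 < e" using bounds by simp
  have "hahn_op n l m (\<lambda>t. \<Prod>\<xi>\<in>D. t - real \<xi>) t = - real e * (real n + 1 - real e) * (\<Prod>\<xi>\<in>D. t - real \<xi>)" for t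
    by (rule hahn_recurrence(2)[where p = "\<lambda>t. \<Prod>\<xi>\<in>D. t - real \<xi>", OF bd a(2) orth \<open>0 < e\<close>])
  then show ?thesis using a(1) rec unfolding prod_eq by blast
qed

text \<open>The centre c is the mean of the Hahn weight, the point where upward and downward rates
  agree. \<sigma>^2 is its variance with n - 1 in the denominator replaced by n; then the sum of the
  rates at c is exactly 2 * n * \<sigma>^2. The number \<rho> is the slope of that sum at c, divided
  by n.\<close>

lemma scaled_hahn_eq_of_hahn_op:
  fixes n l m e :: nat and \<sigma> :: real
  defines "c \<equiv> real l * (real n - real m) / real n"
  assumes n: "n > 0" and \<sigma>: "\<sigma> > 0" "\<sigma>\<^sup>2 = real l * real m * (real n - real m) * (real n - real l) / real n ^ 3"
    and eq: "\<And>t. hahn_op n l m p t = - real e * (real n + 1 - real e) * p t"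
  shows "scaled_hahn_eq e (1 / \<sigma>) (1 / real n) ((2 * real m - real n) / real n * (1 - 2 * real l / real n)) (\<lambda>x. p (c + \<sigma> * x) / \<sigma> ^ e)"
  unfolding scaled_hahn_eq_def
proof
  fix x
  define \<rho> where "\<rho> = (2 * real m - real n) / real n * (1 - 2 * real l / real n)"
  define t where "t = c + \<sigma> * x"
  have sh: "c + \<sigma> * (x + 1 / \<sigma>) = t + 1" "c + \<sigma> * (x - 1 / \<sigma>) = t - 1"
    using \<sigma>(1) by (simp_all add: t_def algebra_simps)
  define B where "B = (real l - t) * (real n - real m - t)"
  define D where "D = t * (real m - real l + t)"
  have "B - D = - (real n * (t - c))" using n by (simp add: B_def D_def c_def field_simps)
  then have BmD: "B - D = - (real n * \<sigma> * x)" by (simp add: t_def)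
  have e1: "real l * (real n - real m) - c * (real n + 2 * real l - 2 * real m) + 2 * c\<^sup>2 = 2 * real n * \<sigma>\<^sup>2"
    unfolding \<sigma>(2) c_def using n by (simp add: field_simps power2_eq_square power3_eq_cube)
  have e2: "4 * c - (real n + 2 * real l - 2 * real m) = real n * \<rho>"
    unfolding \<rho>_def c_def using n by (simp add: field_simps)
  have "B + D = real l * (real n - real m) - t * (real n + 2 * real l - 2 * real m) + 2 * t\<^sup>2"
    by (simp add: B_def D_def algebra_simps power2_eq_square)
  also have "\<dots> = (real l * (real n - real m) - c * (real n + 2 * real l - 2 * real m) + 2 * c\<^sup>2) +
      \<sigma> * x * (4 * c - (real n + 2 * real l - 2 * real m)) + 2 * \<sigma>\<^sup>2 * x\<^sup>2"
    by (simp add: t_def algebra_simps power2_eq_square)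
  finally have BpD: "B + D = 2 * real n * \<sigma>\<^sup>2 + \<sigma> * x * (real n * \<rho>) + 2 * \<sigma>\<^sup>2 * x\<^sup>2" unfolding e1 e2 .
  have "B * (p (t + 1) - p t) + D * (p (t - 1) - p t) + real e * (real n + 1 - real e) * p t = 0"
    using eq[of t] by (simp add: hahn_op_def B_def D_def)
  \<comment> \<open>The one-sided differences are regrouped: B - D belongs to the central first
    difference, B + D to the second difference.\<close>
  then have "(B - D) * ((p (t + 1) - p (t - 1)) / 2) + (B + D) * ((p (t + 1) - 2 * p t + p (t - 1)) / 2) +
      real e * (real n + 1 - real e) * p t = 0"
    by (simp add: field_simps)
  then have main: "- x * (\<sigma> * (p (t + 1) - p (t - 1)) / 2) +
      (1 + \<rho> / \<sigma> / 2 * x + 1 / real n * x\<^sup>2) * (\<sigma>\<^sup>2 * (p (t + 1) - 2 * p t + p (t - 1))) +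
      real e * (1 - (real e - 1) * (1 / real n)) * p t = 0"
  proof -
    have div_n: "- x * (\<sigma> * a / 2) + (1 + \<rho> / \<sigma> / 2 * x + 1 / real n * x\<^sup>2) * (\<sigma>\<^sup>2 * b) + real e * (1 - (real e - 1) * (1 / real n)) * q =
       (- (real n * \<sigma> * x) * (a / 2) + (2 * real n * \<sigma>\<^sup>2 + \<sigma> * x * (real n * \<rho>) + 2 * \<sigma>\<^sup>2 * x\<^sup>2) * (b / 2) + real e * (real n + 1 - real e) * q) / real n" for a b q
      using n \<sigma>(1) by (simp add: field_simps power2_eq_square)
    assume "(B - D) * ((p (t + 1) - p (t - 1)) / 2) + (B + D) * ((p (t + 1) - 2 * p t + p (t - 1)) / 2) +
      real e * (real n + 1 - real e) * p t = 0"
    then show ?thesis unfolding BmD BpD div_n by simp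
  qed
  have factor: "- x * ((u * \<kappa> - v * \<kappa>) / (2 * (1 / \<sigma>))) +
         (1 + \<rho> * (1 / \<sigma>) / 2 * x + 1 / real n * x\<^sup>2) * ((u * \<kappa> - 2 * (q * \<kappa>) + v * \<kappa>) / (1 / \<sigma>)\<^sup>2) + K * (q * \<kappa>) =
     (- x * (\<sigma> * (u - v) / 2) + (1 + \<rho> / \<sigma> / 2 * x + 1 / real n * x\<^sup>2) * (\<sigma>\<^sup>2 * (u - 2 * q + v)) + K * q) * \<kappa>"
    for u v q K \<kappa>
    using n \<sigma>(1) by (simp add: field_simps power2_eq_square)
  show "- x * ((p (c + \<sigma> * (x + 1 / \<sigma>)) / \<sigma> ^ e - p (c + \<sigma> * (x - 1 / \<sigma>)) / \<sigma> ^ e) / (2 * (1 / \<sigma>))) +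
         (1 + (2 * real m - real n) / real n * (1 - 2 * real l / real n) * (1 / \<sigma>) / 2 * x + 1 / real n * x\<^sup>2) *
         ((p (c + \<sigma> * (x + 1 / \<sigma>)) / \<sigma> ^ e - 2 * (p (c + \<sigma> * x) / \<sigma> ^ e) + p (c + \<sigma> * (x - 1 / \<sigma>)) / \<sigma> ^ e) / (1 / \<sigma>)\<^sup>2) +
         real e * (1 - (real e - 1) * (1 / real n)) * (p (c + \<sigma> * x) / \<sigma> ^ e) = 0"
    unfolding sh t_def[symmetric] \<rho>_def[symmetric] divide_inverse[of _ "\<sigma> ^ e"] factor main by simp
qed

text \<open>For n = 2 * m the factors n - m - k become m - k, and integrality of the constant
  coefficient turns into the divisibility behind \<open>middle_dvd_bound\<close>.\<close>

lemma half_case_bound: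
  fixes a :: "nat \<Rightarrow> int"
  assumes "1 \<le> e" "e \<le> l" "l < m" "n = 2 * m" "a e = 1"
    and rec: "\<And>k. k < e \<Longrightarrow> a k * ((int e - int k) * (int n + 1 - int e - int k)) +
         (int k + 1) * (int l - int k) * (int n - int m - int k) * a (Suc k) = 0"
  shows "(n - 2 * e) ^ (e div 2) \<le> l ^ e * (2 * e) ^ (e * e)"
proof -
  have 1: "(\<Prod>k<e. int n + 1 - int e - int k) = int (\<Prod>k<e. 2 * m + 1 - e - k)"
    unfolding of_nat_prod using assms by (intro prod.cong refl) (auto simp: of_nat_diff)
  have 2: "(\<Prod>k<e. (int l - int k) * (int n - int m - int k)) = int ((\<Prod>k<e. l - k) * (\<Prod>k<e. m - k))"
    unfolding of_nat_mult of_nat_prod prod.distrib[symmetric] using assms by (intro prod.cong refl) (auto simp: of_nat_diff)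
  have "(\<Prod>k<e. int n + 1 - int e - int k) dvd \<bar>a 0 * (\<Prod>k<e. int n + 1 - int e - int k)\<bar>" by simp
  also have "\<dots> = \<bar>(\<Prod>k<e. (int l - int k) * (int n - int m - int k))\<bar>"
    by (rule hahn_constant_coefficient[OF rec assms(5)])
  finally have "int (\<Prod>k<e. 2 * m + 1 - e - k) dvd int ((\<Prod>k<e. l - k) * (\<Prod>k<e. m - k))"
    unfolding 1 2 by (simp only: dvd_abs_iff)
  then have "(\<Prod>k<e. 2 * m + 1 - e - k) dvd (\<Prod>k<e. l - k) * (\<Prod>k<e. m - k)" by (simp only: of_nat_dvd_iff)
  from middle_dvd_bound[OF assms(1-3) this] show ?thesis using assms(4) by simp
qed

text \<open>Up to constants both sides are powers of n, with exponents \<delta> * e and e div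
  2.\<close>

lemma no_half_case_eventually:
  fixes \<delta> c :: real and e :: nat
  assumes "\<delta> * real e < real (e div 2)" "c > 0"
  shows "\<forall>\<^sub>F n in sequentially. c ^ e * (real n powr \<delta>) ^ e * real ((2 * e) ^ (e * e)) < (real n - 2 * real e) ^ (e div 2)"
proof -
  define K where "K = c ^ e * real ((2 * e) ^ (e * e)) * 2 ^ (e div 2)"
  have "K \<ge> 0" using assms(2) by (simp add: K_def)
  have "(\<lambda>n. real n powr (- (real (e div 2) - \<delta> * real e))) \<longlonglongrightarrow> 0"
    using assms(1) by (intro tendsto_neg_powr filterlim_real_sequentially) simp
  then have "\<forall>\<^sub>F n in sequentially. real n powr (- (real (e div 2) - \<delta> * real e)) < 1 / (K + 1)"
    using \<open>K \<ge> 0\<close> by (intro order_tendstoD(2)) auto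
  moreover have "\<forall>\<^sub>F n in sequentially. n \<ge> max 1 (4 * e)" by (rule eventually_ge_at_top)
  ultimately show ?thesis
  proof eventually_elim
    case (elim n)
    then have n: "real n > 0" "real n / 2 \<le> real n - 2 * real e" by auto
    have "K + 1 < real n powr (real (e div 2) - \<delta> * real e)"
      using elim(1) n \<open>K \<ge> 0\<close> unfolding powr_minus by (simp add: field_simps)
    then have K: "K < real n powr (real (e div 2) - \<delta> * real e)" by simp
    have "c ^ e * (real n powr \<delta>) ^ e * real ((2 * e) ^ (e * e)) * 2 ^ (e div 2) = K * real n powr (\<delta> * real e)"
      using n by (simp add: K_def powr_powr[symmetric] powr_realpow)
    also have "\<dots> < real n powr (real (e div 2) - \<delta> * real e) * real n powr (\<delta> * real e)"
      using K n by (intro mult_strict_right_mono) auto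
    also have "\<dots> = real n ^ (e div 2)" using n by (simp add: powr_add[symmetric] powr_realpow)
    finally have "c ^ e * (real n powr \<delta>) ^ e * real ((2 * e) ^ (e * e)) < (real n / 2) ^ (e div 2)"
      by (simp add: power_divide field_simps)
    also have "\<dots> \<le> (real n - 2 * real e) ^ (e div 2)" using n by (intro power_mono) auto
    finally show ?case .
  qed
qed

text \<open>The right hand side is the \<sigma>^2 of the rescaling. The constant 32 collects 8 from
  n - 2 * e + 2 \<ge> n / 2 in a cube, where 4 * e \<le> n enters, 2 from estimating L + 1 by 2 * l,
  and 2 from n - l \<ge> n / 2.\<close>

lemma variance_lower_bound:
  fixes a :: "nat \<Rightarrow> int" and n l m e :: nat
  assumes "2 \<le> e" "e \<le> l" "l < m" "m \<le> n - l" "4 * e \<le> n" "a e = 1"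
    and rec: "\<And>k. k < e \<Longrightarrow> a k * ((int e - int k) * (int n + 1 - int e - int k)) +
         (int k + 1) * (int l - int k) * (int n - int m - int k) * a (Suc k) = 0"
  shows "real n / (32 * real e ^ 3 * (real l)\<^sup>2) \<le> real l * real m * (real n - real m) * (real n - real l) / real n ^ 3"
proof -
  let ?N = "int n - 2 * int e + 2" and ?L = "int l - int e + 1" and ?M = "int m - int e + 1" and ?M' = "int n - int m - int e + 1"
  have ln: "l \<le> n" "2 * l < n" using assms by auto
  have "?N\<^sup>2 * (?N + 1) \<le> int e ^ 3 * (?L + 1) * ?L\<^sup>2 * (?M * ?M')"
    using assms ln by (intro hahn_integrality_bound[where a = a]) auto
  also have "\<dots> \<le> int e ^ 3 * (2 * int l) * (int l)\<^sup>2 * (int m * (int n - int m))"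
    using assms ln by (intro mult_mono power_mono mult_nonneg_nonneg) auto
  finally have "real_of_int (?N\<^sup>2 * (?N + 1)) \<le> real_of_int (int e ^ 3 * (2 * int l) * (int l)\<^sup>2 * (int m * (int n - int m)))"
    by (simp only: of_int_le_iff)
  then have 1: "(real n - 2 * real e + 2)\<^sup>2 * (real n - 2 * real e + 2 + 1) \<le>
     real e ^ 3 * (2 * real l) * (real l)\<^sup>2 * (real m * (real n - real m))" by simp
  have half: "real n / 2 \<le> real n - 2 * real e + 2" using assms(5) by simp
  have "(real n / 2)\<^sup>2 * (real n / 2) \<le> (real n - 2 * real e + 2)\<^sup>2 * (real n - 2 * real e + 2 + 1)"
    using half by (intro mult_mono power_mono) auto
  also note 1
  finally have 2: "real n ^ 3 \<le> 16 * real e ^ 3 * real l ^ 3 * (real m * (real n - real m))"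
    by (simp add: power2_eq_square power3_eq_cube)
  have pos: "real n > 0" "real l > 0" "real e > 0" "real n - real l \<ge> real n / 2" using assms ln by auto
  have "real n / (32 * real e ^ 3 * (real l)\<^sup>2) = (real n / 2) * real l * real n ^ 3 / (16 * real e ^ 3 * real l ^ 3 * real n ^ 3)"
    using pos by (simp add: field_simps power2_eq_square power3_eq_cube)
  also have "\<dots> \<le> (real n - real l) * real l * (16 * real e ^ 3 * real l ^ 3 * (real m * (real n - real m))) / (16 * real e ^ 3 * real l ^ 3 * real n ^ 3)"
    using pos 2 by (intro divide_right_mono mult_mono) auto
  also have "\<dots> = real l * real m * (real n - real m) * (real n - real l) / real n ^ 3"
    using pos by (simp add: field_simps)
  finally show ?thesis .
qed

text \<open>Unbounded n would give a sequence of designs along which 1 / \<sigma>^2 = O(n^(2 *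
  \<delta> - 1)) tends to 0, by the variance bound and l < c * n^\<delta>, while exclusion of n = 2
  * m keeps \<rho> nonzero: the situation ruled out by the Hermite limit.\<close>

lemma bounded_parameters:
  fixes \<delta> c :: real and e :: nat
  assumes \<delta>: "\<delta> < 1 / 2" "\<delta> * real e < real (e div 2)" and c: "c > 0" and e: "e \<ge> 27"
  shows "\<exists>n0. \<forall>n l m Y \<omega>. tight_shell_design {..<n} Y \<omega> l m e \<longrightarrow> real l < c * real n powr \<delta> \<longrightarrow> n < n0"
proof (rule ccontr)
  assume neg: "\<not> ?thesis"
  obtain n1 where n1: "\<And>n. n \<ge> n1 \<Longrightarrow> c ^ e * (real n powr \<delta>) ^ e * real ((2 * e) ^ (e * e)) < (real n - 2 * real e) ^ (e div 2)"
    using no_half_case_eventually[OF \<delta>(2) c] unfolding eventually_sequentially by blast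
  define good where "good n l m \<xi> a \<longleftrightarrow> e \<le> l \<and> l < m \<and> m \<le> n - l \<and> real l < c * real n powr \<delta> \<and> a e = (1 :: int) \<and>
    (\<forall>k<e. a k * ((int e - int k) * (int n + 1 - int e - int k)) +
         (int k + 1) * (int l - int k) * (int n - int m - int k) * a (Suc k) = 0) \<and>
    (\<forall>t. hahn_op n l m (\<lambda>t. \<Prod>i<e. t - real (\<xi> i)) t =
       - real e * (real n + 1 - real e) * (\<Prod>i<e. t - real (\<xi> i)))" for n l m \<xi> a
  \<comment> \<open>The summand j drives n to infinity, \<open>n1\<close> excludes n = 2 * m, and 4
    * e serves the variance bound.\<close>
  have "\<exists>n l m \<xi> a. n \<ge> j + n1 + 4 * e \<and> good n l m \<xi> a" for j :: nat
  proof -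
    obtain n l m Y \<omega> where d: "tight_shell_design {..<n} Y \<omega> l m e" "real l < c * real n powr \<delta>" "\<not> n < j + n1 + 4 * e"
      using neg by blast
    interpret tight_shell_design "{..<n}" Y \<omega> l m e by fact
    obtain \<xi> :: "nat \<Rightarrow> nat" and a :: "nat \<Rightarrow> int" where "a e = 1"
      "\<forall>k<e. a k * ((int e - int k) * (int n + 1 - int e - int k)) +
         (int k + 1) * (int l - int k) * (int n - int m - int k) * a (Suc k) = 0"
      "\<forall>t. hahn_op n l m (\<lambda>t. \<Prod>i<e. t - real (\<xi> i)) t =
       - real e * (real n + 1 - real e) * (\<Prod>i<e. t - real (\<xi> i))"
      using hahn_integer_roots_data[OF d(1)] by (elim exE conjE) (rule that)
    moreover have "e \<le> l" "l < m" "m \<le> n - l" using bounds by auto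
    ultimately have "good n l m \<xi> a" unfolding good_def using d(2) by (intro conjI)
    moreover have "j + n1 + 4 * e \<le> n" using d(3) by simp
    ultimately show ?thesis by (intro exI conjI)
  qed
  then obtain n l m \<xi> a where nj: "\<And>j. n j \<ge> j + n1 + 4 * e" and good: "\<And>j. good (n j) (l j) (m j) (\<xi> j) (a j)" by metis
  have b: "e \<le> l j" "l j < m j" "m j \<le> n j - l j" "real (l j) < c * real (n j) powr \<delta>" "a j e = 1"
    and rec: "\<forall>k<e. a j k * ((int e - int k) * (int (n j) + 1 - int e - int k)) +
         (int k + 1) * (int (l j) - int k) * (int (n j) - int (m j) - int k) * a j (Suc k) = 0"
    and op: "\<forall>t. hahn_op (n j) (l j) (m j) (\<lambda>t. \<Prod>i<e. t - real (\<xi> j i)) t =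
       - real e * (real (n j) + 1 - real e) * (\<Prod>i<e. t - real (\<xi> j i))" for j
    using good[of j] unfolding good_def by - ((elim conjE)?, assumption)+
  have npos: "real (n j) > 0" and nge: "n j \<ge> n1" "4 * e \<le> n j" "real (n j) \<ge> real j" for j using nj[of j] e by auto
  have lpos: "real (l j) > 0" "2 * l j < n j" "m j < n j" "l j < n j" for j using b(1-3)[of j] e by linarith+
  define \<sigma> where "\<sigma> j = sqrt (real (l j) * real (m j) * (real (n j) - real (m j)) * (real (n j) - real (l j)) / real (n j) ^ 3)" for j
  define \<rho> where "\<rho> j = (2 * real (m j) - real (n j)) / real (n j) * (1 - 2 * real (l j) / real (n j))" for j
  have v_pos: "real (l j) * real (m j) * (real (n j) - real (m j)) * (real (n j) - real (l j)) / real (n j) ^ 3 > 0" for j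
    using lpos[of j] npos[of j] b(2)[of j] by (intro divide_pos_pos mult_pos_pos) auto
  have \<sigma>: "\<sigma> j > 0" "(\<sigma> j)\<^sup>2 = real (l j) * real (m j) * (real (n j) - real (m j)) * (real (n j) - real (l j)) / real (n j) ^ 3" for j
    using v_pos[of j] by (simp_all add: \<sigma>_def)
  have "n j \<noteq> 2 * m j" for j
  proof
    assume half: "n j = 2 * m j"
    have "(n j - 2 * e) ^ (e div 2) \<le> l j ^ e * (2 * e) ^ (e * e)"
      by (rule half_case_bound[OF _ b(1,2) half b(5) rec[rule_format]]) (use e in auto)
    then have "real ((n j - 2 * e) ^ (e div 2)) \<le> real (l j ^ e * (2 * e) ^ (e * e))" by (simp only: of_nat_le_iff)
    then have "(real (n j) - 2 * real e) ^ (e div 2) \<le> real (l j) ^ e * real ((2 * e) ^ (e * e))"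
      using nge(2)[of j] by (simp add: of_nat_diff)
    also have "\<dots> \<le> (c * real (n j) powr \<delta>) ^ e * real ((2 * e) ^ (e * e))"
      using b(4)[of j] by (intro mult_right_mono power_mono) auto
    also have "\<dots> < (real (n j) - 2 * real e) ^ (e div 2)" using n1[OF nge(1)[of j]] by (simp add: power_mult_distrib)
    finally show False by simp
  qed
  then have rho0: "\<rho> j \<noteq> 0" for j
  proof -
    have "2 * real (m j) - real (n j) \<noteq> 0" using \<open>n j \<noteq> 2 * m j\<close> by linarith
    moreover have "1 - 2 * real (l j) / real (n j) > 0" using lpos(2)[of j] npos[of j] by (simp add: field_simps)
    ultimately show ?thesis using npos[of j] by (simp add: \<rho>_def)
  qed
  have rho1: "\<bar>\<rho> j\<bar> \<le> 1" for j
  proof -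
    have "\<bar>(2 * real (m j) - real (n j)) / real (n j)\<bar> \<le> 1" using lpos(3)[of j] npos[of j] by (simp add: abs_le_iff field_simps)
    moreover have "\<bar>1 - 2 * real (l j) / real (n j)\<bar> \<le> 1" using lpos[of j] npos[of j] by (simp add: abs_le_iff field_simps)
    ultimately show ?thesis unfolding \<rho>_def abs_mult by (intro mult_le_one) auto
  qed
  have n_top: "filterlim (\<lambda>j. real (n j)) at_top sequentially"
    by (rule filterlim_at_top_mono[OF filterlim_real_sequentially]) (use nge(3) in auto)
  have nu: "(\<lambda>j. 1 / real (n j)) \<longlonglongrightarrow> 0"
    using tendsto_inverse_0_at_top[OF n_top] by (simp add: inverse_eq_divide)
  have h: "(\<lambda>j. 1 / \<sigma> j) \<longlonglongrightarrow> 0"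
  proof -
    have up: "(1 / \<sigma> j)\<^sup>2 \<le> 32 * real e ^ 3 * c\<^sup>2 * real (n j) powr (- (1 - 2 * \<delta>))" for j
    proof -
      have "real (n j) / (32 * real e ^ 3 * (real (l j))\<^sup>2) \<le> (\<sigma> j)\<^sup>2"
        unfolding \<sigma>(2) by (rule variance_lower_bound[OF _ b(1-3) nge(2) b(5) rec[rule_format]]) (use e in auto)
      then have "inverse ((\<sigma> j)\<^sup>2) \<le> inverse (real (n j) / (32 * real e ^ 3 * (real (l j))\<^sup>2))"
        using npos[of j] lpos(1)[of j] e by (intro le_imp_inverse_le divide_pos_pos mult_pos_pos) auto
      then have "(1 / \<sigma> j)\<^sup>2 \<le> 32 * real e ^ 3 * (real (l j))\<^sup>2 / real (n j)"
        by (simp add: power_divide inverse_eq_divide)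
      also have "\<dots> \<le> 32 * real e ^ 3 * (c * real (n j) powr \<delta>)\<^sup>2 / real (n j)"
        using b(4)[of j] npos[of j] by (intro divide_right_mono mult_left_mono power_mono) auto
      also have "\<dots> = 32 * real e ^ 3 * c\<^sup>2 * real (n j) powr (- (1 - 2 * \<delta>))"
      proof -
        have sq: "(real (n j) powr \<delta>)\<^sup>2 = real (n j) powr (2 * \<delta>)"
          unfolding power2_eq_square mult_2 by (rule powr_add[symmetric])
        have "real (n j) powr (2 * \<delta>) / real (n j) = real (n j) powr (2 * \<delta> - 1)"
          using npos[of j] by (simp add: powr_diff)
        moreover have "- (1 - 2 * \<delta>) = 2 * \<delta> - 1" by simp
        ultimately show ?thesis by (simp only: power_mult_distrib sq times_divide_eq_right[symmetric] mult.assoc)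
      qed
      finally show ?thesis .
    qed
    have "(\<lambda>j. 32 * real e ^ 3 * c\<^sup>2 * real (n j) powr (- (1 - 2 * \<delta>))) \<longlonglongrightarrow> 32 * real e ^ 3 * c\<^sup>2 * 0"
      using \<delta>(1) n_top by (intro tendsto_mult tendsto_const tendsto_neg_powr) auto
    then have lim: "(\<lambda>j. 32 * real e ^ 3 * c\<^sup>2 * real (n j) powr (- (1 - 2 * \<delta>))) \<longlonglongrightarrow> 0" by simp
    have "(\<lambda>j. (1 / \<sigma> j)\<^sup>2) \<longlonglongrightarrow> 0"
    proof (rule tendsto_sandwich[OF _ _ tendsto_const lim])
      show "\<forall>\<^sub>F j in sequentially. (1 / \<sigma> j)\<^sup>2 \<le> 32 * real e ^ 3 * c\<^sup>2 * real (n j) powr (- (1 - 2 * \<delta>))"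
        by (intro always_eventually allI up)
    qed simp
    then have "(\<lambda>j. sqrt ((1 / \<sigma> j)\<^sup>2)) \<longlonglongrightarrow> sqrt 0" by (rule tendsto_real_sqrt)
    then show ?thesis using \<sigma>(1) by (simp add: less_imp_le)
  qed
  define cc where "cc j = real (l j) * (real (n j) - real (m j)) / real (n j)" for j
  define r where "r j i = (real (\<xi> j i) - cc j) / \<sigma> j" for j i
  have eq: "scaled_hahn_eq e (1 / \<sigma> j) (1 / real (n j)) (\<rho> j) (\<lambda>x. \<Prod>i<e. x - r j i)" for j
  proof -
    have "(\<Prod>i<e. x - r j i) = (\<Prod>i<e. (cc j + \<sigma> j * x) - real (\<xi> j i)) / \<sigma> j ^ e" for x
    proof -
      have "(\<Prod>i<e. x - r j i) = (\<Prod>i<e. ((cc j + \<sigma> j * x) - real (\<xi> j i)) / \<sigma> j)"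
        using \<sigma>(1)[of j] by (intro prod.cong refl) (simp add: r_def field_simps)
      then show ?thesis by (simp add: prod_dividef)
    qed
    moreover have "scaled_hahn_eq e (1 / \<sigma> j) (1 / real (n j)) (\<rho> j) (\<lambda>x. (\<Prod>i<e. (cc j + \<sigma> j * x) - real (\<xi> j i)) / \<sigma> j ^ e)"
      unfolding \<rho>_def cc_def by (rule scaled_hahn_eq_of_hahn_op[OF _ \<sigma> op[rule_format]]) (use npos[of j] in simp)
    ultimately show ?thesis by simp
  qed
  have int: "(r j i1 + r j i2 - (r j i3 + r j i4)) / (1 / \<sigma> j) \<in> \<int>" for j i1 i2 i3 i4
  proof -
    have "(r j i1 + r j i2 - (r j i3 + r j i4)) / (1 / \<sigma> j) =
       real_of_int (int (\<xi> j i1) + int (\<xi> j i2) - (int (\<xi> j i3) + int (\<xi> j i4)))"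
      using \<sigma>(1)[of j] by (simp add: r_def field_simps)
    then show ?thesis by (simp only: Ints_of_int)
  qed
  have "1 / \<sigma> j \<noteq> 0" for j using \<sigma>(1)[of j] by simp
  from scaled_hahn_roots_contradiction[OF e h this nu rho0 rho1 eq int] show False .
qed

section \<open>Finiteness of the set of classes\<close>

lemma finite_quotient_of_finite_image:
  assumes R: "equiv UNIV R" and fin: "finite (\<pi> ` S)"
    and rel: "\<And>p q. p \<in> S \<Longrightarrow> q \<in> S \<Longrightarrow> \<pi> p = \<pi> q \<Longrightarrow> (p, q) \<in> R"
  shows "finite (S // R)"
proof (rule finite_subset[OF _ finite_imageI[OF fin]])
  show "S // R \<subseteq> (\<lambda>k. R `` {SOME p. p \<in> S \<and> \<pi> p = k}) ` (\<pi> ` S)"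
  proof
    fix X assume "X \<in> S // R"
    then obtain p where p: "p \<in> S" "X = R `` {p}" by (rule quotientE)
    let ?q = "SOME q. q \<in> S \<and> \<pi> q = \<pi> p"
    have "?q \<in> S \<and> \<pi> ?q = \<pi> p" by (rule someI[of _ p]) (use p in simp)
    then have "R `` {p} = R `` {?q}" using rel[OF p(1), of ?q] by (intro equiv_class_eq[OF R]) simp
    then show "X \<in> (\<lambda>k. R `` {SOME p. p \<in> S \<and> \<pi> p = k}) ` (\<pi> ` S)" using p by blast
  qed
qed

text \<open>Since Y meets both of its shells, it determines the pair l < m. Uniqueness then applies
  on Y, and both weights are 0 elsewhere.\<close>

lemma tight_designs_on_same_support:
  assumes x: "x \<in> cube n"
    and 1: "tight_relative_design n x e l m Y \<omega>" "1 \<le> e" "e \<le> l" "l < m" "m \<le> n - l"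
    and 2: "tight_relative_design n x e l' m' Y \<omega>'" "e \<le> l'" "l' < m'" "m' \<le> n - l'"
  shows "((n, Y, \<omega>), (n, Y, \<omega>')) \<in> scaling_rel"
proof -
  have d: "tight_shell_design {..<n} (flips x ` Y) (\<lambda>A. \<omega> (unflip x A)) l m e"
    by (rule tight_shell_design_of_tight_relative_design[OF x 1])
  have d': "tight_shell_design {..<n} (flips x ` Y) (\<lambda>A. \<omega>' (unflip x A)) l' m' e"
    by (rule tight_shell_design_of_tight_relative_design[OF x 2(1) 1(2) 2(2-4)])
  interpret d: tight_shell_design "{..<n}" "flips x ` Y" "\<lambda>A. \<omega> (unflip x A)" l m e by (rule d)
  interpret d': tight_shell_design "{..<n}" "flips x ` Y" "\<lambda>A. \<omega>' (unflip x A)" l' m' e by (rule d')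
  have "l = l' \<or> l = m'" "m = l' \<or> m = m'" using d.meets d'.sizes by metis+
  then have "l' = l" "m' = m" using 1(4) 2(3) d'.meets d.sizes by auto
  then obtain a where a: "a > 0" "\<forall>A\<in>flips x ` Y. \<omega>' (unflip x A) = a * \<omega> (unflip x A)"
    using tight_shell_design_unique[OF d, of "\<lambda>A. \<omega>' (unflip x A)"] d' by blast
  have Y: "Y = {y \<in> cube n. \<omega> y > 0}" "Y = {y \<in> cube n. \<omega>' y > 0}"
    and nonneg: "\<And>y. y \<in> cube n \<Longrightarrow> \<omega> y \<ge> 0" "\<And>y. y \<in> cube n \<Longrightarrow> \<omega>' y \<ge> 0"
    and off: "\<And>y. y \<notin> cube n \<Longrightarrow> \<omega> y = 0" "\<And>y. y \<notin> cube n \<Longrightarrow> \<omega>' y = 0"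
    using 1(1) 2(1) unfolding tight_relative_design_def relative_design_def weighted_subset_def by blast+
  have "\<omega>' y = a * \<omega> y" for y
  proof (cases "y \<in> Y")
    case True
    then have "unflip x (flips x y) = y" using x Y(1) by (intro unflip_flips) (auto simp: cube_def)
    then show ?thesis using a(2) True by (metis imageI)
  next
    case False
    have "\<omega> y = 0" using False Y(1) nonneg(1)[of y] off(1)[of y] by (cases "y \<in> cube n") auto
    moreover have "\<omega>' y = 0" using False Y(2) nonneg(2)[of y] off(2)[of y] by (cases "y \<in> cube n") auto
    ultimately show ?thesis by simp
  qed
  then show ?thesis using a(1) unfolding scaling_rel_def by auto
qed

theorem theorem7p1:
  fixes \<delta> :: real
  assumes "0 < \<delta>" and "\<delta> < 1 / 2"
  shows "\<exists>e0 :: nat. e0 > 0 \<and>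
    (\<forall>(e :: nat) (c :: real) (x :: nat \<Rightarrow> vertex).
       e \<ge> e0 \<longrightarrow> c > 0 \<longrightarrow> (\<forall>n. x n \<in> cube n) \<longrightarrow>
       finite ({(n, Y, \<omega>). \<exists>l m. tight_relative_design n (x n) e l m Y \<omega> \<and>
                   e \<le> l \<and> l < m \<and> m \<le> n - l \<and> real l < c * real n powr \<delta>}
               // scaling_rel))"
proof (intro exI conjI allI impI)
  \<comment> \<open>The condition 1 / (1 - 2 * \<delta>) < e amounts to \<delta> * e < (e - 1) / 2,
    which is at most e div 2 for either parity; 27 is the bound assumed for close Hermite
    zeros.\<close>
  show "0 < nat \<lceil>1 / (1 - 2 * \<delta>)\<rceil> + 27" by simp
  fix e :: nat and c :: real and x :: "nat \<Rightarrow> vertex"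
  assume e: "nat \<lceil>1 / (1 - 2 * \<delta>)\<rceil> + 27 \<le> e" and c: "c > 0" and x: "\<forall>n. x n \<in> cube n"
  let ?S = "{(n, Y, \<omega>). \<exists>l m. tight_relative_design n (x n) e l m Y \<omega> \<and>
                   e \<le> l \<and> l < m \<and> m \<le> n - l \<and> real l < c * real n powr \<delta>}"
  \<comment> \<open>Forgetting the weight loses only a scalar, and cubes of bounded dimension have
    finitely many supports.\<close>
  let ?\<pi> = "\<lambda>(n :: nat, Y :: vertex set, \<omega> :: vertex \<Rightarrow> real). (n, Y)"
  have "1 / (1 - 2 * \<delta>) < real e" using e by linarith
  then have "1 < real e * (1 - 2 * \<delta>)" using assms(2) by (simp add: field_simps)
  moreover have "real e - 1 \<le> 2 * real (e div 2)" by linarith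
  ultimately have "\<delta> * real e < real (e div 2)" by (simp add: algebra_simps)
  moreover have "e \<ge> 27" using e by simp
  ultimately obtain n0 where n0: "\<forall>n l m Y \<omega>. tight_shell_design {..<n} Y \<omega> l m e \<longrightarrow> real l < c * real n powr \<delta> \<longrightarrow> n < n0"
    using bounded_parameters[OF assms(2) _ c] by blast
  show "finite (?S // scaling_rel)"
  proof (rule finite_quotient_of_finite_image[OF equiv_scaling_rel, where \<pi> = ?\<pi>])
    have "?\<pi> ` ?S \<subseteq> (SIGMA n:{..<n0}. Pow (cube n))"
    proof (clarsimp)
      fix n Y \<omega> l m
      assume d: "tight_relative_design n (x n) e l m Y \<omega>" "e \<le> l" "l < m" "m \<le> n - l" "real l < c * real n powr \<delta>"
      have "tight_shell_design {..<n} (flips (x n) ` Y) (\<lambda>A. \<omega> (unflip (x n) A)) l m e"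
        by (rule tight_shell_design_of_tight_relative_design[OF x[rule_format] d(1) _ d(2-4)]) (use e in simp)
      then have "n < n0" using d(5) by (rule n0[rule_format])
      moreover have "Y \<subseteq> cube n"
        using d(1) unfolding tight_relative_design_def relative_design_def weighted_subset_def by blast
      ultimately show "n < n0 \<and> Y \<subseteq> cube n" by simp
    qed
    then show "finite (?\<pi> ` ?S)" by (rule finite_subset) (auto simp: finite_cube)
    fix p q assume "p \<in> ?S" "q \<in> ?S" "?\<pi> p = ?\<pi> q"
    then obtain n Y \<omega> \<omega>' l m l' m' where pq: "p = (n, Y, \<omega>)" "q = (n, Y, \<omega>')"
      and d: "tight_relative_design n (x n) e l m Y \<omega>" "e \<le> l" "l < m" "m \<le> n - l"
      and d': "tight_relative_design n (x n) e l' m' Y \<omega>'" "e \<le> l'" "l' < m'" "m' \<le> n - l'"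
      by auto
    show "(p, q) \<in> scaling_rel"
      unfolding pq by (rule tight_designs_on_same_support[OF x[rule_format] d(1) _ d(2-4) d']) (use e in simp)
  qed
qed

end
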